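(* Let $U_0\subset\mathbb{R}^n$ be a domain, let $D\subset U_0\times\mathbb{R}^m$ be a strictly convex family of bounded domains over $U_0$, and let $\varphi$ be a $C^2$ convex function defined on some neighborhood of the closure of $D$ in $U_0\times\mathbb{R}^m$. Then the function $\tilde\varphi$ defined by $$e^{-\tilde\varphi(t)}=\int_{D_t}e^{-\varphi(t,x)}\,d\lambda_x$$ is a strictly convex function on $U_0$.
   Context: Let $p_0:\mathbb{R}^n\times\mathbb{R}^m\to\mathbb{R}^n$ be the natural projection and $D_t=p_0^{-1}(t)\cap D$, regarded as a subset of $\mathbb{R}^m$; $d\lambda_x$ is Lebesgue measure on $\mathbb{R}^m$. A strictly convex family of domains over $U_0$ is a convex domain $D\subset U_0\times\mathbb{R}^m$ with $p_0(D)=U_0$ for which there exists a $C^2$ strictly convex function $\rho_0(t,x)$ on some neighborhood $\tilde D$ of $\overline D$ (closure in $U_0\times\mathbb{R}^m$) such that $D=\{(t,x)\in\tilde D\mid\rho_0(t,x)<0\}$ and, for every $t\in U_0$, the differential of $x\mapsto\rho_0(t,x)$ is nonzero at every point of $\partial D_t$. It is a family of bounded domains if every $D_t$ is bounded. A $C^2$ function is called strictly convex if its Hessian is positive definite everywhere. *)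

theory Defs
  imports "HOL-Analysis.Analysis"
begin

definition is_domain :: "'a::topological_space set \<Rightarrow> bool" where
  "is_domain S \<longleftrightarrow> open S \<and> connected S \<and> S \<noteq> {}"

(* D1 is the differential and D2 the Hessian (as a bilinear form, curried).
   Derivatives are two-sided, so the notion is meant for open S. *)
definition has_C2_derivs_on ::
  "('a::euclidean_space \<Rightarrow> real) \<Rightarrow> ('a \<Rightarrow> 'a \<Rightarrow>\<^sub>L real) \<Rightarrow> ('a \<Rightarrow> 'a \<Rightarrow>\<^sub>L 'a \<Rightarrow>\<^sub>L real) \<Rightarrow> 'a set \<Rightarrow> bool"
where
  "has_C2_derivs_on f D1 D2 S \<longleftrightarrow>
     (\<forall>x\<in>S. (f has_derivative blinfun_apply (D1 x)) (at x)) \<and>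
     (\<forall>x\<in>S. (D1 has_derivative blinfun_apply (D2 x)) (at x)) \<and>
     continuous_on S D2"

definition C2_on :: "'a::euclidean_space set \<Rightarrow> ('a \<Rightarrow> real) \<Rightarrow> bool" where
  "C2_on S f \<longleftrightarrow> (\<exists>D1 D2. has_C2_derivs_on f D1 D2 S)"

definition C2_strictly_convex_on :: "'a::euclidean_space set \<Rightarrow> ('a \<Rightarrow> real) \<Rightarrow> bool" where
  "C2_strictly_convex_on S f \<longleftrightarrow>
     (\<exists>D1 D2. has_C2_derivs_on f D1 D2 S \<and>
        (\<forall>x\<in>S. \<forall>v. v \<noteq> 0 \<longrightarrow> 0 < blinfun_apply (blinfun_apply (D2 x) v) v))"

(* The set S need not be convex, whereas convex_on S f entails convexity of S.  A function
   on S is called convex if it is convex on every convex subset of S, equivalently on every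
   segment contained in S. *)
definition C2_convex_on :: "'a::euclidean_space set \<Rightarrow> ('a \<Rightarrow> real) \<Rightarrow> bool" where
  "C2_convex_on S f \<longleftrightarrow> C2_on S f \<and> (\<forall>C. convex C \<and> C \<subseteq> S \<longrightarrow> convex_on C f)"

definition fibre :: "('a \<times> 'b) set \<Rightarrow> 'a \<Rightarrow> 'b set" where
  "fibre D t = {x. (t, x) \<in> D}"

(* An open neighbourhood, inside U \<times> UNIV, of the closure of D relative to U \<times> UNIV. *)
definition nbhd_of_rel_closure ::
  "'a::topological_space set \<Rightarrow> ('a \<times> 'b::topological_space) set \<Rightarrow> ('a \<times> 'b) set \<Rightarrow> bool"
where
  "nbhd_of_rel_closure U D W \<longleftrightarrow>
     open W \<and> closure D \<inter> (U \<times> UNIV) \<subseteq> W \<and> W \<subseteq> U \<times> UNIV"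

definition strictly_convex_family ::
  "(real^'n) set \<Rightarrow> ((real^'n) \<times> (real^'m)) set \<Rightarrow> bool"
where
  "strictly_convex_family U D \<longleftrightarrow>
     is_domain D \<and> convex D \<and> D \<subseteq> U \<times> UNIV \<and> fst ` D = U \<and>
     (\<exists>W \<rho>. nbhd_of_rel_closure U D W \<and> C2_strictly_convex_on W \<rho> \<and>
        D = {(t, x) \<in> W. \<rho> (t, x) < 0} \<and>
        (\<forall>t\<in>U. \<forall>x\<in>frontier (fibre D t).
           frechet_derivative (\<lambda>y. \<rho> (t, y)) (at x) \<noteq> (\<lambda>_. 0)))"

definition strictly_convex_family_of_bounded_domains ::
  "(real^'n) set \<Rightarrow> ((real^'n) \<times> (real^'m)) set \<Rightarrow> bool"
where
  "strictly_convex_family_of_bounded_domains U D \<longleftrightarrow>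
     strictly_convex_family U D \<and> (\<forall>t\<in>U. bounded (fibre D t))"

definition fibre_integral ::
  "((real^'n) \<times> (real^'m)) set \<Rightarrow> ((real^'n) \<times> (real^'m) \<Rightarrow> real) \<Rightarrow> real^'n \<Rightarrow> real"
where
  "fibre_integral D \<phi> t = (LINT x:fibre D t|lebesgue. exp (- \<phi> (t, x)))"

(* Solves exp (- marginal D \<phi> t) = fibre_integral D \<phi> t whenever the right-hand side is positive;
   ln takes junk values otherwise. *)
definition marginal ::
  "((real^'n) \<times> (real^'m)) set \<Rightarrow> ((real^'n) \<times> (real^'m) \<Rightarrow> real) \<Rightarrow> real^'n \<Rightarrow> real"
where
  "marginal D \<phi> t = - ln (fibre_integral D \<phi> t)"

end

(* Let F t be the integral of exp (- phi) over the fibre of D over t.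

   Regularity. Fix x0 in the fibre over t0. By convexity of rho along rays, the exit radius r(t, z) of the
   ray from x0 in direction z is a simple zero of rho, hence C2 in (t, z) by the implicit function theorem.
   In polar coordinates, with a weighted spherical shell in place of the sphere, F is up to a constant factor
   the integral of r(t, z)^m u^(m-1) exp (- phi (t, x0 + u r(t, z) z)) over a fixed box of pairs (z, u); this
   integrand is C2 in t, so one may differentiate twice under the integral sign.

   Strict convexity. For a, b = t +- h v let M be the midpoint set of the fibres over a and b. The
   Prekopa-Leindler inequality gives sqrt (F a F b) <= integral of exp (- phi (t, _)) over M. The positive
   Hessian of rho forces rho (t, _) <= - c h^2 on M, so the fibre over t even contains a dilate of M by
   1 + c' h^2. Hence F t >= sqrt (F a F b) + c'' h^2, and - ln F has second differences of order h^2. *)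

theory Submission
  imports Defs
begin

section \<open>The Prekopa-Leindler inequality\<close>

text \<open>The integrals run over domains that move with t, whereas differentiation under the
  integral sign needs a fixed domain; this is what the radial substitution supplies. The sphere is
  thickened to a shell so that rays are indexed by an open set of vectors z: no surface measure is
  involved, and smoothness of r(t, z) is a statement on an open subset of a vector space. The shell
  weight depends only on the variable of integration, so its continuity is enough, and its vanishing
  near z = 0 hides the singularity of r there. A strict inequality at midpoints would not give a
  positive definite Hessian; a deficit of order h^2 with a constant independent of h is needed, and
  Prekopa-Leindler alone yields none. It is therefore applied with a third function supported on M,
  not on the whole fibre over t, and the deficit is the mass of the fibre outside M. The constants
  attached to \<rho> and \<phi> come from compactness of the part of the closure of D over a small
  ball around t.\<close>

text \<open>With a the maximum of \<open>K\<close> and b the minimum of \<open>L\<close>, the sets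
  (K + b) / 2 and (a + L) / 2 both lie in \<open>Z\<close> and meet in at most one point, so their
  measures add up.\<close>

lemma brunn_minkowski_real_compact:
  fixes K L :: "real set"
  assumes K: "compact K" "K \<noteq> {}" and L: "compact L" "L \<noteq> {}" and Z: "Z \<in> sets borel"
    and mid: "\<And>x y. x \<in> K \<Longrightarrow> y \<in> L \<Longrightarrow> (x + y) / 2 \<in> Z"
  shows "emeasure lborel K + emeasure lborel L \<le> 2 * emeasure lborel Z"
proof -
  obtain a where a: "a \<in> K" "\<And>x. x \<in> K \<Longrightarrow> x \<le> a"
    using compact_attains_sup[OF K] by blast
  obtain b where b: "b \<in> L" "\<And>y. y \<in> L \<Longrightarrow> b \<le> y"
    using compact_attains_inf[OF L] by blast
  define A where "A = (\<lambda>x. (1/2) *\<^sub>R x + b/2) ` K"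
  define B where "B = (\<lambda>y. (1/2) *\<^sub>R y + a/2) ` L"
  have cA: "compact A" "compact B" unfolding A_def B_def
    by (intro compact_continuous_image continuous_intros K L)+
  then have mA [measurable]: "A \<in> sets borel" "B \<in> sets borel"
    by (auto simp: borel_compact)
  have KL: "K \<in> sets borel" "L \<in> sets borel" using K L by (auto simp: borel_compact)
  have eA: "emeasure lborel A = inverse 2 * emeasure lborel K"
    using emeasure_lebesgue_affine[of "1/2" "b/2" K] mA KL by (simp add: A_def ennreal_half)
  have eB: "emeasure lborel B = inverse 2 * emeasure lborel L"
    using emeasure_lebesgue_affine[of "1/2" "a/2" L] mA KL by (simp add: B_def ennreal_half)
  have "A \<inter> B \<subseteq> {(a + b)/2}"
  proof
    fix z assume "z \<in> A \<inter> B"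
    then obtain x y where "x \<in> K" "y \<in> L" "z = x/2 + b/2" "z = y/2 + a/2"
      by (auto simp: A_def B_def)
    then show "z \<in> {(a + b)/2}" using a(2)[of x] b(2)[of y] by (auto simp: field_simps)
  qed
  then have AB0: "emeasure lborel (A \<inter> B) = 0"
    using emeasure_mono[of "A \<inter> B" "{(a+b)/2}" lborel] by simp
  have "A \<union> B \<subseteq> Z"
    using mid[OF _ b(1)] mid[OF a(1)] by (auto simp: A_def B_def add_divide_distrib add.commute)
  then have "emeasure lborel (A \<union> B) \<le> emeasure lborel Z"
    by (intro emeasure_mono) (use Z in auto)
  moreover have "emeasure lborel (A \<union> B) = emeasure lborel A + emeasure lborel B"
    using emeasure_Un_Int[of A lborel B] AB0 by simp
  ultimately have "inverse 2 * emeasure lborel K + inverse 2 * emeasure lborel L \<le> emeasure lborel Z"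
    using eA eB by simp
  then have "2 * (inverse 2 * emeasure lborel K + inverse 2 * emeasure lborel L) \<le> 2 * emeasure lborel Z"
    by (rule mult_left_mono) simp
  moreover have "(2::ennreal) * inverse 2 = 1"
    using ennreal_divide_self[of 2] by (simp add: divide_ennreal_def)
  ultimately show ?thesis
    by (simp add: distrib_left mult.assoc[symmetric])
qed

text \<open>Inner regularity reduces this to compact sets: boundedness makes the closed inner
  approximations compact.\<close>

lemma brunn_minkowski_real_bounded:
  fixes X Y :: "real set"
  assumes X: "X \<in> sets borel" "bounded X" "X \<noteq> {}" and Y: "Y \<in> sets borel" "bounded Y" "Y \<noteq> {}"
    and Z: "Z \<in> sets borel"
    and mid: "\<And>x y. x \<in> X \<Longrightarrow> y \<in> Y \<Longrightarrow> (x + y) / 2 \<in> Z"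
  shows "emeasure lborel X + emeasure lborel Y \<le> 2 * emeasure lborel Z"
proof -
  have inner: "\<exists>K. compact K \<and> K \<noteq> {} \<and> K \<subseteq> X \<and> emeasure lborel X \<le> emeasure lborel K + ennreal e"
    if X: "X \<in> sets borel" "bounded X" "X \<noteq> {}" and e: "0 < e" for X :: "real set" and e
  proof -
    obtain x where x: "x \<in> X" using X by auto
    obtain T where T: "closed T" "T \<subseteq> X" "emeasure lebesgue (X - T) < ennreal e"
      using sets_lebesgue_inner_closed[of X e] X(1) e by (metis sets_completionI_sets sets_lborel)
    \<comment> \<open>The point \<open>x\<close> keeps the approximation nonempty; \<open>T\<close>
      may be empty, for instance when \<open>X\<close> is a null set.\<close>
    have cT: "compact (insert x T)"
      using T(1) bounded_subset[OF X(2) T(2)] by (simp add: compact_eq_bounded_closed)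
    have Tb: "T \<in> sets borel" using T by (simp add: borel_closed)
    have "emeasure lborel X \<le> emeasure lborel (insert x T \<union> (X - T))"
      by (intro emeasure_mono) (use X Tb in auto)
    also have "\<dots> \<le> emeasure lborel (insert x T) + emeasure lborel (X - T)"
      by (intro emeasure_subadditive) (use X Tb in auto)
    also have "\<dots> \<le> emeasure lborel (insert x T) + ennreal e"
      using T(3) X Tb by (intro add_left_mono) simp
    finally show ?thesis using cT T(2) x by (intro exI[of _ "insert x T"]) auto
  qed
  show ?thesis
  proof (rule ennreal_le_epsilon)
    fix e :: real assume e: "0 < e"
    obtain K where K: "compact K" "K \<noteq> {}" "K \<subseteq> X" "emeasure lborel X \<le> emeasure lborel K + ennreal (e/2)"
      using inner[OF X, of "e/2"] e by auto
    obtain L where L: "compact L" "L \<noteq> {}" "L \<subseteq> Y" "emeasure lborel Y \<le> emeasure lborel L + ennreal (e/2)"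
      using inner[OF Y, of "e/2"] e by auto
    have "emeasure lborel X + emeasure lborel Y
      \<le> (emeasure lborel K + emeasure lborel L) + (ennreal (e/2) + ennreal (e/2))"
      using add_mono[OF K(4) L(4)] by (simp add: ac_simps)
    also have "ennreal (e/2) + ennreal (e/2) = ennreal e"
      using e by (simp flip: ennreal_plus)
    also have "emeasure lborel K + emeasure lborel L \<le> 2 * emeasure lborel Z"
      using K L mid Z by (intro brunn_minkowski_real_compact) auto
    finally show "emeasure lborel X + emeasure lborel Y \<le> 2 * emeasure lborel Z + ennreal e"
      by (simp add: add_right_mono)
  qed
qed

lemma brunn_minkowski_real:
  fixes X Y :: "real set"
  assumes X: "X \<in> sets borel" "X \<noteq> {}" and Y: "Y \<in> sets borel" "Y \<noteq> {}" and Z: "Z \<in> sets borel"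
    and mid: "\<And>x y. x \<in> X \<Longrightarrow> y \<in> Y \<Longrightarrow> (x + y) / 2 \<in> Z"
  shows "emeasure lborel X + emeasure lborel Y \<le> 2 * emeasure lborel Z"
proof -
  obtain x0 y0 where x0: "x0 \<in> X" and y0: "y0 \<in> Y" using X Y by auto
  \<comment> \<open>\<open>N\<close> makes every window \<open>I n\<close> contain both
    \<open>x0\<close> and \<open>y0\<close>, so no truncated set is empty.\<close>
  define N where "N = max \<bar>x0\<bar> \<bar>y0\<bar>"
  define I where "I n = {-(N + real n)..N + real n}" for n
  have incI: "incseq (\<lambda>n. S \<inter> I n)" for S by (auto simp: incseq_def I_def)
  have UI: "(\<Union>n. S \<inter> I n) = S" for S :: "real set"
  proof -
    have "\<exists>n. x \<in> I n" for x
    proof -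
      obtain n where "\<bar>x\<bar> \<le> real n" using real_arch_simple by blast
      moreover have "0 \<le> N" by (simp add: N_def)
      ultimately have "x \<in> I n" unfolding I_def atLeastAtMost_iff by linarith
      then show ?thesis ..
    qed
    then show ?thesis by auto
  qed
  have lim: "(\<lambda>n. emeasure lborel (S \<inter> I n)) \<longlonglongrightarrow> emeasure lborel S" if "S \<in> sets borel" for S
  proof -
    have "range (\<lambda>n. S \<inter> I n) \<subseteq> sets lborel" using that by (auto simp: I_def)
    from Lim_emeasure_incseq[OF this incI] show ?thesis by (simp only: UI)
  qed
  have "(\<lambda>n. emeasure lborel (X \<inter> I n) + emeasure lborel (Y \<inter> I n))
      \<longlonglongrightarrow> emeasure lborel X + emeasure lborel Y"
    by (intro tendsto_add lim X Y)
  moreover have "emeasure lborel (X \<inter> I n) + emeasure lborel (Y \<inter> I n) \<le> 2 * emeasure lborel Z" for n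
  proof (rule brunn_minkowski_real_bounded)
    show "X \<inter> I n \<noteq> {}" "Y \<inter> I n \<noteq> {}"
    proof -
      have "x0 \<in> I n" "y0 \<in> I n" by (auto simp: I_def N_def)
      then show "X \<inter> I n \<noteq> {}" "Y \<inter> I n \<noteq> {}" using x0 y0 by auto
    qed
    show "bounded (X \<inter> I n)" "bounded (Y \<inter> I n)" unfolding I_def
      by (auto intro: bounded_subset[OF bounded_closed_interval])
  qed (use X Y Z mid in \<open>auto simp: I_def\<close>)
  ultimately show ?thesis by (intro LIMSEQ_le_const2) auto
qed

lemma emeasure_lborel_greaterThan_real: "emeasure lborel {0::real<..} = \<infinity>"
proof (rule ccontr)
  assume *: "emeasure lborel {0::real<..} \<noteq> \<infinity>"
  then obtain r where r: "emeasure lborel {0::real<..} = ennreal r" "0 \<le> r"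
    by (cases "emeasure lborel {0::real<..}") auto
  have "emeasure lborel {0<..<r + 1} \<le> emeasure lborel {0::real<..}"
    by (rule emeasure_mono) auto
  with r show False by simp
qed

text \<open>Fubini for the indicator of the region between 0 and the graph; its section over x has
  length \<open>f x\<close>, also when \<open>f x\<close> is infinite.\<close>

lemma nn_integral_layer_cake:
  fixes f :: "real \<Rightarrow> ennreal"
  assumes [measurable]: "f \<in> borel_measurable borel"
  shows "(\<integral>\<^sup>+x. f x \<partial>lborel) = (\<integral>\<^sup>+s. indicator {0<..} s * emeasure lborel {x. ennreal s < f x} \<partial>lborel)"
proof -
  define J :: "real \<Rightarrow> real \<Rightarrow> ennreal" where "J s x = (if 0 < s \<and> ennreal s < f x then 1 else 0)" for s x
  have [measurable]: "(\<lambda>(s, x). J s x) \<in> borel_measurable (lborel \<Otimes>\<^sub>M lborel)"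
  proof -
    have [measurable]: "f \<in> lborel \<rightarrow>\<^sub>M borel" by simp
    show ?thesis unfolding J_def split_beta by measurable
  qed
  have Jx: "(\<integral>\<^sup>+s. J s x \<partial>lborel) = f x" for x
  proof (cases "f x")
    case (real r)
    have "(\<integral>\<^sup>+s. J s x \<partial>lborel) = (\<integral>\<^sup>+s. indicator {0<..<r} s \<partial>lborel)"
      by (intro nn_integral_cong) (use real in \<open>auto simp: J_def ennreal_less_iff\<close>)
    then show ?thesis using real by simp
  next
    case top
    have "(\<integral>\<^sup>+s. J s x \<partial>lborel) = (\<integral>\<^sup>+s. indicator {0<..} (s::real) \<partial>lborel)"
      by (intro nn_integral_cong) (use top in \<open>auto simp: J_def\<close>)
    then show ?thesis using top by (simp add: emeasure_lborel_greaterThan_real)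
  qed
  have Js: "(\<integral>\<^sup>+x. J s x \<partial>lborel) = indicator {0<..} s * emeasure lborel {x. ennreal s < f x}" for s
  proof -
    have [measurable]: "{x. ennreal s < f x} \<in> sets lborel" by measurable
    have "(\<integral>\<^sup>+x. J s x \<partial>lborel) = (\<integral>\<^sup>+x. indicator {0<..} s * indicator {x. ennreal s < f x} x \<partial>lborel)"
      by (intro nn_integral_cong) (auto simp: J_def)
    also have "\<dots> = indicator {0<..} s * (\<integral>\<^sup>+x. indicator {x. ennreal s < f x} x \<partial>lborel)"
      by (rule nn_integral_cmult) measurable
    finally show ?thesis by simp
  qed
  have "(\<integral>\<^sup>+x. \<integral>\<^sup>+s. J s x \<partial>lborel \<partial>lborel) = (\<integral>\<^sup>+s. \<integral>\<^sup>+x. J s x \<partial>lborel \<partial>lborel)"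
    by (rule lborel_pair.Fubini') fact
  then show ?thesis unfolding Jx Js .
qed

text \<open>Equal suprema make the superlevel sets of \<open>f\<close> and \<open>g\<close> at each
  level s in (0, 1) both nonempty; their midpoint set lies in the superlevel set of
  \<open>h\<close>, and the one-dimensional Brunn-Minkowski inequality is integrated over s. Levels
  s \<ge> 1 contribute nothing to the left-hand side.\<close>

lemma prekopa_leindler_real_sup1:
  fixes f g h :: "real \<Rightarrow> ennreal"
  assumes [measurable]: "f \<in> borel_measurable borel" "g \<in> borel_measurable borel" "h \<in> borel_measurable borel"
    and f1: "(SUP x. f x) = 1" and g1: "(SUP x. g x) = 1"
    and mid: "\<And>x y. f x * g y \<le> (h ((x + y) / 2))\<^sup>2"
  shows "(\<integral>\<^sup>+x. f x \<partial>lborel) + (\<integral>\<^sup>+x. g x \<partial>lborel) \<le> 2 * (\<integral>\<^sup>+x. h x \<partial>lborel)"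
proof -
  have *: "indicator {0<..} s * emeasure lborel {x. ennreal s < f x} + indicator {0<..} s * emeasure lborel {x. ennreal s < g x}
     \<le> 2 * (indicator {0<..} s * emeasure lborel {x. ennreal s < h x})" for s :: real
  proof (cases "0 < s \<and> s < 1")
    case True
    then have s: "0 < s" "ennreal s < 1" by (auto simp: ennreal_less_iff simp flip: ennreal_1)
    have "\<exists>x. ennreal s < f x" "\<exists>x. ennreal s < g x"
      using s f1 g1 less_SUP_iff[of "ennreal s" f UNIV] less_SUP_iff[of "ennreal s" g UNIV] by auto
    moreover have "ennreal s < h ((x + y) / 2)" if "ennreal s < f x" "ennreal s < g y" for x y
    proof (rule ccontr)
      assume "\<not> ennreal s < h ((x + y) / 2)"
      then have "(h ((x + y) / 2))\<^sup>2 \<le> (ennreal s)\<^sup>2" by (intro power_mono) auto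
      also have "\<dots> = ennreal s * ennreal s" by (simp add: power2_eq_square)
      also have "\<dots> < f x * ennreal s"
        using that s(1) by (intro ennreal_mult_strict_right_mono) auto
      also have "\<dots> \<le> f x * g y"
        using that by (intro mult_left_mono) auto
      finally show False using mid[of x y] by simp
    qed
    ultimately have "emeasure lborel {x. ennreal s < f x} + emeasure lborel {x. ennreal s < g x}
       \<le> 2 * emeasure lborel {x. ennreal s < h x}"
      by (intro brunn_minkowski_real) auto
    then show ?thesis using s by simp
  next
    case False
    have "{x. ennreal s < f x} = {}" "{x. ennreal s < g x} = {}" if "1 \<le> s"
    proof -
      have "1 \<le> ennreal s" using that by simp
      moreover have "f x \<le> 1" "g x \<le> 1" for x
        using f1 g1 by (metis SUP_upper UNIV_I)+
      ultimately show "{x. ennreal s < f x} = {}" "{x. ennreal s < g x} = {}"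
        by (auto simp: not_less intro: order_trans[of _ 1])
    qed
    then show ?thesis using False by (cases "0 < s") auto
  qed
  have m: "(\<lambda>s. indicator {0<..} s * emeasure lborel {x. ennreal s < F x}) \<in> borel_measurable lborel"
    if [measurable]: "F \<in> borel_measurable borel" for F :: "real \<Rightarrow> ennreal"
    by measurable
  show ?thesis
    unfolding nn_integral_layer_cake[OF assms(1)] nn_integral_layer_cake[OF assms(2)] nn_integral_layer_cake[OF assms(3)]
    using m
    by (subst nn_integral_add[symmetric] nn_integral_cmult[symmetric]; simp)+
       (intro nn_integral_mono *)
qed

lemma ennreal_am_gm:
  fixes u v w :: ennreal
  assumes "u + v \<le> 2 * w"
  shows "u * v \<le> w\<^sup>2"
proof (cases "w = \<infinity>")
  case False
  then obtain c where c: "w = ennreal c" "0 \<le> c" by (cases w) auto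
  from assms c have "u + v < top"
    by (intro order_le_less_trans[OF assms]) (simp add: ennreal_mult_less_top)
  then obtain a b where ab: "u = ennreal a" "v = ennreal b" "0 \<le> a" "0 \<le> b"
    by (cases u; cases v) auto
  have "ennreal (a + b) \<le> ennreal (2 * c)"
    using assms unfolding c ab using ab c by (simp add: ennreal_mult)
  then have "a + b \<le> 2 * c" using c by (simp add: ennreal_le_iff)
  then have "(a + b)\<^sup>2 \<le> (2 * c)\<^sup>2" using ab by (intro power_mono) auto
  then have "a * b \<le> c\<^sup>2"
    using zero_le_power2[of "a - b"] by (simp add: power2_eq_square algebra_simps)
  then show ?thesis unfolding c ab using ab c
    by (simp add: ennreal_power flip: ennreal_mult)
qed simp

text \<open>The hypothesis survives scaling \<open>f\<close>, \<open>g\<close>, \<open>h\<close> by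
  1/a, 1/b, 1/c when c is the geometric mean of a and b, so both suprema may be taken to be 1; AM-GM
  then turns the sum into a product.\<close>

lemma prekopa_leindler_real_bounded:
  fixes f g h :: "real \<Rightarrow> ennreal" and K :: real
  assumes [measurable]: "f \<in> borel_measurable borel" "g \<in> borel_measurable borel" "h \<in> borel_measurable borel"
    and bdd: "\<And>x. f x \<le> ennreal K" "\<And>x. g x \<le> ennreal K"
    and mid: "\<And>x y. f x * g y \<le> (h ((x + y) / 2))\<^sup>2"
  shows "(\<integral>\<^sup>+x. f x \<partial>lborel) * (\<integral>\<^sup>+x. g x \<partial>lborel) \<le> (\<integral>\<^sup>+x. h x \<partial>lborel)\<^sup>2"
proof -
  have "(SUP x. f x) \<le> ennreal K" "(SUP x. g x) \<le> ennreal K" using bdd by (auto intro: SUP_least)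
  then obtain a b where a: "(SUP x. f x) = ennreal a" "0 \<le> a" and b: "(SUP x. g x) = ennreal b" "0 \<le> b"
    by (cases "SUP x. f x"; cases "SUP x. g x") (auto simp: top_unique)
  show ?thesis
  proof (cases "a = 0 \<or> b = 0")
    case True
    have "f x \<le> ennreal a" "g x \<le> ennreal b" for x
      using a b by (metis SUP_upper UNIV_I)+
    with True have "(\<forall>x. f x = 0) \<or> (\<forall>x. g x = 0)" by auto
    then show ?thesis by auto
  next
    case False
    then have pos: "0 < a" "0 < b" using a b by auto
    define c where "c = sqrt (a * b)"
    have c: "0 < c" "c\<^sup>2 = a * b" using pos by (auto simp: c_def)
    define F where "F = (\<integral>\<^sup>+x. f x \<partial>lborel)"
    define G where "G = (\<integral>\<^sup>+x. g x \<partial>lborel)"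
    define H where "H = (\<integral>\<^sup>+x. h x \<partial>lborel)"
    have "(\<integral>\<^sup>+x. ennreal (1/a) * f x \<partial>lborel) + (\<integral>\<^sup>+x. ennreal (1/b) * g x \<partial>lborel)
        \<le> 2 * (\<integral>\<^sup>+x. ennreal (1/c) * h x \<partial>lborel)"
    proof (rule prekopa_leindler_real_sup1)
      show "(SUP x. ennreal (1/a) * f x) = 1"
        using a pos by (simp flip: SUP_mult_left_ennreal ennreal_mult)
      show "(SUP x. ennreal (1/b) * g x) = 1"
        using b pos by (simp flip: SUP_mult_left_ennreal ennreal_mult)
      fix x y
      have "ennreal (1/a) * f x * (ennreal (1/b) * g y) = ennreal (1/a) * ennreal (1/b) * (f x * g y)"
        by (simp add: ac_simps)
      also have "ennreal (1/a) * ennreal (1/b) = (ennreal (1/c))\<^sup>2"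
        using pos c by (simp add: power_divide ennreal_power flip: ennreal_mult)
      also have "(ennreal (1/c))\<^sup>2 * (f x * g y) \<le> (ennreal (1/c))\<^sup>2 * (h ((x + y) / 2))\<^sup>2"
        by (intro mult_left_mono mid) simp
      finally show "ennreal (1/a) * f x * (ennreal (1/b) * g y) \<le> (ennreal (1/c) * h ((x + y) / 2))\<^sup>2"
        by (simp add: power_mult_distrib)
    qed measurable
    then have "(ennreal (1/a) * F) * (ennreal (1/b) * G) \<le> (ennreal (1/c) * H)\<^sup>2"
      by (intro ennreal_am_gm) (simp add: nn_integral_cmult F_def G_def H_def)
    then have "ennreal (c\<^sup>2) * ((ennreal (1/a) * F) * (ennreal (1/b) * G)) \<le> ennreal (c\<^sup>2) * (ennreal (1/c) * H)\<^sup>2"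
      by (intro mult_left_mono) auto
    moreover have "ennreal (c\<^sup>2) * ((ennreal (1/a) * F) * (ennreal (1/b) * G))
       = (ennreal (c\<^sup>2) * ennreal (1/a) * ennreal (1/b)) * (F * G)" by (simp only: ac_simps)
    moreover have "ennreal (c\<^sup>2) * ennreal (1/a) * ennreal (1/b) = 1"
      using pos c by (simp flip: ennreal_mult)
    moreover have "ennreal (c\<^sup>2) * (ennreal (1/c) * H)\<^sup>2 = (ennreal (c\<^sup>2) * (ennreal (1/c))\<^sup>2) * H\<^sup>2"
      by (simp add: power_mult_distrib ac_simps)
    moreover have "ennreal (c\<^sup>2) * (ennreal (1/c))\<^sup>2 = 1"
      using c(1) by (simp add: power_divide ennreal_power flip: ennreal_mult)
    ultimately show ?thesis by (simp add: F_def G_def H_def)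
  qed
qed

lemma prekopa_leindler_real:
  fixes f g h :: "real \<Rightarrow> ennreal"
  assumes [measurable]: "f \<in> borel_measurable borel" "g \<in> borel_measurable borel" "h \<in> borel_measurable borel"
    and mid: "\<And>x y. f x * g y \<le> (h ((x + y) / 2))\<^sup>2"
  shows "(\<integral>\<^sup>+x. f x \<partial>lborel) * (\<integral>\<^sup>+x. g x \<partial>lborel) \<le> (\<integral>\<^sup>+x. h x \<partial>lborel)\<^sup>2"
proof -
  define T where "T f n x = min (f x) (ennreal (real n))" for f :: "real \<Rightarrow> ennreal" and n x
  have inc: "incseq (T f)" for f
    by (auto simp: incseq_def T_def le_fun_def intro: min.coboundedI2 ennreal_leI)
  have [measurable]: "T f n \<in> borel_measurable borel" if [measurable]: "f \<in> borel_measurable borel" for f n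
    unfolding T_def by measurable
  have SUPT: "(SUP n. T f n x) = f x" for f x
  proof (cases "f x")
    case (real r)
    obtain n where "r \<le> real n" using real_arch_simple by blast
    then have "T f n x = f x" using real by (simp add: T_def min_def ennreal_leI)
    then show ?thesis
      by (intro antisym SUP_least) (auto simp: T_def intro: SUP_upper2[of n])
  next
    case top
    then have "T f n x = of_nat n" for n by (simp add: T_def ennreal_of_nat_eq_real_of_nat)
    then show ?thesis using top ennreal_SUP_of_nat_eq_top by simp
  qed
  have conv: "(\<integral>\<^sup>+x. f x \<partial>lborel) = (SUP n. \<integral>\<^sup>+x. T f n x \<partial>lborel)"
    if [measurable]: "f \<in> borel_measurable borel" for f :: "real \<Rightarrow> ennreal"
    using nn_integral_monotone_convergence_SUP[OF inc[of f], of lborel] by (simp add: SUPT)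
  \<comment> \<open>Truncation lowers \<open>f\<close> and \<open>g\<close> and so keeps the
    hypothesis with \<open>h\<close> unchanged. The two levels are independent because a product of
    suprema is a double supremum.\<close>
  have le: "(\<integral>\<^sup>+x. T f n x \<partial>lborel) * (\<integral>\<^sup>+x. T g m x \<partial>lborel) \<le> (\<integral>\<^sup>+x. h x \<partial>lborel)\<^sup>2" for n m
  proof (rule prekopa_leindler_real_bounded)
    show "T f n x * T g m y \<le> (h ((x + y) / 2))\<^sup>2" for x y
      using mid[of x y] by (rule order_trans[rotated]) (auto simp: T_def intro!: mult_mono)
    show "T f n x \<le> ennreal (real (max n m))" "T g m x \<le> ennreal (real (max n m))" for x
      by (auto simp: T_def intro!: min.coboundedI2 ennreal_leI)
  qed auto
  have "(\<integral>\<^sup>+x. f x \<partial>lborel) * (\<integral>\<^sup>+x. g x \<partial>lborel)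
      = (SUP m. SUP n. (\<integral>\<^sup>+x. T f n x \<partial>lborel) * (\<integral>\<^sup>+x. T g m x \<partial>lborel))"
    by (simp only: conv[OF assms(1)] conv[OF assms(2)] SUP_mult_left_ennreal SUP_mult_right_ennreal)
  also have "\<dots> \<le> (\<integral>\<^sup>+x. h x \<partial>lborel)\<^sup>2"
    by (intro SUP_least le)
  finally show ?thesis .
qed

section \<open>Several variables, by induction over the coordinates\<close>

interpretation lborel_product: product_sigma_finite "\<lambda>_. lborel :: real measure"
  by standard

text \<open>Integrating out one coordinate preserves the hypothesis, by the one-dimensional
  inequality, so the induction passes to the marginals. The points are extensional functions because
  these make up the product space.\<close>

lemma prekopa_leindler_PiM:
  fixes f g h :: "('i \<Rightarrow> real) \<Rightarrow> ennreal"
  assumes "finite I"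
    and "f \<in> borel_measurable (Pi\<^sub>M I (\<lambda>_. lborel))" "g \<in> borel_measurable (Pi\<^sub>M I (\<lambda>_. lborel))"
      "h \<in> borel_measurable (Pi\<^sub>M I (\<lambda>_. lborel))"
    and "\<And>x y. x \<in> extensional I \<Longrightarrow> y \<in> extensional I \<Longrightarrow> f x * g y \<le> (h (\<lambda>i\<in>I. (x i + y i) / 2))\<^sup>2"
  shows "(\<integral>\<^sup>+x. f x \<partial>Pi\<^sub>M I (\<lambda>_. lborel)) * (\<integral>\<^sup>+x. g x \<partial>Pi\<^sub>M I (\<lambda>_. lborel))
    \<le> (\<integral>\<^sup>+x. h x \<partial>Pi\<^sub>M I (\<lambda>_. lborel))\<^sup>2"
  using assms
proof (induction I arbitrary: f g h rule: finite_induct)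
  case empty
  \<comment> \<open>The empty product is a one-point space of mass 1; its point is the constantly
    undefined function.\<close>
  show ?case
    using empty(4)[of "\<lambda>_. undefined" "\<lambda>_. undefined"]
    by (simp add: PiM_empty nn_integral_count_space_finite restrict_def)
next
  case (insert i I)
  note [measurable] = insert.prems(1-3)
  have sec: "(\<lambda>y. F (x(i := y))) \<in> borel_measurable borel"
    if "F \<in> borel_measurable (Pi\<^sub>M (insert i I) (\<lambda>_. lborel :: real measure))" "x \<in> extensional I"
    for F :: "('i \<Rightarrow> real) \<Rightarrow> ennreal" and x
  proof -
    have "(\<lambda>y. x(i := y)) \<in> lborel \<rightarrow>\<^sub>M Pi\<^sub>M (insert i I) (\<lambda>_. lborel)"
      using that(2) by (intro measurable_fun_upd[where J = I]) (auto simp: space_PiM PiE_def)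
    from measurable_compose[OF this that(1)] show ?thesis by simp
  qed
  have marg: "(\<lambda>x. \<integral>\<^sup>+y. F (x(i := y)) \<partial>lborel) \<in> borel_measurable (Pi\<^sub>M I (\<lambda>_. lborel))"
    if [measurable]: "F \<in> borel_measurable (Pi\<^sub>M (insert i I) (\<lambda>_. lborel :: real measure))"
    for F :: "('i \<Rightarrow> real) \<Rightarrow> ennreal"
    by measurable
  have "(\<integral>\<^sup>+s. f (x(i := s)) \<partial>lborel) * (\<integral>\<^sup>+t. g (y(i := t)) \<partial>lborel)
      \<le> (\<integral>\<^sup>+u. h ((\<lambda>j\<in>I. (x j + y j) / 2)(i := u)) \<partial>lborel)\<^sup>2"
    if xy: "x \<in> extensional I" "y \<in> extensional I" for x y
  proof (rule prekopa_leindler_real)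
    fix s t
    have "(\<lambda>j\<in>insert i I. ((x(i := s)) j + (y(i := t)) j) / 2) = (\<lambda>j\<in>I. (x j + y j) / 2)(i := (s + t) / 2)"
      using insert.hyps by (auto simp: fun_eq_iff restrict_def)
    moreover have "x(i := s) \<in> extensional (insert i I)" "y(i := t) \<in> extensional (insert i I)"
      using xy by (auto simp: extensional_def)
    ultimately show "f (x(i := s)) * g (y(i := t)) \<le> (h ((\<lambda>j\<in>I. (x j + y j) / 2)(i := (s + t) / 2)))\<^sup>2"
      using insert.prems(4) by metis
  qed (use sec insert.prems xy in auto)
  then have "(\<integral>\<^sup>+x. \<integral>\<^sup>+s. f (x(i := s)) \<partial>lborel \<partial>Pi\<^sub>M I (\<lambda>_. lborel)) * (\<integral>\<^sup>+x. \<integral>\<^sup>+s. g (x(i := s)) \<partial>lborel \<partial>Pi\<^sub>M I (\<lambda>_. lborel))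
    \<le> (\<integral>\<^sup>+x. \<integral>\<^sup>+s. h (x(i := s)) \<partial>lborel \<partial>Pi\<^sub>M I (\<lambda>_. lborel))\<^sup>2"
    by (intro insert.IH marg insert.prems)
  then show ?case
    using insert.hyps insert.prems(1-3) by (simp add: lborel_product.product_nn_integral_insert)
qed

text \<open>\<open>P\<close> is linear in the coordinates and reads only the indices in
  \<open>Basis\<close>, so it sends the restricted midpoint to the midpoint.\<close>

theorem prekopa_leindler:
  fixes f g h :: "'a::euclidean_space \<Rightarrow> ennreal"
  assumes [measurable]: "f \<in> borel_measurable borel" "g \<in> borel_measurable borel" "h \<in> borel_measurable borel"
    and mid: "\<And>x y. f x * g y \<le> (h ((1/2) *\<^sub>R (x + y)))\<^sup>2"
  shows "(\<integral>\<^sup>+x. f x \<partial>lborel) * (\<integral>\<^sup>+x. g x \<partial>lborel) \<le> (\<integral>\<^sup>+x. h x \<partial>lborel)\<^sup>2"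
proof -
  define P where "P = (\<lambda>x::'a \<Rightarrow> real. \<Sum>b\<in>Basis. x b *\<^sub>R b)"
  have [measurable]: "P \<in> Pi\<^sub>M Basis (\<lambda>_. lborel) \<rightarrow>\<^sub>M borel" unfolding P_def by measurable
  have eq: "(\<integral>\<^sup>+x. F x \<partial>lborel) = (\<integral>\<^sup>+x. F (P x) \<partial>Pi\<^sub>M Basis (\<lambda>_. lborel))"
    if [measurable]: "F \<in> borel_measurable borel" for F :: "'a \<Rightarrow> ennreal"
    by (subst lborel_eq, fold P_def, rule nn_integral_distr) measurable
  have "P (\<lambda>i\<in>Basis. (x i + y i) / 2) = (1/2) *\<^sub>R (P x + P y)" for x y
    by (simp add: P_def scaleR_sum_right sum.distrib[symmetric] scaleR_add_left scaleR_add_right add_divide_distrib)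
  then have "(\<integral>\<^sup>+x. f (P x) \<partial>Pi\<^sub>M Basis (\<lambda>_. lborel)) * (\<integral>\<^sup>+x. g (P x) \<partial>Pi\<^sub>M Basis (\<lambda>_. lborel))
    \<le> (\<integral>\<^sup>+x. h (P x) \<partial>Pi\<^sub>M Basis (\<lambda>_. lborel))\<^sup>2"
    by (intro prekopa_leindler_PiM) (simp_all add: mid)
  then show ?thesis by (simp add: eq)
qed

section \<open>Functions of class C1 and C2\<close>

text \<open>Continuity of the derivative is asked direction by direction. In finite dimension this
  is equivalent to norm continuity, and it keeps the closure properties free of operator-valued
  functions.\<close>

definition C1_differentiable :: "'a::euclidean_space set \<Rightarrow> ('a \<Rightarrow> 'b::euclidean_space) \<Rightarrow> bool" where
  "C1_differentiable S f \<longleftrightarrow> (\<exists>f'. (\<forall>x\<in>S. (f has_derivative f' x) (at x)) \<and> (\<forall>h. continuous_on S (\<lambda>x. f' x h)))"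

definition C2_differentiable :: "'a::euclidean_space set \<Rightarrow> ('a \<Rightarrow> 'b::euclidean_space) \<Rightarrow> bool" where
  "C2_differentiable S f \<longleftrightarrow> (\<exists>f'. (\<forall>x\<in>S. (f has_derivative f' x) (at x)) \<and> (\<forall>h. C1_differentiable S (\<lambda>x. f' x h)))"

lemma C1_imp_continuous_on: "C1_differentiable S f \<Longrightarrow> continuous_on S f"
  unfolding C1_differentiable_def
  by (meson continuous_at_imp_continuous_on has_derivative_continuous)

lemma C2_imp_C1: "C2_differentiable S f \<Longrightarrow> C1_differentiable S f"
  unfolding C2_differentiable_def C1_differentiable_def[of S f] by (meson C1_imp_continuous_on)

lemma C1_differentiable_subset: "C1_differentiable S f \<Longrightarrow> T \<subseteq> S \<Longrightarrow> C1_differentiable T f"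
  unfolding C1_differentiable_def by (meson continuous_on_subset subsetD)

lemma C2_differentiable_subset: "C2_differentiable S f \<Longrightarrow> T \<subseteq> S \<Longrightarrow> C2_differentiable T f"
  unfolding C2_differentiable_def by (meson C1_differentiable_subset subsetD)

lemma has_derivative_cong_open:
  assumes "(f has_derivative f') (at x)" "open S" "x \<in> S" "\<And>y. y \<in> S \<Longrightarrow> f y = g y"
  shows "(g has_derivative f') (at x)"
  using has_derivative_transform_within_open[OF assms(1-3)] assms(4) by metis

lemma C1_differentiable_cong:
  assumes "C1_differentiable S f" "open S" "\<And>y. y \<in> S \<Longrightarrow> f y = g y"
  shows "C1_differentiable S g"
  using assms has_derivative_cong_open[where f = f and g = g] unfolding C1_differentiable_def by metis

lemma C2_differentiable_cong:
  assumes "C2_differentiable S f" "open S" "\<And>y. y \<in> S \<Longrightarrow> f y = g y"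
  shows "C2_differentiable S g"
  using assms has_derivative_cong_open[where f = f and g = g] unfolding C2_differentiable_def by metis

lemma C1_differentiable_derivative:
  assumes "C1_differentiable S f"
  obtains f' where "\<And>x. x \<in> S \<Longrightarrow> (f has_derivative f' x) (at x)" "\<And>h. continuous_on S (\<lambda>x. f' x h)"
  using assms unfolding C1_differentiable_def by metis

text \<open>Local derivatives agree with the Frechet derivative by uniqueness, which provides the
  single global choice that the definition asks for.\<close>

lemma C1_differentiable_local:
  assumes "\<And>x. x \<in> S \<Longrightarrow> \<exists>T. open T \<and> x \<in> T \<and> C1_differentiable T f"
  shows "C1_differentiable S f"
  unfolding C1_differentiable_def
proof (intro exI conjI ballI allI)
  let ?f' = "\<lambda>x. frechet_derivative f (at x)"
  have *: "\<exists>T. open T \<and> x \<in> T \<and> (\<forall>y\<in>T. (f has_derivative ?f' y) (at y)) \<and> (\<forall>h. continuous_on T (\<lambda>y. ?f' y h))"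
    if x: "x \<in> S" for x
  proof -
    obtain T where T: "open T" "x \<in> T" "C1_differentiable T f" using assms[OF x] by auto
    obtain f' where f': "\<And>x. x \<in> T \<Longrightarrow> (f has_derivative f' x) (at x)" "\<And>h. continuous_on T (\<lambda>x. f' x h)"
      using T(3) C1_differentiable_derivative by metis
    have eq: "f' y = ?f' y" if "y \<in> T" for y using frechet_derivative_at[OF f'(1)[OF that]] .
    then have "continuous_on T (\<lambda>y. ?f' y h)" for h
      using f'(2)[of h] by (subst continuous_on_cong[OF refl]) auto
    moreover have "(f has_derivative ?f' y) (at y)" if "y \<in> T" for y
      using f'(1)[OF that] eq[OF that] by simp
    ultimately show ?thesis using T by blast
  qed
  show "(f has_derivative ?f' x) (at x)" if "x \<in> S" for x using *[OF that] by auto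
  show "continuous_on S (\<lambda>x. ?f' x h)" for h
  proof (intro continuous_at_imp_continuous_on ballI)
    fix x assume "x \<in> S"
    then show "isCont (\<lambda>x. ?f' x h) x"
      using * continuous_on_eq_continuous_at by blast
  qed
qed

lemma C2_differentiable_local:
  assumes "\<And>x. x \<in> S \<Longrightarrow> \<exists>T. open T \<and> x \<in> T \<and> C2_differentiable T f"
  shows "C2_differentiable S f"
  unfolding C2_differentiable_def
proof (intro exI conjI ballI allI)
  let ?f' = "\<lambda>x. frechet_derivative f (at x)"
  have *: "\<exists>T. open T \<and> x \<in> T \<and> (\<forall>y\<in>T. (f has_derivative ?f' y) (at y)) \<and> (\<forall>h. C1_differentiable T (\<lambda>y. ?f' y h))"
    if x: "x \<in> S" for x
  proof -
    obtain T where T: "open T" "x \<in> T" "C2_differentiable T f" using assms[OF x] by auto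
    obtain f' where f': "\<And>x. x \<in> T \<Longrightarrow> (f has_derivative f' x) (at x)" "\<And>h. C1_differentiable T (\<lambda>x. f' x h)"
      using T(3) unfolding C2_differentiable_def by metis
    have eq: "f' y = ?f' y" if "y \<in> T" for y using frechet_derivative_at[OF f'(1)[OF that]] .
    then have "C1_differentiable T (\<lambda>y. ?f' y h)" for h
      using C1_differentiable_cong[OF f'(2)[of h] T(1)] by simp
    moreover have "(f has_derivative ?f' y) (at y)" if "y \<in> T" for y
      using f'(1)[OF that] eq[OF that] by simp
    ultimately show ?thesis using T by blast
  qed
  show "(f has_derivative ?f' x) (at x)" if "x \<in> S" for x using *[OF that] by auto
  show "C1_differentiable S (\<lambda>x. ?f' x h)" for h
    using * by (intro C1_differentiable_local) blast
qed

lemma C1_differentiable_const: "C1_differentiable S (\<lambda>x. c)"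
  unfolding C1_differentiable_def by (intro exI[of _ "\<lambda>_ _. 0"]) auto

lemma C2_differentiable_const: "C2_differentiable S (\<lambda>x. c)"
  unfolding C2_differentiable_def
  by (intro exI[of _ "\<lambda>_ _. 0"]) (auto intro: C1_differentiable_const)

lemma C1_differentiable_bounded_linear: "bounded_linear f \<Longrightarrow> C1_differentiable S f"
  unfolding C1_differentiable_def
  by (intro exI[of _ "\<lambda>_. f"]) (auto simp: bounded_linear_imp_has_derivative)

lemma C2_differentiable_bounded_linear: "bounded_linear f \<Longrightarrow> C2_differentiable S f"
  unfolding C2_differentiable_def
  by (intro exI[of _ "\<lambda>_. f"]) (auto simp: bounded_linear_imp_has_derivative C1_differentiable_const)

lemma C1_differentiable_add:
  assumes "C1_differentiable S f" "C1_differentiable S g"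
  shows "C1_differentiable S (\<lambda>x. f x + g x)"
proof -
  obtain f' where f': "\<And>x. x \<in> S \<Longrightarrow> (f has_derivative f' x) (at x)" "\<And>h. continuous_on S (\<lambda>x. f' x h)"
    using assms(1) C1_differentiable_derivative by metis
  obtain g' where g': "\<And>x. x \<in> S \<Longrightarrow> (g has_derivative g' x) (at x)" "\<And>h. continuous_on S (\<lambda>x. g' x h)"
    using assms(2) C1_differentiable_derivative by metis
  show ?thesis unfolding C1_differentiable_def
    by (intro exI[of _ "\<lambda>x h. f' x h + g' x h"] conjI ballI allI derivative_intros continuous_intros f' g')
qed

lemma C1_differentiable_scaleR:
  assumes "C1_differentiable S f" "C1_differentiable S g"
  shows "C1_differentiable S (\<lambda>x. f x *\<^sub>R g x)"
proof -
  obtain f' where f': "\<And>x. x \<in> S \<Longrightarrow> (f has_derivative f' x) (at x)" "\<And>h. continuous_on S (\<lambda>x. f' x h)"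
    using assms(1) C1_differentiable_derivative by metis
  obtain g' where g': "\<And>x. x \<in> S \<Longrightarrow> (g has_derivative g' x) (at x)" "\<And>h. continuous_on S (\<lambda>x. g' x h)"
    using assms(2) C1_differentiable_derivative by metis
  show ?thesis unfolding C1_differentiable_def
    by (intro exI[of _ "\<lambda>x h. f x *\<^sub>R g' x h + f' x h *\<^sub>R g x"] conjI ballI allI has_derivative_scaleR
        continuous_intros f' g' C1_imp_continuous_on assms)
qed

lemma C2_differentiable_derivative:
  assumes "C2_differentiable S f"
  obtains f' where "\<And>x. x \<in> S \<Longrightarrow> (f has_derivative f' x) (at x)" "\<And>h. C1_differentiable S (\<lambda>x. f' x h)"
  using assms unfolding C2_differentiable_def by metis

lemma C2_differentiable_add:
  assumes "C2_differentiable S f" "C2_differentiable S g"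
  shows "C2_differentiable S (\<lambda>x. f x + g x)"
proof -
  obtain f' where f': "\<And>x. x \<in> S \<Longrightarrow> (f has_derivative f' x) (at x)" "\<And>h. C1_differentiable S (\<lambda>x. f' x h)"
    using assms(1) C2_differentiable_derivative by metis
  obtain g' where g': "\<And>x. x \<in> S \<Longrightarrow> (g has_derivative g' x) (at x)" "\<And>h. C1_differentiable S (\<lambda>x. g' x h)"
    using assms(2) C2_differentiable_derivative by metis
  show ?thesis unfolding C2_differentiable_def
    by (intro exI[of _ "\<lambda>x h. f' x h + g' x h"] conjI ballI allI derivative_intros C1_differentiable_add f' g')
qed

lemma C2_differentiable_scaleR:
  assumes "C2_differentiable S f" "C2_differentiable S g"
  shows "C2_differentiable S (\<lambda>x. f x *\<^sub>R g x)"
proof -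
  obtain f' where f': "\<And>x. x \<in> S \<Longrightarrow> (f has_derivative f' x) (at x)" "\<And>h. C1_differentiable S (\<lambda>x. f' x h)"
    using assms(1) C2_differentiable_derivative by metis
  obtain g' where g': "\<And>x. x \<in> S \<Longrightarrow> (g has_derivative g' x) (at x)" "\<And>h. C1_differentiable S (\<lambda>x. g' x h)"
    using assms(2) C2_differentiable_derivative by metis
  show ?thesis unfolding C2_differentiable_def
    by (intro exI[of _ "\<lambda>x h. f x *\<^sub>R g' x h + f' x h *\<^sub>R g x"] conjI ballI allI has_derivative_scaleR
        C1_differentiable_add C1_differentiable_scaleR f' g' C2_imp_C1 assms)
qed

lemma C1_differentiable_sum:
  "finite I \<Longrightarrow> (\<And>i. i \<in> I \<Longrightarrow> C1_differentiable S (f i)) \<Longrightarrow> C1_differentiable S (\<lambda>x. \<Sum>i\<in>I. f i x)"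
  by (induction I rule: finite_induct) (auto intro: C1_differentiable_const C1_differentiable_add)

text \<open>In the chain rule the outer derivative is applied to a direction that moves with x,
  whereas regularity is known for fixed directions; expanding over the basis reduces to
  those.\<close>

lemma linear_expand_Basis:
  fixes A :: "'a::euclidean_space \<Rightarrow> 'b::real_vector"
  assumes "linear A"
  shows "A v = (\<Sum>b\<in>Basis. (v \<bullet> b) *\<^sub>R A b)"
proof -
  have "A v = A (\<Sum>b\<in>Basis. (v \<bullet> b) *\<^sub>R b)" by (simp add: euclidean_representation)
  also have "\<dots> = (\<Sum>b\<in>Basis. (v \<bullet> b) *\<^sub>R A b)"
    by (simp add: linear_sum[OF assms] linear_cmul[OF assms] o_def)
  finally show ?thesis .
qed

lemma C1_differentiable_compose:
  assumes f: "C1_differentiable S f" and g: "C1_differentiable T g" and sub: "f ` S \<subseteq> T"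
  shows "C1_differentiable S (\<lambda>x. g (f x))"
proof -
  obtain f' where f': "\<And>x. x \<in> S \<Longrightarrow> (f has_derivative f' x) (at x)" "\<And>h. continuous_on S (\<lambda>x. f' x h)"
    using f C1_differentiable_derivative by metis
  obtain g' where g': "\<And>x. x \<in> T \<Longrightarrow> (g has_derivative g' x) (at x)" "\<And>h. continuous_on T (\<lambda>x. g' x h)"
    using g C1_differentiable_derivative by metis
  show ?thesis unfolding C1_differentiable_def
  proof (intro exI[of _ "\<lambda>x h. g' (f x) (f' x h)"] conjI ballI allI)
    show "((\<lambda>x. g (f x)) has_derivative (\<lambda>h. g' (f x) (f' x h))) (at x)" if "x \<in> S" for x
      using diff_chain_at[OF f'(1)[OF that] g'(1)] that sub by (auto simp: o_def)
    fix h
    have eq: "(\<Sum>b\<in>Basis. (f' x h \<bullet> b) *\<^sub>R g' (f x) b) = g' (f x) (f' x h)" if "x \<in> S" for x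
      using linear_expand_Basis[OF has_derivative_linear[OF g'(1)[of "f x"]], of "f' x h"] that sub by auto
    have "continuous_on S (\<lambda>x. (\<Sum>b\<in>Basis. (f' x h \<bullet> b) *\<^sub>R g' (f x) b))"
      by (intro continuous_intros f' continuous_on_compose2[OF g'(2) C1_imp_continuous_on[OF f] sub])
    then show "continuous_on S (\<lambda>x. g' (f x) (f' x h))"
      by (subst (asm) continuous_on_cong[OF refl eq]) auto
  qed
qed

lemma C2_differentiable_compose:
  assumes f: "C2_differentiable S f" and g: "C2_differentiable T g" and sub: "f ` S \<subseteq> T" and S: "open S"
  shows "C2_differentiable S (\<lambda>x. g (f x))"
proof -
  obtain f' where f': "\<And>x. x \<in> S \<Longrightarrow> (f has_derivative f' x) (at x)" "\<And>h. C1_differentiable S (\<lambda>x. f' x h)"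
    using f C2_differentiable_derivative by metis
  obtain g' where g': "\<And>x. x \<in> T \<Longrightarrow> (g has_derivative g' x) (at x)" "\<And>h. C1_differentiable T (\<lambda>x. g' x h)"
    using g C2_differentiable_derivative by metis
  show ?thesis unfolding C2_differentiable_def
  proof (intro exI[of _ "\<lambda>x h. g' (f x) (f' x h)"] conjI ballI allI)
    show "((\<lambda>x. g (f x)) has_derivative (\<lambda>h. g' (f x) (f' x h))) (at x)" if "x \<in> S" for x
      using diff_chain_at[OF f'(1)[OF that] g'(1)] that sub by (auto simp: o_def)
    fix h
    have eq: "(\<Sum>b\<in>Basis. (f' x h \<bullet> b) *\<^sub>R g' (f x) b) = g' (f x) (f' x h)" if "x \<in> S" for x
      using linear_expand_Basis[OF has_derivative_linear[OF g'(1)[of "f x"]], of "f' x h"] that sub by auto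
    have "C1_differentiable S (\<lambda>x. f' x h \<bullet> b)" for b
      by (rule C1_differentiable_compose[OF f'(2) C1_differentiable_bounded_linear[of _ UNIV]])
         (auto intro: bounded_linear_inner_left)
    then have "C1_differentiable S (\<lambda>x. (\<Sum>b\<in>Basis. (f' x h \<bullet> b) *\<^sub>R g' (f x) b))"
      by (intro C1_differentiable_sum C1_differentiable_scaleR
          C1_differentiable_compose[OF C2_imp_C1[OF f] g'(2) sub]) auto
    then show "C1_differentiable S (\<lambda>x. g' (f x) (f' x h))"
      by (rule C1_differentiable_cong[OF _ S eq])
  qed
qed

lemma C1_differentiable_Pair:
  assumes "C1_differentiable S f" "C1_differentiable S g"
  shows "C1_differentiable S (\<lambda>x. (f x, g x))"
proof -
  obtain f' where f': "\<And>x. x \<in> S \<Longrightarrow> (f has_derivative f' x) (at x)" "\<And>h. continuous_on S (\<lambda>x. f' x h)"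
    using assms(1) C1_differentiable_derivative by metis
  obtain g' where g': "\<And>x. x \<in> S \<Longrightarrow> (g has_derivative g' x) (at x)" "\<And>h. continuous_on S (\<lambda>x. g' x h)"
    using assms(2) C1_differentiable_derivative by metis
  show ?thesis unfolding C1_differentiable_def
    by (intro exI[of _ "\<lambda>x h. (f' x h, g' x h)"] conjI ballI allI has_derivative_Pair continuous_intros f' g')
qed

lemma C2_differentiable_Pair:
  assumes "C2_differentiable S f" "C2_differentiable S g"
  shows "C2_differentiable S (\<lambda>x. (f x, g x))"
proof -
  obtain f' where f': "\<And>x. x \<in> S \<Longrightarrow> (f has_derivative f' x) (at x)" "\<And>h. C1_differentiable S (\<lambda>x. f' x h)"
    using assms(1) C2_differentiable_derivative by metis
  obtain g' where g': "\<And>x. x \<in> S \<Longrightarrow> (g has_derivative g' x) (at x)" "\<And>h. C1_differentiable S (\<lambda>x. g' x h)"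
    using assms(2) C2_differentiable_derivative by metis
  show ?thesis unfolding C2_differentiable_def
    by (intro exI[of _ "\<lambda>x h. (f' x h, g' x h)"] conjI ballI allI has_derivative_Pair C1_differentiable_Pair f' g')
qed

lemma C1_differentiable_real:
  fixes f f' :: "real \<Rightarrow> real"
  assumes "\<And>x. x \<in> S \<Longrightarrow> (f has_real_derivative f' x) (at x)" "continuous_on S f'"
  shows "C1_differentiable S f"
  unfolding C1_differentiable_def
  by (intro exI[of _ "\<lambda>x h. f' x * h"] conjI ballI allI continuous_intros assms)
     (use assms(1) in \<open>auto simp: has_field_derivative_def\<close>)

lemma C2_differentiable_real:
  fixes f f' f'' :: "real \<Rightarrow> real"
  assumes "\<And>x. x \<in> S \<Longrightarrow> (f has_real_derivative f' x) (at x)"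
    "\<And>x. x \<in> S \<Longrightarrow> (f' has_real_derivative f'' x) (at x)" "continuous_on S f''"
  shows "C2_differentiable S f"
proof -
  have "C1_differentiable S f'" using assms(2,3) by (rule C1_differentiable_real)
  then have "C1_differentiable S (\<lambda>x. f' x * h)" for h
    using C1_differentiable_scaleR[OF _ C1_differentiable_const[of S h], of f'] by simp
  then show ?thesis
    unfolding C2_differentiable_def
    by (intro exI[of _ "\<lambda>x h. f' x * h"]) (use assms(1) in \<open>auto simp: has_field_derivative_def\<close>)
qed

lemma C2_differentiable_exp: "C2_differentiable S (exp :: real \<Rightarrow> real)"
  by (rule C2_differentiable_real[of _ _ exp exp]) (auto intro!: derivative_eq_intros continuous_intros)

lemma C2_differentiable_ln: "C2_differentiable {0<..} (ln :: real \<Rightarrow> real)"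
  by (rule C2_differentiable_real[of _ _ inverse "\<lambda>x. - (inverse x ^ 2)"])
     (auto intro!: derivative_eq_intros continuous_intros simp: field_simps power2_eq_square)

lemma C1_differentiable_inverse: "C1_differentiable (-{0}) (inverse :: real \<Rightarrow> real)"
  by (rule C1_differentiable_real[of _ _ "\<lambda>x. - (inverse x ^ 2)"])
     (auto intro!: derivative_eq_intros continuous_intros simp: field_simps power2_eq_square)

lemma C2_differentiable_power:
  fixes f :: "'a::euclidean_space \<Rightarrow> real"
  assumes "C2_differentiable S f"
  shows "C2_differentiable S (\<lambda>x. f x ^ n)"
proof (induction n)
  case (Suc n)
  then show ?case using C2_differentiable_scaleR[OF assms Suc] by simp
qed (simp add: C2_differentiable_const)

section \<open>Directionwise regularity versus derivatives as bounded linear maps\<close>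

lemma has_C2_derivs_on_imp_C2_differentiable:
  assumes "has_C2_derivs_on f D1 D2 S"
  shows "C2_differentiable S f"
  unfolding C2_differentiable_def
proof (intro exI conjI ballI allI)
  show "(f has_derivative blinfun_apply (D1 x)) (at x)" if "x \<in> S" for x
    using assms that by (auto simp: has_C2_derivs_on_def)
  fix h
  show "C1_differentiable S (\<lambda>x. blinfun_apply (D1 x) h)"
    unfolding C1_differentiable_def
  proof (intro exI conjI ballI allI)
    show "((\<lambda>x. blinfun_apply (D1 x) h) has_derivative (\<lambda>k. blinfun_apply (blinfun_apply (D2 x) k) h)) (at x)"
      if "x \<in> S" for x
    proof -
      have "(D1 has_derivative blinfun_apply (D2 x)) (at x)"
        using assms that by (auto simp: has_C2_derivs_on_def)
      from bounded_linear.has_derivative[OF bounded_linear_apply_blinfun this] show ?thesis .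
    qed
    show "continuous_on S (\<lambda>x. blinfun_apply (blinfun_apply (D2 x) k) h)" for k
      using assms by (auto simp: has_C2_derivs_on_def intro!: continuous_intros)
  qed
qed

text \<open>The directional derivatives along the basis are the coefficients of the differential in
  the dual basis, so both derivatives can be reassembled as bounded linear maps; norm continuity
  follows from continuity in each direction.\<close>

lemma C2_differentiable_imp_has_C2_derivs_on:
  fixes f :: "'a::euclidean_space \<Rightarrow> real"
  assumes "C2_differentiable S f"
  obtains D1 D2 where "has_C2_derivs_on f D1 D2 S"
proof -
  obtain f' where f': "\<And>x. x \<in> S \<Longrightarrow> (f has_derivative f' x) (at x)" "\<And>h. C1_differentiable S (\<lambda>x. f' x h)"
    using assms C2_differentiable_derivative by metis
  have "\<exists>g. (\<forall>x\<in>S. ((\<lambda>x. f' x h) has_derivative g x) (at x)) \<and> (\<forall>k. continuous_on S (\<lambda>x. g x k))" for h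
    using f'(2)[of h] unfolding C1_differentiable_def .
  then obtain f'' where f'': "\<And>h x. x \<in> S \<Longrightarrow> ((\<lambda>x. f' x h) has_derivative f'' h x) (at x)"
    "\<And>h k. continuous_on S (\<lambda>x. f'' h x k)" by metis
  define E :: "'a \<Rightarrow> 'a \<Rightarrow>\<^sub>L real" where "E b = blinfun_inner_left b" for b
  have E: "blinfun_apply (E b) v = v \<bullet> b" for b v
    by (simp add: E_def inner_commute)
  define D1 where "D1 x = (\<Sum>b\<in>Basis. f' x b *\<^sub>R E b)" for x
  \<comment> \<open>\<open>Blinfun\<close> is meaningful only for bounded linear arguments, and
    boundedness is known just for \<open>x\<close> in \<open>S\<close>.\<close>
  define D2 where "D2 x = Blinfun (\<lambda>k. \<Sum>b\<in>Basis. f'' b x k *\<^sub>R E b)" for x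
  have D1: "blinfun_apply (D1 x) v = f' x v" if "x \<in> S" for x v
    using linear_expand_Basis[OF has_derivative_linear[OF f'(1)[OF that]], of v]
    by (simp add: D1_def blinfun.sum_left blinfun.scaleR_left E mult.commute)
  have D2: "blinfun_apply (D2 x) k = (\<Sum>b\<in>Basis. f'' b x k *\<^sub>R E b)" if "x \<in> S" for x k
    unfolding D2_def
    by (subst bounded_linear_Blinfun_apply)
       (auto intro!: bounded_linear_sum bounded_linear_scaleR_const has_derivative_bounded_linear[OF f''(1)] that)
  have "has_C2_derivs_on f D1 D2 S"
    unfolding has_C2_derivs_on_def
  proof (intro conjI ballI)
    fix x assume x: "x \<in> S"
    have "blinfun_apply (D1 x) = f' x" using D1[OF x] by (intro ext)
    then show "(f has_derivative blinfun_apply (D1 x)) (at x)"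
      using f'(1)[OF x] by simp
    have "(D1 has_derivative (\<lambda>k. \<Sum>b\<in>Basis. f'' b x k *\<^sub>R E b)) (at x)"
      unfolding D1_def using f''(1)[OF x]
      by (auto intro!: derivative_eq_intros)
    moreover have "blinfun_apply (D2 x) = (\<lambda>k. \<Sum>b\<in>Basis. f'' b x k *\<^sub>R E b)"
      using D2[OF x] by (intro ext)
    ultimately show "(D1 has_derivative blinfun_apply (D2 x)) (at x)" by simp
  next
    show "continuous_on S D2"
    proof (rule continuous_on_blinfun_componentwise)
      fix k :: 'a
      have "continuous_on S (\<lambda>x. \<Sum>b\<in>Basis. f'' b x k *\<^sub>R E b)"
        by (intro continuous_intros f'')
      then show "continuous_on S (\<lambda>x. blinfun_apply (D2 x) k)"
        by (rule continuous_on_eq) (simp add: D2)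
    qed
  qed
  then show ?thesis using that by blast
qed

section \<open>Implicit functions with one real unknown\<close>

text \<open>For continuous \<^term>\<open>r\<close> the equation \<^term>\<open>P (p, r p) = 0\<close> gives
  \<open>\<partial>\<^sub>pP h + \<partial>\<^sub>sP (r (p + h) - r p) = o(\<bar>h\<bar> + \<bar>r (p + h) - r p\<bar>)\<close>, which first bounds the increment
  of \<^term>\<open>r\<close> by a multiple of \<open>\<bar>h\<bar>\<close> and then identifies it up to \<open>o(\<bar>h\<bar>)\<close>.\<close>

lemma has_derivative_implicit_real:
  fixes P :: "'p::euclidean_space \<times> real \<Rightarrow> real" and r :: "'p \<Rightarrow> real"
  assumes S: "open S" "p \<in> S" and r: "isCont r p"
    and P0: "\<And>q. q \<in> S \<Longrightarrow> P (q, r q) = 0"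
    and P': "(P has_derivative P') (at (p, r p))" and nz: "P' (0, 1) \<noteq> 0"
  shows "(r has_derivative (\<lambda>h. - P' (h, 0) / P' (0, 1))) (at p)"
proof -
  define c where "c = P' (0, 1)"
  have lin: "linear P'" and bl: "bounded_linear P'"
    using P' by (auto intro: has_derivative_linear has_derivative_bounded_linear)
  have P'_eq: "P' (h, s) = P' (h, 0) + s * c" for h s
  proof -
    have "P' (h, s) = P' ((h, 0) + s *\<^sub>R (0, 1))" by simp
    also have "\<dots> = P' (h, 0) + s * c"
      unfolding linear_add[OF lin] linear_cmul[OF lin] by (simp add: c_def)
    finally show ?thesis .
  qed
  obtain B where B: "B > 0" "\<And>x. norm (P' x) \<le> norm x * B"
    using bounded_linear.pos_bounded[OF bl] by auto
  have Bh: "\<bar>P' (h, 0)\<bar> \<le> B * norm h" for h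
    using B(2)[of "(h, 0)"] by (simp add: norm_Pair mult.commute)
  have "bounded_linear (\<lambda>h. P' (h, 0))"
    by (rule bounded_linear_compose[OF bl]) (intro bounded_linear_intros)
  from bounded_linear_compose[OF bounded_linear_scaleR_right[of "- inverse c"] this]
  have blr: "bounded_linear (\<lambda>h. - P' (h, 0) / P' (0, 1))"
    by (simp add: c_def divide_inverse mult.commute)
  show ?thesis
    unfolding has_derivative_at_alt
  proof (intro conjI blr allI impI)
    fix e :: real assume e: "e > 0"
    have c0: "0 < \<bar>c\<bar>" using nz by (simp add: c_def)
    \<comment> \<open>\<open>K\<close> will bound |h| + |s| by a multiple of |h|. In
      \<open>\<epsilon>\<close>, the first entry lets half of |s| |c| be absorbed on the left, and
      the second leaves the final error e |c| |h|.\<close>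
    define K where "K = 1 + 2 * (B + \<bar>c\<bar>) / \<bar>c\<bar>"
    have K: "K > 0" unfolding K_def using B c0 by (intro add_pos_nonneg) auto
    define \<epsilon> where "\<epsilon> = min (\<bar>c\<bar> / 2) (e * \<bar>c\<bar> / K)"
    have \<epsilon>: "\<epsilon> > 0" using c0 e K by (simp add: \<epsilon>_def)
    obtain d where d: "d > 0" "\<And>y. norm (y - (p, r p)) < d \<Longrightarrow>
        norm (P y - P (p, r p) - P' (y - (p, r p))) \<le> \<epsilon> * norm (y - (p, r p))"
      using P'[unfolded has_derivative_at_alt, THEN conjunct2, rule_format, OF \<epsilon>] by blast
    obtain d1 where d1: "d1 > 0" "\<And>q. norm (q - p) < d1 \<Longrightarrow> \<bar>r q - r p\<bar> < d / 2"
      using r[unfolded continuous_at_eps_delta, rule_format, of "d/2"] d(1) by (auto simp: dist_norm)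
    obtain d2 where d2: "d2 > 0" "ball p d2 \<subseteq> S" using S open_contains_ball by metis
    show "\<exists>d>0. \<forall>y. norm (y - p) < d \<longrightarrow>
        norm (r y - r p - - P' (y - p, 0) / P' (0, 1)) \<le> e * norm (y - p)"
    proof (intro exI[of _ "min (min d1 d2) (d/2)"] conjI allI impI)
      show "0 < min (min d1 d2) (d/2)" using d d1 d2 by auto
      fix q assume q: "norm (q - p) < min (min d1 d2) (d/2)"
      define h where "h = q - p"
      define s where "s = r q - r p"
      have "q \<in> S" using q d2(2) by (auto simp: dist_norm norm_minus_commute subset_iff)
      then have Pq: "P (q, r q) = 0" "P (p, r p) = 0" using P0 S by auto
      have n: "norm (h, s) \<le> norm h + \<bar>s\<bar>" using norm_Pair_le[of h s] by simp
      also have "\<dots> < d" using q d1(2)[of q] by (simp add: h_def s_def)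
      finally have "\<bar>P' (h, s)\<bar> \<le> \<epsilon> * norm (h, s)"
        using d(2)[of "(q, r q)"] by (simp add: Pq h_def s_def)
      also have "\<dots> \<le> \<epsilon> * (norm h + \<bar>s\<bar>)" using n \<epsilon> by simp
      finally have main: "\<bar>P' (h, 0) + s * c\<bar> \<le> \<epsilon> * (norm h + \<bar>s\<bar>)" by (simp add: P'_eq[of h s])
      have "\<bar>s\<bar> * \<bar>c\<bar> = \<bar>s * c\<bar>" by (simp add: abs_mult)
      also have "\<dots> \<le> \<bar>P' (h, 0) + s * c\<bar> + \<bar>P' (h, 0)\<bar>" by linarith
      also have "\<dots> \<le> (\<bar>c\<bar> / 2) * (norm h + \<bar>s\<bar>) + B * norm h"
      proof (intro add_mono Bh order_trans[OF main])
        show "\<epsilon> * (norm h + \<bar>s\<bar>) \<le> \<bar>c\<bar> / 2 * (norm h + \<bar>s\<bar>)"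
          by (intro mult_right_mono) (simp_all only: \<epsilon>_def min.cobounded1, simp)
      qed
      finally have "\<bar>s\<bar> * \<bar>c\<bar> \<le> (\<bar>c\<bar> * norm h + \<bar>s\<bar> * \<bar>c\<bar>) / 2 + B * norm h"
        by (simp add: algebra_simps)
      then have "\<bar>s\<bar> * \<bar>c\<bar> \<le> \<bar>c\<bar> * norm h + 2 * (B * norm h)" by argo
      then have "\<bar>s\<bar> * \<bar>c\<bar> \<le> (\<bar>c\<bar> + 2 * B) * norm h" by (simp add: algebra_simps)
      also have "\<dots> \<le> 2 * (B + \<bar>c\<bar>) * norm h" by (intro mult_right_mono) auto
      finally have "\<bar>s\<bar> \<le> 2 * (B + \<bar>c\<bar>) / \<bar>c\<bar> * norm h" using c0 by (simp add: field_simps)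
      then have "norm h + \<bar>s\<bar> \<le> K * norm h" by (simp add: K_def algebra_simps)
      then have "\<epsilon> * (norm h + \<bar>s\<bar>) \<le> (e * \<bar>c\<bar> / K) * (K * norm h)"
        by (intro mult_mono) (use \<epsilon> e c0 K in \<open>auto simp: \<epsilon>_def\<close>)
      also have "\<dots> = e * \<bar>c\<bar> * norm h" using K by simp
      finally have "\<bar>P' (h, 0) + s * c\<bar> \<le> e * \<bar>c\<bar> * norm h" using main by simp
      moreover have "s - - P' (h, 0) / c = (P' (h, 0) + s * c) / c" using c0 by (simp add: field_simps)
      ultimately have "\<bar>s - - P' (h, 0) / c\<bar> \<le> e * norm h" using c0 by (simp add: abs_divide field_simps)
      then show "norm (r q - r p - - P' (q - p, 0) / P' (0, 1)) \<le> e * norm (q - p)"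
        by (simp add: s_def h_def c_def)
    qed
  qed
qed

text \<open>Bootstrapping: the formula for the derivative of \<open>r\<close> contains
  \<open>r\<close> itself, so continuity of \<open>r\<close> gives C1, and C1 put back into the
  formula gives C2.\<close>

lemma C2_differentiable_implicit_real:
  fixes P :: "'p::euclidean_space \<times> real \<Rightarrow> real" and r :: "'p \<Rightarrow> real"
  assumes S: "open S" and r: "continuous_on S r" and sub: "\<And>p. p \<in> S \<Longrightarrow> (p, r p) \<in> O'"
    and P0: "\<And>p. p \<in> S \<Longrightarrow> P (p, r p) = 0" and P: "C2_differentiable O' P"
    and P': "\<And>p. p \<in> S \<Longrightarrow> (P has_derivative P' p) (at (p, r p))"
    and nz: "\<And>p. p \<in> S \<Longrightarrow> P' p (0, 1) \<noteq> 0"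
  shows "C2_differentiable S r"
proof -
  obtain Q where Q: "\<And>x. x \<in> O' \<Longrightarrow> (P has_derivative Q x) (at x)" "\<And>h. C1_differentiable O' (\<lambda>x. Q x h)"
    using P C2_differentiable_derivative by metis
  have QP': "P' p = Q (p, r p)" if "p \<in> S" for p
    using has_derivative_unique[OF P'[OF that] Q(1)[OF sub[OF that]]] .
  have r': "(r has_derivative (\<lambda>h. - (inverse (Q (p, r p) (0, 1)) *\<^sub>R Q (p, r p) (h, 0)))) (at p)" if "p \<in> S" for p
  proof -
    have "isCont r p" using r S that by (simp add: continuous_on_eq_continuous_at)
    from has_derivative_implicit_real[OF S that this P0 P'[OF that] nz[OF that]]
    show ?thesis using QP'[OF that] by (simp add: divide_inverse mult.commute)
  qed
  have emb: "(\<lambda>p. (p, r p)) ` S \<subseteq> O'" using sub by auto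
  have "continuous_on S (\<lambda>p. - (inverse (Q (p, r p) (0, 1)) *\<^sub>R Q (p, r p) (h, 0)))" for h
    using nz QP' emb
    by (intro continuous_intros r ballI continuous_on_compose2[OF C1_imp_continuous_on[OF Q(2)], where f = "\<lambda>p. (p, r p)"]) auto
  with r' have C1r: "C1_differentiable S r" unfolding C1_differentiable_def
    by (intro exI[of _ "\<lambda>p h. - (inverse (Q (p, r p) (0, 1)) *\<^sub>R Q (p, r p) (h, 0))"]) blast
  have C1: "C1_differentiable S (\<lambda>p. (p, r p))"
    by (rule C1_differentiable_Pair[OF C1_differentiable_bounded_linear[OF bounded_linear_ident] C1r])
  have "C1_differentiable S (\<lambda>p. Q (p, r p) h)" for h
    by (rule C1_differentiable_compose[OF C1 Q(2) emb])
  moreover have "C1_differentiable S (\<lambda>p. inverse (Q (p, r p) (0, 1)))"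
    using nz QP' by (intro C1_differentiable_compose[OF calculation C1_differentiable_inverse]) auto
  ultimately have "C1_differentiable S (\<lambda>p. (-1) *\<^sub>R (inverse (Q (p, r p) (0, 1)) *\<^sub>R Q (p, r p) (h, 0)))" for h
    by (intro C1_differentiable_scaleR C1_differentiable_const)
  with r' show ?thesis unfolding C2_differentiable_def
    by (intro exI[of _ "\<lambda>p h. - (inverse (Q (p, r p) (0, 1)) *\<^sub>R Q (p, r p) (h, 0))"]) simp
qed

section \<open>Differentiation under the integral sign\<close>

text \<open>\<open>leibniz_rule\<close> wants the derivative as a jointly continuous operator-valued
  map; it is assembled from the directional derivatives, and its integral is evaluated in a
  direction by commuting integral and evaluation.\<close>

lemma has_derivative_integral_cbox:
  fixes f :: "'a::euclidean_space \<Rightarrow> 'b::euclidean_space \<Rightarrow> real"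
  assumes U: "open U" "convex U" "x0 \<in> U"
    and f: "\<And>x q. x \<in> U \<Longrightarrow> q \<in> cbox a b \<Longrightarrow> ((\<lambda>x. f x q) has_derivative f' x q) (at x)"
    and int: "\<And>x. x \<in> U \<Longrightarrow> f x integrable_on cbox a b"
    and cont: "\<And>k. continuous_on (U \<times> cbox a b) (\<lambda>(x, q). f' x q k)"
  shows "((\<lambda>x. integral (cbox a b) (f x)) has_derivative (\<lambda>k. integral (cbox a b) (\<lambda>q. f' x0 q k))) (at x0)"
proof -
  define F where "F x q = Blinfun (f' x q)" for x q
  have F: "blinfun_apply (F x q) = f' x q" if "x \<in> U" "q \<in> cbox a b" for x q
    unfolding F_def by (rule bounded_linear_Blinfun_apply[OF has_derivative_bounded_linear[OF f[OF that]]])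
  have contF: "continuous_on (U \<times> cbox a b) (\<lambda>(x, q). F x q)"
  proof (rule continuous_on_blinfun_componentwise)
    show "continuous_on (U \<times> cbox a b) (\<lambda>x. blinfun_apply (case x of (x, q) \<Rightarrow> F x q) k)" for k
      using cont[of k] by (rule continuous_on_eq) (clarsimp simp: F)
  qed
  have "((\<lambda>x. integral (cbox a b) (f x)) has_derivative integral (cbox a b) (F x0)) (at x0 within U)"
  proof (rule leibniz_rule[where fx = F and f = f, OF _ int contF U(3,2)])
    show "((\<lambda>x. f x q) has_derivative blinfun_apply (F x q)) (at x within U)"
      if "x \<in> U" "q \<in> cbox a b" for x q
      unfolding F[OF that] by (rule has_derivative_at_withinI[OF f[OF that]])
  qed
  then have "((\<lambda>x. integral (cbox a b) (f x)) has_derivative integral (cbox a b) (F x0)) (at x0)"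
    by (simp only: at_within_open[OF U(3,1)])
  moreover have "blinfun_apply (integral (cbox a b) (F x0)) = (\<lambda>k. integral (cbox a b) (\<lambda>q. f' x0 q k))"
  proof
    fix k
    have "continuous_on (cbox a b) (\<lambda>q. case (x0, q) of (x, q) \<Rightarrow> F x q)"
      by (rule continuous_on_compose2[OF contF]) (use U in \<open>auto intro!: continuous_intros\<close>)
    then have "continuous_on (cbox a b) (F x0)" by simp
    then have "F x0 integrable_on cbox a b" by (rule integrable_continuous)
    from integral_linear[OF this bounded_linear_apply_blinfun[of k]]
    have "blinfun_apply (integral (cbox a b) (F x0)) k = integral (cbox a b) (\<lambda>q. blinfun_apply (F x0 q) k)"
      by (simp add: o_def)
    also have "\<dots> = integral (cbox a b) (\<lambda>q. f' x0 q k)"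
      by (rule integral_cong) (simp add: F[OF U(3)])
    finally show "blinfun_apply (integral (cbox a b) (F x0)) k = integral (cbox a b) (\<lambda>q. f' x0 q k)" .
  qed
  ultimately show ?thesis by simp
qed

lemma C2_differentiable_integral_cbox:
  fixes f :: "'a::euclidean_space \<Rightarrow> 'b::euclidean_space \<Rightarrow> real"
  assumes U: "open U" "convex U"
    and f: "\<And>x q. x \<in> U \<Longrightarrow> q \<in> cbox a b \<Longrightarrow> ((\<lambda>x. f x q) has_derivative f' x q) (at x)"
    and f': "\<And>x q h. x \<in> U \<Longrightarrow> q \<in> cbox a b \<Longrightarrow> ((\<lambda>x. f' x q h) has_derivative f'' h x q) (at x)"
    and cont: "continuous_on (U \<times> cbox a b) (\<lambda>(x, q). f x q)"
      "\<And>h. continuous_on (U \<times> cbox a b) (\<lambda>(x, q). f' x q h)"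
      "\<And>h k. continuous_on (U \<times> cbox a b) (\<lambda>(x, q). f'' h x q k)"
  shows "C2_differentiable U (\<lambda>x. integral (cbox a b) (f x))"
proof -
  have int: "g x integrable_on cbox a b"
    if "continuous_on (U \<times> cbox a b) (\<lambda>(x, q). g x q)" "x \<in> U" for g :: "'a \<Rightarrow> 'b \<Rightarrow> real" and x
  proof (rule integrable_continuous)
    have "continuous_on (cbox a b) (\<lambda>q. case (x, q) of (x, q) \<Rightarrow> g x q)"
      by (rule continuous_on_compose2[OF that(1)]) (use that in \<open>auto intro!: continuous_intros\<close>)
    then show "continuous_on (cbox a b) (g x)" by simp
  qed
  have "C1_differentiable U (\<lambda>x. integral (cbox a b) (\<lambda>q. f' x q h))" for h
    unfolding C1_differentiable_def
  proof (intro exI conjI ballI allI)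
    show "((\<lambda>x. integral (cbox a b) (\<lambda>q. f' x q h)) has_derivative
        (\<lambda>k. integral (cbox a b) (\<lambda>q. f'' h x q k))) (at x)" if "x \<in> U" for x
      using U that f' int[OF cont(2)] cont(3) by (rule has_derivative_integral_cbox)
    show "continuous_on U (\<lambda>x. integral (cbox a b) (\<lambda>q. f'' h x q k))" for k
      by (rule integral_continuous_on_param) (rule cont)
  qed
  moreover have "((\<lambda>x. integral (cbox a b) (f x)) has_derivative
        (\<lambda>k. integral (cbox a b) (\<lambda>q. f' x q k))) (at x)" if "x \<in> U" for x
    using U that f int[OF cont(1)] cont(2) by (rule has_derivative_integral_cbox)
  ultimately show ?thesis
    unfolding C2_differentiable_def
    by (intro exI[of _ "\<lambda>x k. integral (cbox a b) (\<lambda>q. f' x q k)"]) blast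
qed

text \<open>The weight \<^term>\<open>w\<close> cuts the box down to a region on which the integrand is regular.\<close>

lemma continuous_on_weighted:
  fixes g :: "'a::euclidean_space \<times> 'b::euclidean_space \<Rightarrow> real" and w :: "'b \<Rightarrow> real"
  assumes g: "continuous_on G g" and w: "continuous_on UNIV w" and K: "closed K"
    and sub: "U \<times> (cbox a b \<inter> K) \<subseteq> G" and w0: "\<And>q. q \<notin> interior K \<Longrightarrow> w q = 0"
  shows "continuous_on (U \<times> cbox a b) (\<lambda>(x, q). w q * g (x, q))"
proof -
  have w': "continuous_on S (\<lambda>p. w (snd p))" for S :: "('a \<times> 'b) set"
    by (intro continuous_on_compose2[OF w] continuous_intros) auto
  \<comment> \<open>Two relatively closed pieces cover the domain: over \<open>K\<close> the
    function \<open>g\<close> is continuous, and off the interior of \<open>K\<close> the product is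
    0 whatever the value of \<open>g\<close>.\<close>
  have "continuous_on (U \<times> cbox a b \<inter> {p. snd p \<in> K} \<union> U \<times> cbox a b \<inter> {p. snd p \<notin> interior K})
      (\<lambda>p. w (snd p) * g p)"
  proof (rule continuous_on_Un_local)
    have 1: "closed {p::'a \<times> 'b. snd p \<in> K}" and 2: "closed {p::'a \<times> 'b. snd p \<notin> interior K}"
      using continuous_closed_vimage[OF K, of snd]
        continuous_closed_vimage[of "- interior K" snd] by (auto simp: vimage_def continuous_snd)
    have un: "U \<times> cbox a b \<inter> {p. snd p \<in> K} \<union> U \<times> cbox a b \<inter> {p. snd p \<notin> interior K} = U \<times> cbox a b"
      using interior_subset[of K] by auto
    show "closedin (top_of_set (U \<times> cbox a b \<inter> {p. snd p \<in> K} \<union> U \<times> cbox a b \<inter> {p. snd p \<notin> interior K}))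
        (U \<times> cbox a b \<inter> {p. snd p \<in> K})"
      unfolding un using 1 by (rule closedin_closed_Int)
    show "closedin (top_of_set (U \<times> cbox a b \<inter> {p. snd p \<in> K} \<union> U \<times> cbox a b \<inter> {p. snd p \<notin> interior K}))
        (U \<times> cbox a b \<inter> {p. snd p \<notin> interior K})"
      unfolding un using 2 by (rule closedin_closed_Int)
    show "continuous_on (U \<times> cbox a b \<inter> {p. snd p \<in> K}) (\<lambda>p. w (snd p) * g p)"
      using sub by (intro continuous_on_mult w' continuous_on_subset[OF g]) auto
    have "continuous_on (U \<times> cbox a b \<inter> {p. snd p \<notin> interior K}) (\<lambda>p. 0 :: real)" by simp
    then show "continuous_on (U \<times> cbox a b \<inter> {p. snd p \<notin> interior K}) (\<lambda>p. w (snd p) * g p)"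
      by (rule continuous_on_eq) (auto simp: w0)
  qed
  then show ?thesis
    by (rule continuous_on_subset[THEN continuous_on_eq]) (use interior_subset[of K] in \<open>auto split: prod.splits\<close>)
qed

lemma C2_differentiable_weighted_integral:
  fixes H :: "'a::euclidean_space \<times> 'b::euclidean_space \<Rightarrow> real" and w :: "'b \<Rightarrow> real"
  assumes U: "open U" "convex U" and G: "open G" and H: "C2_differentiable G H"
    and w: "continuous_on UNIV w" and K: "closed K"
    and sub: "U \<times> (cbox a b \<inter> K) \<subseteq> G" and w0: "\<And>q. q \<notin> interior K \<Longrightarrow> w q = 0"
  shows "C2_differentiable U (\<lambda>x. integral (cbox a b) (\<lambda>q. w q * H (x, q)))"
proof -
  obtain H' where H': "\<And>p. p \<in> G \<Longrightarrow> (H has_derivative H' p) (at p)" "\<And>h. C1_differentiable G (\<lambda>p. H' p h)"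
    using H C2_differentiable_derivative by metis
  have "\<exists>g. (\<forall>x\<in>G. ((\<lambda>x. H' x h) has_derivative g x) (at x)) \<and> (\<forall>k. continuous_on G (\<lambda>x. g x k))" for h
    using H'(2)[of h] unfolding C1_differentiable_def .
  then obtain H'' where H'': "\<And>h x. x \<in> G \<Longrightarrow> ((\<lambda>x. H' x h) has_derivative H'' h x) (at x)"
    "\<And>h k. continuous_on G (\<lambda>x. H'' h x k)" by metis
  \<comment> \<open>Where \<open>w q\<close> = 0 the product vanishes identically in x, so its
    derivative is 0 even at points where \<open>g\<close> is not differentiable.\<close>
  have partial: "((\<lambda>x. w q * g (x, q)) has_derivative (\<lambda>k. w q * g' (k, 0))) (at x)"
    if g: "w q \<noteq> 0 \<Longrightarrow> (g has_derivative g') (at (x, q))" for g :: "'a \<times> 'b \<Rightarrow> real" and g' x q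
  proof (cases "w q = 0")
    case False
    have "((\<lambda>x. (x, q)) has_derivative (\<lambda>k. (k, 0))) (at x)" by (auto intro!: derivative_eq_intros)
    from diff_chain_at[OF this g[OF False]] have "((\<lambda>x. g (x, q)) has_derivative (\<lambda>k. g' (k, 0))) (at x)"
      by (simp add: o_def)
    then show ?thesis by (rule has_derivative_mult_right)
  qed simp
  have inG: "(x, q) \<in> G" if "x \<in> U" "q \<in> cbox a b" "w q \<noteq> 0" for x q
    using sub w0[of q] that interior_subset[of K] by auto
  have cw: "continuous_on (U \<times> cbox a b) (\<lambda>(x, q). w q * g (x, q))"
    if g: "continuous_on G g" for g :: "'a \<times> 'b \<Rightarrow> real"
    using continuous_on_weighted[OF g w K sub w0] .
  show ?thesis
  proof (rule C2_differentiable_integral_cbox[OF U])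
    show "((\<lambda>x. w q * H (x, q)) has_derivative (\<lambda>k. w q * H' (x, q) (k, 0))) (at x)"
      if "x \<in> U" "q \<in> cbox a b" for x q
      using that by (intro partial H'(1) inG)
    show "((\<lambda>x. w q * H' (x, q) (h, 0)) has_derivative (\<lambda>k. w q * H'' (h, 0) (x, q) (k, 0))) (at x)"
      if "x \<in> U" "q \<in> cbox a b" for x q h
      using that by (intro partial[where g = "\<lambda>p. H' p (h, 0)"] H''(1) inG)
    show "continuous_on (U \<times> cbox a b) (\<lambda>(x, q). w q * H (x, q))"
      by (intro cw C1_imp_continuous_on C2_imp_C1 H)
    show "continuous_on (U \<times> cbox a b) (\<lambda>(x, q). w q * H' (x, q) (h, 0))" for h
      by (intro cw[where g = "\<lambda>p. H' p (h, 0)"] C1_imp_continuous_on H')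
    show "continuous_on (U \<times> cbox a b) (\<lambda>(x, q). w q * H'' (h, 0) (x, q) (k, 0))" for h k
      by (intro cw[where g = "\<lambda>p. H'' (h, 0) p (k, 0)"] H'')
  qed
qed

section \<open>Polar coordinates on a shell\<close>

text \<open>A continuous function of |z|, positive exactly on the shell 1 < |z| < 2. It carries no
  derivatives, as these are taken in the parameter only.\<close>

definition shell_weight :: "'b::real_normed_vector \<Rightarrow> real" where
  "shell_weight z = max 0 ((norm z - 1) * (2 - norm z))"

text \<open>The integral of the weight of x/s against ds/s over s > 0, for any unit vector
  x.\<close>

definition shell_const :: ennreal where
  "shell_const = (\<integral>\<^sup>+v. indicator {0<..} v * ennreal (max 0 ((1/v - 1) * (2 - 1/v)) / v) \<partial>lborel)"

lemma shell_weight_nonneg: "0 \<le> shell_weight z"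
  by (simp add: shell_weight_def)

lemma shell_weight_eq_0: "norm z \<le> 1 \<or> 2 \<le> norm z \<Longrightarrow> shell_weight z = 0"
  by (auto simp: shell_weight_def mult_le_0_iff intro: max_absorb1)

lemma continuous_shell_weight: "continuous_on S shell_weight"
  unfolding shell_weight_def by (intro continuous_intros)

lemma shell_weight_measurable [measurable]: "shell_weight \<in> borel_measurable borel"
  using continuous_shell_weight by (rule borel_measurable_continuous_onI)

text \<open>For v in [3/5, 3/4] the reciprocal 1/v lies in [4/3, 5/3], so the integrand is at least
  (1/9) (4/3) > 1/8. Outside [1/2, 1] it vanishes, and inside it is at most 2.\<close>

lemma shell_const_pos_finite: "0 < shell_const" "shell_const < \<infinity>"
proof -
  have "(\<integral>\<^sup>+v. ennreal (1/8) * indicator {3/5..3/4::real} v \<partial>lborel) \<le> shell_const"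
    unfolding shell_const_def
  proof (rule nn_integral_mono)
    fix v :: real
    show "ennreal (1/8) * indicator {3/5..3/4} v \<le> indicator {0<..} v * ennreal (max 0 ((1/v - 1) * (2 - 1/v)) / v)"
    proof (cases "v \<in> {3/5..3/4}")
      case True
      then have v: "4/3 \<le> 1/v" "1/v \<le> 5/3" by (auto simp: field_simps)
      have "(1/3) * (1/3) \<le> (1/v - 1) * (2 - 1/v)" using v by (intro mult_mono) auto
      then have "(1/9) * (4/3) \<le> max 0 ((1/v - 1) * (2 - 1/v)) * (1/v)" using v by (intro mult_mono) auto
      then have "1/8 \<le> max 0 ((1/v - 1) * (2 - 1/v)) / v" by simp
      then show ?thesis using True by (auto intro!: ennreal_leI)
    qed simp
  qed
  moreover have "(\<integral>\<^sup>+v. ennreal (1/8) * indicator {3/5..3/4::real} v \<partial>lborel) = ennreal (1/8 * (3/20))"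
    by (simp add: nn_integral_cmult ennreal_mult[symmetric])
  ultimately show "0 < shell_const" by (auto intro: less_le_trans[rotated])
  have "shell_const \<le> (\<integral>\<^sup>+v. ennreal 2 * indicator {0..1::real} v \<partial>lborel)"
    unfolding shell_const_def
  proof (rule nn_integral_mono)
    fix v :: real
    show "indicator {0<..} v * ennreal (max 0 ((1/v - 1) * (2 - 1/v)) / v) \<le> ennreal 2 * indicator {0..1} v"
    proof (cases "v \<in> {1/2..1}")
      case True
      then have v: "1 \<le> 1/v" "1/v \<le> 2" by (auto simp: field_simps)
      have "(1/v - 1) * (2 - 1/v) \<le> 1 * 1" using v by (intro mult_mono) auto
      then have "max 0 ((1/v - 1) * (2 - 1/v)) * (1/v) \<le> 1 * 2" using v True by (intro mult_mono) auto
      then have "ennreal (max 0 ((1/v - 1) * (2 - 1/v)) / v) \<le> ennreal 2" by (intro ennreal_leI) simp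
      then show ?thesis using True by simp
    next
      case False
      then have "1/v \<le> 1 \<or> 2 \<le> 1/v" if "0 < v" using that by (auto simp: field_simps)
      then have "0 < v \<Longrightarrow> (1/v - 1) * (2 - 1/v) \<le> 0" by (force simp only: mult_le_0_iff)
      then show ?thesis using False by (auto simp: max_def split: split_indicator)
    qed
  qed
  also have "\<dots> < \<infinity>" by (simp add: nn_integral_cmult ennreal_mult_less_top)
  finally show "shell_const < \<infinity>" .
qed

lemma nn_integral_lborel_scaleR:
  fixes f :: "'b::euclidean_space \<Rightarrow> ennreal"
  assumes [measurable]: "f \<in> borel_measurable borel" and c: "c \<noteq> 0"
  shows "(\<integral>\<^sup>+x. f x \<partial>lborel) = ennreal (\<bar>c\<bar> ^ DIM('b)) * (\<integral>\<^sup>+x. f (c *\<^sub>R x) \<partial>lborel)"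
  by (subst lborel_affine[OF c, of 0])
     (simp add: nn_integral_density nn_integral_distr nn_integral_cmult)

text \<open>The measure ds/s is invariant under dilations, so the substitution s = |x| v removes
  x.\<close>

lemma shell_weight_integral:
  fixes x :: "'b::euclidean_space"
  assumes "x \<noteq> 0"
  shows "(\<integral>\<^sup>+s. indicator {0<..} s * ennreal (shell_weight ((1/s) *\<^sub>R x) / s) \<partial>lborel) = shell_const"
proof -
  have n: "norm x > 0" using assms by simp
  have [measurable]: "(\<lambda>s::real. shell_weight ((1/s) *\<^sub>R x)) \<in> borel_measurable borel"
    by measurable
  have "(\<integral>\<^sup>+s. indicator {0<..} s * ennreal (shell_weight ((1/s) *\<^sub>R x) / s) \<partial>lborel)
    = ennreal (norm x) * (\<integral>\<^sup>+v. indicator {0<..} (norm x * v) * ennreal (shell_weight ((1/(norm x * v)) *\<^sub>R x) / (norm x * v)) \<partial>lborel)"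
    using n by (subst nn_integral_real_affine[where c = "norm x" and t = 0]) auto
  also have "\<dots> = (\<integral>\<^sup>+v. ennreal (norm x) * (indicator {0<..} (norm x * v) * ennreal (shell_weight ((1/(norm x * v)) *\<^sub>R x) / (norm x * v))) \<partial>lborel)"
    by (subst nn_integral_cmult) auto
  also have "\<dots> = shell_const"
    unfolding shell_const_def
  proof (rule nn_integral_cong)
    fix v :: real
    show "ennreal (norm x) * (indicator {0<..} (norm x * v) * ennreal (shell_weight ((1/(norm x * v)) *\<^sub>R x) / (norm x * v)))
      = indicator {0<..} v * ennreal (max 0 ((1/v - 1) * (2 - 1/v)) / v)"
    proof (cases "0 < v")
      case True
      then have "norm ((1/(norm x * v)) *\<^sub>R x) = 1/v" using n by simp
      then have "shell_weight ((1/(norm x * v)) *\<^sub>R x) = max 0 ((1/v - 1) * (2 - 1/v))"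
        unfolding shell_weight_def by simp
      then show ?thesis using True n by (simp add: ennreal_mult[symmetric])
    next
      case False
      then have "\<not> 0 < norm x * v" using n by (simp add: zero_less_mult_iff)
      then show ?thesis using False by simp
    qed
  qed
  finally show ?thesis .
qed

text \<open>Polar coordinates in which a spherical shell replaces the sphere: the radial weight is
  averaged over all dilations.\<close>

lemma nn_integral_shell:
  fixes g :: "'b::euclidean_space \<Rightarrow> ennreal"
  assumes [measurable]: "g \<in> borel_measurable borel"
  shows "shell_const * (\<integral>\<^sup>+x. g x \<partial>lborel)
    = (\<integral>\<^sup>+z. ennreal (shell_weight z) * (\<integral>\<^sup>+s. indicator {0<..} s * ennreal (s ^ (DIM('b) - 1)) * g (s *\<^sub>R z) \<partial>lborel) \<partial>lborel)"
proof -
  define k where "k s x = indicator {0<..} s * ennreal (shell_weight ((1/s) *\<^sub>R x) / s)" for s :: real and x :: 'b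
  have [measurable]: "(\<lambda>(s, x). k s x * g x) \<in> borel_measurable (lborel \<Otimes>\<^sub>M lborel)"
    "(\<lambda>(x, s). k s x * g x) \<in> borel_measurable (lborel \<Otimes>\<^sub>M lborel)"
    "\<And>x. (\<lambda>s. k s x) \<in> borel_measurable lborel" "\<And>s. (\<lambda>x. k s x) \<in> borel_measurable borel"
    unfolding k_def split_beta by measurable
  have "shell_const * (\<integral>\<^sup>+x. g x \<partial>lborel) = (\<integral>\<^sup>+x. shell_const * g x \<partial>lborel)"
    by (simp add: nn_integral_cmult)
  also have "\<dots> = (\<integral>\<^sup>+x. (\<integral>\<^sup>+s. k s x * g x \<partial>lborel) \<partial>lborel)"
  proof (rule nn_integral_cong_AE)
    \<comment> \<open>At the origin the average over dilations is 0 instead of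
      \<open>shell_const\<close>.\<close>
    have "AE x in lborel. x \<noteq> (0::'b)" by (rule AE_lborel_singleton)
    then show "AE x in lborel. shell_const * g x = (\<integral>\<^sup>+s. k s x * g x \<partial>lborel)"
      by eventually_elim (simp add: nn_integral_multc, simp add: k_def shell_weight_integral)
  qed
  also have "\<dots> = (\<integral>\<^sup>+s. (\<integral>\<^sup>+x. k s x * g x \<partial>lborel) \<partial>lborel)"
    by (rule lborel_pair.Fubini') measurable
  also have "\<dots> = (\<integral>\<^sup>+s. (\<integral>\<^sup>+z. ennreal (shell_weight z) * (indicator {0<..} s * ennreal (s ^ (DIM('b) - 1)) * g (s *\<^sub>R z)) \<partial>lborel) \<partial>lborel)"
  proof (rule nn_integral_cong)
    fix s :: real
    show "(\<integral>\<^sup>+x. k s x * g x \<partial>lborel)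
      = (\<integral>\<^sup>+z. ennreal (shell_weight z) * (indicator {0<..} s * ennreal (s ^ (DIM('b) - 1)) * g (s *\<^sub>R z)) \<partial>lborel)"
    proof (cases "0 < s")
      \<comment> \<open>Substituting x = s z turns the weight of x/s into that of z; one factor of
        the Jacobian, a power of s, cancels the 1/s of the kernel.\<close>
      case True
      have "(\<integral>\<^sup>+x. k s x * g x \<partial>lborel) = ennreal (s ^ DIM('b)) * (\<integral>\<^sup>+z. k s (s *\<^sub>R z) * g (s *\<^sub>R z) \<partial>lborel)"
        using True by (subst nn_integral_lborel_scaleR[where c = s]) auto
      also have "\<dots> = (\<integral>\<^sup>+z. ennreal (s ^ DIM('b)) * (k s (s *\<^sub>R z) * g (s *\<^sub>R z)) \<partial>lborel)"
        by (subst nn_integral_cmult) measurable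
      also have "\<dots> = (\<integral>\<^sup>+z. ennreal (shell_weight z) * (indicator {0<..} s * ennreal (s ^ (DIM('b) - 1)) * g (s *\<^sub>R z)) \<partial>lborel)"
      proof (rule nn_integral_cong)
        fix z :: 'b
        have "s ^ DIM('b) = s * s ^ (DIM('b) - 1)" by (metis DIM_positive power_minus_mult mult.commute)
        then have "s ^ DIM('b) * (shell_weight z / s) = shell_weight z * s ^ (DIM('b) - 1)" using True by simp
        then have "ennreal (s ^ DIM('b)) * ennreal (shell_weight z / s) = ennreal (shell_weight z) * ennreal (s ^ (DIM('b) - 1))"
          using True by (simp add: shell_weight_nonneg flip: ennreal_mult)
        moreover have "k s (s *\<^sub>R z) = ennreal (shell_weight z / s)" using True by (simp add: k_def)
        ultimately show "ennreal (s ^ DIM('b)) * (k s (s *\<^sub>R z) * g (s *\<^sub>R z))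
          = ennreal (shell_weight z) * (indicator {0<..} s * ennreal (s ^ (DIM('b) - 1)) * g (s *\<^sub>R z))"
          using True by (simp add: mult.assoc[symmetric])
      qed
      finally show ?thesis .
    qed (simp add: k_def)
  qed
  also have "\<dots> = (\<integral>\<^sup>+z. (\<integral>\<^sup>+s. ennreal (shell_weight z) * (indicator {0<..} s * ennreal (s ^ (DIM('b) - 1)) * g (s *\<^sub>R z)) \<partial>lborel) \<partial>lborel)"
    by (rule lborel_pair.Fubini') measurable
  also have "\<dots> = (\<integral>\<^sup>+z. ennreal (shell_weight z) * (\<integral>\<^sup>+s. indicator {0<..} s * ennreal (s ^ (DIM('b) - 1)) * g (s *\<^sub>R z) \<partial>lborel) \<partial>lborel)"
    by (intro nn_integral_cong nn_integral_cmult) measurable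
  finally show ?thesis .
qed

text \<open>A coordinate box around the shell, times [0, 1]: differentiation under the integral sign
  is set up over boxes, and the weight cuts out the shell.\<close>

abbreviation shell_box :: "('b::euclidean_space \<times> real) set" where
  "shell_box \<equiv> cbox (- 2 *\<^sub>R One, 0) (2 *\<^sub>R One, 1)"

lemma mem_shell_box:
  fixes z :: "'b::euclidean_space"
  assumes "norm z \<le> 2"
  shows "(z, u) \<in> shell_box \<longleftrightarrow> 0 \<le> u \<and> u \<le> 1"
proof -
  have "\<bar>z \<bullet> b\<bar> \<le> 2" if "b \<in> Basis" for b
    using Basis_le_norm[OF that, of z] assms by simp
  then have "z \<in> cbox (- 2 *\<^sub>R One) (2 *\<^sub>R One)"
    by (auto simp: mem_box abs_le_iff minus_le_iff)
  then show ?thesis by (auto simp: cbox_Pair_eq mem_box)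
qed

text \<open>On each ray the substitution s = R(z) u turns membership in \<open>E\<close> into u < 1,
  so the dependence on \<open>E\<close> moves from the domain of integration into the integrand,
  through \<open>R\<close>.\<close>

lemma nn_integral_starlike:
  fixes E :: "'b::euclidean_space set" and G R :: "'b \<Rightarrow> real"
  assumes R: "\<And>z. z \<noteq> 0 \<Longrightarrow> 0 < R z"
    and E: "\<And>z s. z \<noteq> 0 \<Longrightarrow> 0 < s \<Longrightarrow> s *\<^sub>R z \<in> E \<longleftrightarrow> s < R z"
    and meas: "(\<lambda>x. indicator E x * ennreal (G x)) \<in> borel_measurable borel"
    and G: "\<And>x. 0 \<le> G x"
    and cont: "continuous_on shell_box
      (\<lambda>(z, u). shell_weight z * (R z ^ DIM('b) * u ^ (DIM('b) - 1) * G (u *\<^sub>R R z *\<^sub>R z)))"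
  shows "shell_const * (\<integral>\<^sup>+x. indicator E x * ennreal (G x) \<partial>lborel)
    = ennreal (integral shell_box
      (\<lambda>(z, u). shell_weight z * (R z ^ DIM('b) * u ^ (DIM('b) - 1) * G (u *\<^sub>R R z *\<^sub>R z))))"
proof -
  define m where "m = DIM('b) - 1"
  have m: "DIM('b) = Suc m" by (simp add: m_def)
  define f where "f = (\<lambda>p::'b \<times> real. shell_weight (fst p) * (R (fst p) ^ DIM('b) * snd p ^ m * G (snd p *\<^sub>R R (fst p) *\<^sub>R fst p)))"
  have f_eq: "(\<lambda>(z, u). shell_weight z * (R z ^ DIM('b) * u ^ (DIM('b) - 1) * G (u *\<^sub>R R z *\<^sub>R z))) = f"
    by (auto simp: f_def m_def)
  define g where "g x = indicator E x * ennreal (G x)" for x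
  have [measurable]: "g \<in> borel_measurable borel" using meas by (simp add: g_def[abs_def])
  have int: "integrable lborel (\<lambda>p. indicator shell_box p *\<^sub>R f p)"
    using borel_integrable_compact[of shell_box f] cont unfolding f_eq by (simp add: compact_cbox)
  have f0: "0 \<le> indicator shell_box p *\<^sub>R f p" for p
  \<comment> \<open>At z = 0 the sign of \<open>R\<close> is unknown, but the weight vanishes
    there.\<close>
  proof (cases "p \<in> shell_box \<and> fst p \<noteq> 0")
    case True
    then have "0 \<le> snd p" by (cases p) (auto simp: cbox_Pair_eq mem_box)
    then show ?thesis using True R[of "fst p"] G
      by (auto simp: f_def intro!: mult_nonneg_nonneg shell_weight_nonneg)
  next
    case False
    then show ?thesis by (auto simp: f_def shell_weight_eq_0)
  qed
  have "shell_const * (\<integral>\<^sup>+x. g x \<partial>lborel)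
    = (\<integral>\<^sup>+z. ennreal (shell_weight z) * (\<integral>\<^sup>+s. indicator {0<..} s * ennreal (s ^ m) * g (s *\<^sub>R z) \<partial>lborel) \<partial>lborel)"
    using nn_integral_shell[of g] by (simp add: m_def)
  also have "\<dots> = (\<integral>\<^sup>+z. (\<integral>\<^sup>+u. ennreal (indicator shell_box (z, u) *\<^sub>R f (z, u)) \<partial>lborel) \<partial>lborel)"
  proof (rule nn_integral_cong)
    fix z :: 'b
    show "ennreal (shell_weight z) * (\<integral>\<^sup>+s. indicator {0<..} s * ennreal (s ^ m) * g (s *\<^sub>R z) \<partial>lborel)
      = (\<integral>\<^sup>+u. ennreal (indicator shell_box (z, u) *\<^sub>R f (z, u)) \<partial>lborel)"
    proof (cases "shell_weight z = 0")
      case True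
      then show ?thesis by (simp add: f_def)
    next
      case False
      then have z: "norm z \<le> 2" "z \<noteq> 0" using shell_weight_eq_0[of z] by force+
      note Rz = R[OF z(2)]
      have "(\<integral>\<^sup>+s. indicator {0<..} s * ennreal (s ^ m) * g (s *\<^sub>R z) \<partial>lborel)
        = ennreal (R z) * (\<integral>\<^sup>+u. indicator {0<..} (R z * u) * ennreal ((R z * u) ^ m) * g ((R z * u) *\<^sub>R z) \<partial>lborel)"
        using Rz by (subst nn_integral_real_affine[where c = "R z" and t = 0]) auto
      then have "ennreal (shell_weight z) * (\<integral>\<^sup>+s. indicator {0<..} s * ennreal (s ^ m) * g (s *\<^sub>R z) \<partial>lborel)
        = (\<integral>\<^sup>+u. ennreal (shell_weight z) * (ennreal (R z) * (indicator {0<..} (R z * u) * ennreal ((R z * u) ^ m) * g ((R z * u) *\<^sub>R z))) \<partial>lborel)"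
        by (simp add: nn_integral_cmult)
      also have "\<dots> = (\<integral>\<^sup>+u. ennreal (indicator shell_box (z, u) *\<^sub>R f (z, u)) \<partial>lborel)"
      proof (rule nn_integral_cong_AE)
        \<comment> \<open>Exceptional points: u = 0 lies in the box but is excluded by s > 0, and u
          = 1 lies in the box although R(z) z is not in \<open>E\<close>.\<close>
        have "AE u in lborel. u \<noteq> (0::real)" "AE u in lborel. u \<noteq> (1::real)" by (rule AE_lborel_singleton)+
        then show "AE u in lborel. ennreal (shell_weight z) * (ennreal (R z) * (indicator {0<..} (R z * u) * ennreal ((R z * u) ^ m) * g ((R z * u) *\<^sub>R z)))
          = ennreal (indicator shell_box (z, u) *\<^sub>R f (z, u))"
        proof eventually_elim
          fix u :: real assume u: "u \<noteq> 0" "u \<noteq> 1"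
          show "ennreal (shell_weight z) * (ennreal (R z) * (indicator {0<..} (R z * u) * ennreal ((R z * u) ^ m) * g ((R z * u) *\<^sub>R z)))
            = ennreal (indicator shell_box (z, u) *\<^sub>R f (z, u))"
          proof (cases "0 < u")
            case pos: True
            then have Ru: "0 < R z * u" using Rz by simp
            have "indicator E ((R z * u) *\<^sub>R z) = (if u < 1 then 1 else (0::ennreal))"
              using E[OF z(2) Ru] Rz by auto
            moreover have "indicator shell_box (z, u) = (if u < 1 then 1 else (0::real))"
              using mem_shell_box[OF z(1), of u] pos u by (auto simp del: cbox_Pair_iff)
            moreover have "ennreal (shell_weight z) * (ennreal (R z) * (ennreal ((R z * u) ^ m) * ennreal (G ((R z * u) *\<^sub>R z))))
              = ennreal (f (z, u))"
              using Rz Ru pos G by (simp add: f_def m shell_weight_nonneg power_mult_distrib ac_simps flip: ennreal_mult)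
            ultimately show ?thesis using Ru by (simp add: g_def)
          next
            case False
            then have "(z, u) \<notin> shell_box" using mem_shell_box[OF z(1), of u] u by auto
            moreover have "\<not> 0 < R z * u" using False Rz by (simp add: zero_less_mult_iff)
            ultimately show ?thesis by simp
          qed
        qed
      qed
      finally show ?thesis .
    qed
  qed
  also have "\<dots> = (\<integral>\<^sup>+p. ennreal (indicator shell_box p *\<^sub>R f p) \<partial>lborel)"
    using int by (subst lborel_prod[symmetric], subst lborel.nn_integral_fst[symmetric])
      (auto simp: lborel_prod dest!: borel_measurable_integrable)
  also have "\<dots> = ennreal (LINT p|lborel. indicator shell_box p *\<^sub>R f p)"
    using int f0 by (intro nn_integral_eq_integral) auto
  also have "(LINT p|lborel. indicator shell_box p *\<^sub>R f p) = integral shell_box f"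
    using set_borel_integral_eq_integral(2)[of shell_box f] int by (simp add: set_integrable_def set_lebesgue_integral_def)
  finally show ?thesis unfolding f_eq g_def .
qed

section \<open>Exit radii of a strictly convex family\<close>

lemma has_C2_derivs_on_line:
  assumes f: "has_C2_derivs_on f D1 D2 S" and in_S: "p + s *\<^sub>R v \<in> S"
  shows "((\<lambda>s. f (p + s *\<^sub>R v)) has_real_derivative blinfun_apply (D1 (p + s *\<^sub>R v)) v) (at s)"
    and "((\<lambda>s. blinfun_apply (D1 (p + s *\<^sub>R v)) v) has_real_derivative
      blinfun_apply (blinfun_apply (D2 (p + s *\<^sub>R v)) v) v) (at s)"
proof -
  have line: "((\<lambda>s. p + s *\<^sub>R v) has_derivative (\<lambda>h. h *\<^sub>R v)) (at s)" by (auto intro!: derivative_eq_intros)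
  have 1: "(f has_derivative blinfun_apply (D1 (p + s *\<^sub>R v))) (at (p + s *\<^sub>R v))"
    and 2: "(D1 has_derivative blinfun_apply (D2 (p + s *\<^sub>R v))) (at (p + s *\<^sub>R v))"
    using f in_S by (auto simp: has_C2_derivs_on_def)
  from diff_chain_at[OF line 1]
  show "((\<lambda>s. f (p + s *\<^sub>R v)) has_real_derivative blinfun_apply (D1 (p + s *\<^sub>R v)) v) (at s)"
    by (simp add: o_def has_field_derivative_def blinfun.scaleR_right mult_commute_abs)
  from bounded_linear.has_derivative[OF bounded_linear_apply_blinfun[of v] diff_chain_at[OF line 2]]
  show "((\<lambda>s. blinfun_apply (D1 (p + s *\<^sub>R v)) v) has_real_derivative
      blinfun_apply (blinfun_apply (D2 (p + s *\<^sub>R v)) v) v) (at s)"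
    by (simp add: o_def has_field_derivative_def blinfun.scaleR_right blinfun.scaleR_left mult_commute_abs)
qed

text \<open>The parameter domain is not a separate variable but the projection of \<open>D\<close>,
  so no compatibility condition between the two has to be carried along.\<close>

locale C2_convex_family =
  fixes D W :: "('a::euclidean_space \<times> 'b::euclidean_space) set" and \<rho> \<rho>1 \<rho>2
  assumes open_D: "open D" and convex_D: "convex D"
    and bounded_fibre: "\<And>t. t \<in> fst ` D \<Longrightarrow> bounded (fibre D t)"
    and open_W: "open W" and closure_sub: "closure D \<inter> (fst ` D \<times> UNIV) \<subseteq> W"
    and derivs: "has_C2_derivs_on \<rho> \<rho>1 \<rho>2 W"
    and pos_def: "\<And>p v. p \<in> W \<Longrightarrow> v \<noteq> 0 \<Longrightarrow> 0 < blinfun_apply (blinfun_apply (\<rho>2 p) v) v"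
    and D_eq: "D = {p \<in> W. \<rho> p < 0}"
begin

text \<open>The direction z is not normalised. The supremum is meaningful for (t, x0) in
  \<open>D\<close> and nonzero z: the set then contains 0 and is bounded.\<close>

definition exit :: "'b \<Rightarrow> 'a \<Rightarrow> 'b \<Rightarrow> real" where
  "exit x0 t z = Sup {s. 0 \<le> s \<and> (t, x0 + s *\<^sub>R z) \<in> D}"

lemma bdd_above_ray:
  assumes "(t, x0) \<in> D" "z \<noteq> 0"
  shows "bdd_above {s. 0 \<le> s \<and> (t, x0 + s *\<^sub>R z) \<in> D}"
proof -
  have "t \<in> fst ` D" using assms(1) by force
  then obtain B where B: "\<And>x. x \<in> fibre D t \<Longrightarrow> norm x \<le> B"
    using bounded_fibre bounded_iff by metis
  show ?thesis
  proof (rule bdd_aboveI)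
    fix s assume "s \<in> {s. 0 \<le> s \<and> (t, x0 + s *\<^sub>R z) \<in> D}"
    then have s: "0 \<le> s" "norm (x0 + s *\<^sub>R z) \<le> B" using B by (auto simp: fibre_def)
    have "s * norm z = norm ((x0 + s *\<^sub>R z) - x0)" using s by simp
    also have "\<dots> \<le> B + norm x0" using s(2) norm_triangle_ineq4[of "x0 + s *\<^sub>R z" x0] by simp
    finally show "s \<le> (B + norm x0) / norm z" using assms(2) by (simp add: field_simps)
  qed
qed

lemma ray_shrink:
  assumes "(t, x0) \<in> D" "(t, x0 + s' *\<^sub>R z) \<in> D" "0 \<le> s" "s \<le> s'"
  shows "(t, x0 + s *\<^sub>R z) \<in> D"
proof (cases "s = s'")
  case False
  then have s': "0 < s'" "s / s' \<le> 1" "0 \<le> s / s'" using assms(3,4) by auto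
  have "(1 - s/s') *\<^sub>R (t, x0) + (s/s') *\<^sub>R (t, x0 + s' *\<^sub>R z) \<in> D"
    using convex_D assms(1,2) s' by (intro convexD) auto
  moreover have "(1 - s/s') *\<^sub>R (t, x0) + (s/s') *\<^sub>R (t, x0 + s' *\<^sub>R z) = (t, x0 + s *\<^sub>R z)"
    using s' by (simp add: algebra_simps)
  ultimately show ?thesis by simp
qed (use assms in simp)

text \<open>Convexity makes the admissible parameters an interval starting at 0, and openness of
  \<open>D\<close> keeps the supremum from being attained.\<close>

lemma less_exit_iff:
  assumes D: "(t, x0) \<in> D" and z: "z \<noteq> 0" and s: "0 \<le> s"
  shows "s < exit x0 t z \<longleftrightarrow> (t, x0 + s *\<^sub>R z) \<in> D"
proof
  assume "s < exit x0 t z"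
  moreover have "0 \<in> {s. 0 \<le> s \<and> (t, x0 + s *\<^sub>R z) \<in> D}" using D by simp
  ultimately obtain s' where "s < s'" "(t, x0 + s' *\<^sub>R z) \<in> D"
    unfolding exit_def using less_cSup_iff[OF _ bdd_above_ray[OF D z]] by blast
  then show "(t, x0 + s *\<^sub>R z) \<in> D" using ray_shrink[OF D] s by auto
next
  assume in_D: "(t, x0 + s *\<^sub>R z) \<in> D"
  have "isCont (\<lambda>s. (t, x0 + s *\<^sub>R z)) s" by (intro continuous_intros)
  then have "eventually (\<lambda>s. (t, x0 + s *\<^sub>R z) \<in> D) (at s)"
    using open_D in_D unfolding isCont_def by (rule topological_tendstoD)
  then have "eventually (\<lambda>s. (t, x0 + s *\<^sub>R z) \<in> D) (at_right s)"
    by (rule filter_leD[rotated]) (simp add: at_le)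
  then obtain b where b: "b > s" "\<And>y. s < y \<Longrightarrow> y < b \<Longrightarrow> (t, x0 + y *\<^sub>R z) \<in> D"
    unfolding eventually_at_right_field by auto
  define y where "y = (s + b) / 2"
  have y: "s < y" "y < b" using b(1) by (auto simp: y_def)
  then have "y \<in> {s. 0 \<le> s \<and> (t, x0 + s *\<^sub>R z) \<in> D}" using b s by auto
  then have "y \<le> exit x0 t z" unfolding exit_def by (rule cSup_upper[OF _ bdd_above_ray[OF D z]])
  then show "s < exit x0 t z" using y by simp
qed

lemma exit_pos: "(t, x0) \<in> D \<Longrightarrow> z \<noteq> 0 \<Longrightarrow> 0 < exit x0 t z"
  using less_exit_iff[of t x0 z 0] by simp

text \<open>The endpoint s = \<open>exit x0 t z\<close> lies outside \<open>D\<close>; membership in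
  the closure is what places it in the neighbourhoods on which \<rho> and \<phi> are
  regular.\<close>

lemma exit_closure:
  assumes D: "(t, x0) \<in> D" and z: "z \<noteq> 0" and s: "0 \<le> s" "s \<le> exit x0 t z"
  shows "(t, x0 + s *\<^sub>R z) \<in> closure D"
proof -
  have pos: "0 < exit x0 t z" by (rule exit_pos[OF D z])
  have "(\<lambda>s. (t, x0 + s *\<^sub>R z)) ` closure {0..<exit x0 t z} \<subseteq> closure D"
  proof (rule image_closure_subset)
    show "(\<lambda>s. (t, x0 + s *\<^sub>R z)) ` {0..<exit x0 t z} \<subseteq> closure D"
      using less_exit_iff[OF D z] by (auto intro!: subsetD[OF closure_subset[of D]])
  qed (auto intro!: continuous_intros)
  then show ?thesis using pos s by (auto simp: image_subset_iff)
qed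

lemma exit_W:
  assumes "(t, x0) \<in> D" "z \<noteq> 0" "0 \<le> s" "s \<le> exit x0 t z"
  shows "(t, x0 + s *\<^sub>R z) \<in> W"
  using exit_closure[OF assms] closure_sub assms(1) by force

lemma rho_has_derivative: "p \<in> W \<Longrightarrow> (\<rho> has_derivative blinfun_apply (\<rho>1 p)) (at p)"
  using derivs by (auto simp: has_C2_derivs_on_def)

lemma rho_continuous: "continuous_on W \<rho>"
  by (meson continuous_at_imp_continuous_on has_derivative_continuous rho_has_derivative)

lemmas rho_line_derivative = has_C2_derivs_on_line[OF derivs]

text \<open>The limit from inside gives at most 0; the exit point lies in \<open>W\<close> but not
  in \<open>D\<close>, which gives at least 0.\<close>

lemma rho_exit:
  assumes D: "(t, x0) \<in> D" and z: "z \<noteq> 0"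
  shows "\<rho> (t, x0 + exit x0 t z *\<^sub>R z) = 0"
proof (rule antisym)
  note pos = exit_pos[OF D z]
  have "(\<lambda>s. \<rho> (t, x0 + s *\<^sub>R z)) ` closure {0..<exit x0 t z} \<subseteq> {..0}"
  proof (rule image_closure_subset)
    show "continuous_on (closure {0..<exit x0 t z}) (\<lambda>s. \<rho> (t, x0 + s *\<^sub>R z))"
      using pos exit_W[OF D z]
      by (intro continuous_on_compose2[OF rho_continuous] continuous_intros) auto
    show "(\<lambda>s. \<rho> (t, x0 + s *\<^sub>R z)) ` {0..<exit x0 t z} \<subseteq> {..0}"
      using less_exit_iff[OF D z] D_eq by (auto simp: less_imp_le)
  qed auto
  then show "\<rho> (t, x0 + exit x0 t z *\<^sub>R z) \<le> 0" using pos by (auto simp: image_subset_iff)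
  have "(t, x0 + exit x0 t z *\<^sub>R z) \<notin> D" using less_exit_iff[OF D z, of "exit x0 t z"] pos by simp
  then show "0 \<le> \<rho> (t, x0 + exit x0 t z *\<^sub>R z)"
    using exit_W[OF D z, of "exit x0 t z"] pos D_eq by auto
qed

text \<open>\<rho> is negative at the centre and 0 at the exit, so its slope is positive somewhere
  before the exit; the positive Hessian makes the slope increase along the ray.\<close>

lemma rho1_exit_pos:
  assumes D: "(t, x0) \<in> D" and z: "z \<noteq> 0"
  shows "0 < blinfun_apply (\<rho>1 (t, x0 + exit x0 t z *\<^sub>R z)) (0, z)"
proof -
  define r where "r = exit x0 t z"
  have r: "0 < r" unfolding r_def by (rule exit_pos[OF D z])
  have eq: "(t, x0) + s *\<^sub>R (0, z) = (t, x0 + s *\<^sub>R z)" for s by simp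
  have W: "(t, x0) + s *\<^sub>R (0, z) \<in> W" if "0 \<le> s" "s \<le> r" for s
    using exit_W[OF D z] that by (simp add: r_def)
  have d1: "((\<lambda>s. \<rho> (t, x0 + s *\<^sub>R z)) has_real_derivative blinfun_apply (\<rho>1 (t, x0 + s *\<^sub>R z)) (0, z)) (at s)"
    if "0 \<le> s" "s \<le> r" for s
    using rho_line_derivative(1)[OF W[OF that]] by (simp only: eq)
  have d2: "((\<lambda>s. blinfun_apply (\<rho>1 (t, x0 + s *\<^sub>R z)) (0, z)) has_real_derivative
      blinfun_apply (blinfun_apply (\<rho>2 (t, x0 + s *\<^sub>R z)) (0, z)) (0, z)) (at s)" if "0 \<le> s" "s \<le> r" for s
    using rho_line_derivative(2)[OF W[OF that]] by (simp only: eq)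
  obtain \<xi> where \<xi>: "0 < \<xi>" "\<xi> < r"
    "\<rho> (t, x0 + r *\<^sub>R z) - \<rho> (t, x0 + 0 *\<^sub>R z) = (r - 0) * blinfun_apply (\<rho>1 (t, x0 + \<xi> *\<^sub>R z)) (0, z)"
    using MVT2[OF r d1] by auto
  moreover have "\<rho> (t, x0) < 0" using D D_eq by auto
  ultimately have "0 < r * blinfun_apply (\<rho>1 (t, x0 + \<xi> *\<^sub>R z)) (0, z)"
    using rho_exit[OF D z] by (simp add: r_def)
  then have 1: "0 < blinfun_apply (\<rho>1 (t, x0 + \<xi> *\<^sub>R z)) (0, z)"
    using r by (rule zero_less_mult_pos)
  obtain \<eta> where \<eta>: "\<xi> < \<eta>" "\<eta> < r"
    "blinfun_apply (\<rho>1 (t, x0 + r *\<^sub>R z)) (0, z) - blinfun_apply (\<rho>1 (t, x0 + \<xi> *\<^sub>R z)) (0, z)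
     = (r - \<xi>) * blinfun_apply (blinfun_apply (\<rho>2 (t, x0 + \<eta> *\<^sub>R z)) (0, z)) (0, z)"
    using MVT2[OF \<xi>(2) d2] \<xi>(1) by auto
  have "0 < blinfun_apply (blinfun_apply (\<rho>2 (t, x0 + \<eta> *\<^sub>R z)) (0, z)) (0, z)"
    using pos_def[of "(t, x0 + \<eta> *\<^sub>R z)" "(0, z)"] W[of \<eta>] \<eta> \<xi> z by (simp add: zero_prod_def)
  then have "0 < (r - \<xi>) * blinfun_apply (blinfun_apply (\<rho>2 (t, x0 + \<eta> *\<^sub>R z)) (0, z)) (0, z)"
    using \<xi>(2) by simp
  then show ?thesis using \<eta>(3) 1 by (simp add: r_def)
qed

definition rays :: "'b \<Rightarrow> ('a \<times> 'b) set" where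
  "rays x0 = {(t, z). (t, x0) \<in> D \<and> z \<noteq> 0}"

lemma open_rays: "open (rays x0)"
proof -
  have "open ((\<lambda>p. (fst p, x0)) -` D \<inter> snd -` (- {0 :: 'b}))"
    by (intro open_Int open_vimage open_D) (auto intro!: continuous_intros)
  moreover have "(\<lambda>p. (fst p, x0)) -` D \<inter> snd -` (- {0 :: 'b}) = rays x0" by (auto simp: rays_def)
  ultimately show ?thesis by simp
qed

text \<open>Lower semicontinuity follows from openness of \<open>D\<close>. For upper
  semicontinuity, a point strictly beyond the exit is outside the closure of \<open>D\<close>:
  otherwise the exit point would lie inside a segment from a point of the open convex set
  \<open>D\<close> to a point of its closure, hence in \<open>D\<close>.\<close>

lemma continuous_on_exit: "continuous_on (rays x0) (\<lambda>p. exit x0 (fst p) (snd p))"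
proof (intro continuous_at_imp_continuous_on ballI)
  fix p assume p: "p \<in> rays x0"
  obtain t z where tz: "p = (t, z)" by (cases p)
  have D: "(t, x0) \<in> D" and z: "z \<noteq> 0" using p tz by (auto simp: rays_def)
  have near: "eventually (\<lambda>q. q \<in> rays x0) (at p)"
    using open_rays p by (rule eventually_at_in_open')
  have lim: "((\<lambda>q. (fst q, x0 + a *\<^sub>R snd q)) \<longlongrightarrow> (t, x0 + a *\<^sub>R z)) (at p)" for a
    unfolding tz by (auto intro!: tendsto_eq_intros)
  have "((\<lambda>q. exit x0 (fst q) (snd q)) \<longlongrightarrow> exit x0 t z) (at p)"
  proof (rule order_tendstoI)
    fix a assume a: "a < exit x0 t z"
    \<comment> \<open>\<open>less_exit_iff\<close> speaks of nonnegative parameters only.\<close>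
    define b where "b = max a 0"
    have b: "0 \<le> b" "a \<le> b" "b < exit x0 t z" using a exit_pos[OF D z] by (auto simp: b_def)
    then have "(t, x0 + b *\<^sub>R z) \<in> D" using less_exit_iff[OF D z] by auto
    from topological_tendstoD[OF lim open_D this] near
    show "eventually (\<lambda>q. a < exit x0 (fst q) (snd q)) (at p)"
    proof eventually_elim
      case (elim q)
      then have "b < exit x0 (fst q) (snd q)" using less_exit_iff[of "fst q" x0 "snd q" b] b by (auto simp: rays_def)
      then show ?case using b by simp
    qed
  next
    fix a assume a: "exit x0 t z < a"
    define b where "b = (exit x0 t z + a) / 2"
    have b: "exit x0 t z < b" "b < a" "0 < b" using a exit_pos[OF D z] by (auto simp: b_def)
    have "(t, x0 + b *\<^sub>R z) \<in> - closure D"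
    proof
      assume cl: "(t, x0 + b *\<^sub>R z) \<in> closure D"
      have "open_segment (t, x0) (t, x0 + b *\<^sub>R z) \<subseteq> interior D"
        using convex_D _ cl by (rule in_interior_closure_convex_segment) (use D open_D in \<open>simp add: interior_open\<close>)
      moreover have "(t, x0 + exit x0 t z *\<^sub>R z) \<in> open_segment (t, x0) (t, x0 + b *\<^sub>R z)"
        unfolding in_segment
      proof (intro conjI exI[of _ "exit x0 t z / b"])
        show "(t, x0 + exit x0 t z *\<^sub>R z) = (1 - exit x0 t z / b) *\<^sub>R (t, x0) + (exit x0 t z / b) *\<^sub>R (t, x0 + b *\<^sub>R z)"
          using b by (simp add: algebra_simps)
      qed (use b z exit_pos[OF D z] in auto)
      ultimately have "(t, x0 + exit x0 t z *\<^sub>R z) \<in> D" using interior_subset by blast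
      then show False using less_exit_iff[OF D z, of "exit x0 t z"] exit_pos[OF D z] by simp
    qed
    moreover have "open (- closure D)" by (rule open_Compl) simp
    ultimately have "eventually (\<lambda>q. (fst q, x0 + b *\<^sub>R snd q) \<in> - closure D) (at p)"
      using topological_tendstoD[OF lim] by blast
    with near show "eventually (\<lambda>q. exit x0 (fst q) (snd q) < a) (at p)"
    proof eventually_elim
      case (elim q)
      then have "(fst q, x0 + b *\<^sub>R snd q) \<notin> D" using closure_subset by blast
      then have "\<not> b < exit x0 (fst q) (snd q)"
        using less_exit_iff[of "fst q" x0 "snd q" b] b elim by (auto simp: rays_def)
      then show ?case using b by simp
    qed
  qed
  then show "isCont (\<lambda>p. exit x0 (fst p) (snd p)) p" unfolding isCont_def tz by simp
qed

text \<open>The implicit equation is \<rho>(t, x0 + s z) = 0 in the unknown s; its derivative in s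
  is the slope of \<rho> along the ray, positive at the exit by
  \<open>rho1_exit_pos\<close>.\<close>

lemma C2_differentiable_exit: "C2_differentiable (rays x0) (\<lambda>p. exit x0 (fst p) (snd p))"
proof -
  define \<gamma> where "\<gamma> q = (fst (fst q), x0 + snd q *\<^sub>R snd (fst q))" for q :: "('a \<times> 'b) \<times> real"
  have C2\<gamma>: "C2_differentiable S \<gamma>" for S
    unfolding \<gamma>_def
    by (intro C2_differentiable_Pair C2_differentiable_add C2_differentiable_scaleR C2_differentiable_const
        C2_differentiable_bounded_linear bounded_linear_compose[OF bounded_linear_fst]
        bounded_linear_compose[OF bounded_linear_snd] bounded_linear_fst bounded_linear_snd)
  have open_pre: "open (\<gamma> -` W)"
    by (intro open_vimage open_W) (auto simp: \<gamma>_def intro!: continuous_intros)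
  have \<gamma>': "(\<gamma> has_derivative (\<lambda>h. (fst (fst h), snd q *\<^sub>R snd (fst h) + snd h *\<^sub>R snd (fst q)))) (at q)" for q
    unfolding \<gamma>_def by (auto intro!: derivative_eq_intros)
  define e where "e p = (p, exit x0 (fst p) (snd p))" for p
  have \<gamma>e: "\<gamma> (e p) = (fst p, x0 + exit x0 (fst p) (snd p) *\<^sub>R snd p)" for p by (simp add: \<gamma>_def e_def)
  have W: "\<gamma> (e p) \<in> W" if "p \<in> rays x0" for p
    unfolding \<gamma>e using that exit_pos[of "fst p" x0 "snd p"] by (intro exit_W) (auto simp: rays_def)
  show ?thesis
  proof (rule C2_differentiable_implicit_real[where P = "\<lambda>q. \<rho> (\<gamma> q)" and O' = "\<gamma> -` W"
        and P' = "\<lambda>p h. blinfun_apply (\<rho>1 (\<gamma> (e p))) (fst (fst h), snd (e p) *\<^sub>R snd (fst h) + snd h *\<^sub>R snd (fst (e p)))"])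
    show "C2_differentiable (\<gamma> -` W) (\<lambda>q. \<rho> (\<gamma> q))"
      using C2\<gamma> has_C2_derivs_on_imp_C2_differentiable[OF derivs] _ open_pre
      by (rule C2_differentiable_compose) auto
    fix p assume p: "p \<in> rays x0"
    show "(p, exit x0 (fst p) (snd p)) \<in> \<gamma> -` W" using W[OF p] by (simp add: e_def)
    show "\<rho> (\<gamma> (p, exit x0 (fst p) (snd p))) = 0"
      using rho_exit[of "fst p" x0 "snd p"] p by (auto simp: \<gamma>_def rays_def)
    show "((\<lambda>q. \<rho> (\<gamma> q)) has_derivative (\<lambda>h. blinfun_apply (\<rho>1 (\<gamma> (e p)))
        (fst (fst h), snd (e p) *\<^sub>R snd (fst h) + snd h *\<^sub>R snd (fst (e p))))) (at (p, exit x0 (fst p) (snd p)))"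
      using diff_chain_at[OF \<gamma>'[of "e p"] rho_has_derivative[OF W[OF p]]] by (simp add: o_def e_def)
    show "blinfun_apply (\<rho>1 (\<gamma> (e p))) (fst (fst (0::'a \<times> 'b, 1::real)), snd (e p) *\<^sub>R snd (fst (0::'a \<times> 'b, 1::real)) + snd (0::'a \<times> 'b, 1::real) *\<^sub>R snd (fst (e p))) \<noteq> 0"
      using rho1_exit_pos[of "fst p" x0 "snd p"] p unfolding \<gamma>e by (auto simp: rays_def e_def)
  qed (rule open_rays continuous_on_exit)+
qed

end

section \<open>Regularity of the fibre integrals\<close>

locale C2_weighted_convex_family = C2_convex_family D W \<rho> \<rho>1 \<rho>2
  for D W :: "('a::euclidean_space \<times> 'b::euclidean_space) set" and \<rho> \<rho>1 \<rho>2 +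
  fixes V :: "('a \<times> 'b) set" and \<phi> :: "'a \<times> 'b \<Rightarrow> real"
  assumes open_V: "open V" and closure_sub_V: "closure D \<inter> (fst ` D \<times> UNIV) \<subseteq> V"
    and C2_phi: "C2_differentiable V \<phi>"
begin

text \<open>Taken in \<open>ennreal\<close> over \<open>lborel\<close>, so that it exists before
  integrability is known and fits the Prekopa-Leindler inequality.\<close>

definition fibre_mass :: "'a \<Rightarrow> ennreal" where
  "fibre_mass t = (\<integral>\<^sup>+x. indicator (fibre D t) x * ennreal (exp (- \<phi> (t, x))) \<partial>lborel)"

lemma open_fibre: "open (fibre D t)"
proof -
  have "open ((\<lambda>x. (t, x)) -` D)" by (intro open_vimage open_D continuous_intros)
  then show ?thesis by (simp add: fibre_def vimage_def)
qed

lemma D_sub_V: "D \<subseteq> V"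
  using closure_sub_V closure_subset[of D] by force

lemma phi_continuous: "continuous_on V \<phi>"
  by (rule C1_imp_continuous_on[OF C2_imp_C1[OF C2_phi]])

lemma continuous_on_fibre_phi: "S \<subseteq> fibre V t \<Longrightarrow> continuous_on S (\<lambda>x. \<phi> (t, x))"
  by (intro continuous_on_compose2[OF phi_continuous] continuous_intros) (auto simp: fibre_def)

lemma fibre_density_measurable:
  assumes "open S" "S \<subseteq> fibre V t"
  shows "(\<lambda>x. indicator S x * ennreal (exp (- \<phi> (t, x)))) \<in> borel_measurable borel"
proof -
  have "(\<lambda>x. indicator S x *\<^sub>R exp (- \<phi> (t, x))) \<in> borel_measurable borel"
    using assms by (intro borel_measurable_continuous_on_indicator continuous_intros continuous_on_fibre_phi) auto
  then have "(\<lambda>x. ennreal (indicator S x *\<^sub>R exp (- \<phi> (t, x)))) \<in> borel_measurable borel" by simp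
  moreover have "ennreal (indicator S x *\<^sub>R exp (- \<phi> (t, x))) = indicator S x * ennreal (exp (- \<phi> (t, x)))" for x
    by (auto split: split_indicator)
  ultimately show ?thesis by (simp only:)
qed

lemma fibre_sub_V: "fibre D t \<subseteq> fibre V t"
  using D_sub_V by (auto simp: fibre_def)

lemma fibre_mass_pos:
  assumes "t \<in> fst ` D"
  shows "0 < fibre_mass t"
proof -
  have [measurable]: "(\<lambda>x. indicator (fibre D t) x * ennreal (exp (- \<phi> (t, x)))) \<in> borel_measurable borel"
    by (intro fibre_density_measurable open_fibre fibre_sub_V)
  have "fibre D t \<noteq> {}" using assms by (auto simp: fibre_def)
  have "fibre_mass t \<noteq> 0"
  proof
    assume "fibre_mass t = 0"
    then have "AE x in lborel. indicator (fibre D t) x * ennreal (exp (- \<phi> (t, x))) = 0"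
      unfolding fibre_mass_def by (subst (asm) nn_integral_0_iff_AE) auto
    then have "AE x in lborel. x \<notin> fibre D t" by eventually_elim (auto split: split_indicator_asm)
    then have "fibre D t \<in> null_sets lborel"
      using open_fibre[of t] by (subst (asm) AE_iff_null_sets[symmetric]) auto
    then have "negligible (fibre D t)"
      unfolding negligible_iff_null_sets by (rule null_sets_completionI)
    then show False using open_not_negligible[OF open_fibre \<open>fibre D t \<noteq> {}\<close>] by simp
  qed
  then show ?thesis by (simp add: zero_less_iff_neq_zero)
qed

text \<open>A point \<open>x0\<close> of the fibre over \<open>t0\<close> remains in the fibres over
  a ball around \<open>t0\<close>, so polar coordinates about this one centre describe all of
  them.\<close>

lemma fibre_mass_local:
  assumes "t0 \<in> fst ` D"
  obtains U J where "open U" "t0 \<in> U" "C2_differentiable U J"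
    "\<And>t. t \<in> U \<Longrightarrow> shell_const * fibre_mass t = ennreal (J t)"
proof -
  obtain x0 where x0: "(t0, x0) \<in> D" using assms by auto
  have "open ((\<lambda>t. (t, x0)) -` D)" by (intro open_vimage open_D continuous_intros)
  then obtain r where r: "0 < r" "ball t0 r \<subseteq> (\<lambda>t. (t, x0)) -` D"
    using x0 by (metis open_contains_ball vimageI)
  define U where "U = ball t0 r"
  have UD: "(t, x0) \<in> D" if "t \<in> U" for t using r(2) that by (auto simp: U_def)
  define rd where "rd p = exit x0 (fst p) (fst (snd p))" for p :: "'a \<times> 'b \<times> real"
  define pt where "pt p = (fst p, x0 + snd (snd p) *\<^sub>R rd p *\<^sub>R fst (snd p))" for p :: "'a \<times> 'b \<times> real"
  define H where "H p = rd p ^ DIM('b) * snd (snd p) ^ (DIM('b) - 1) * exp (- \<phi> (pt p))" for p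
  define A where "A = (\<lambda>p::'a \<times> 'b \<times> real. (fst p, fst (snd p))) -` rays x0"
  define G where "G = A \<inter> pt -` V"
  define w where "w q = shell_weight (fst q)" for q :: "'b \<times> real"
  \<comment> \<open>\<open>K\<close> keeps z away from 0, where the exit radius degenerates; outside
    its interior the weight is 0. Points of the box with |z| > 2 stay in \<open>K\<close>: the
    integrand is regular there and the weight 0.\<close>
  define K where "K = {q::'b \<times> real. 1 \<le> norm (fst q)}"
  have open_A: "open A" unfolding A_def by (intro open_vimage open_rays) (auto intro!: continuous_intros)
  have C2_rd: "C2_differentiable A rd"
    unfolding rd_def
  proof (rule C2_differentiable_compose[OF _ C2_differentiable_exit[of x0] _ open_A, where f = "\<lambda>p. (fst p, fst (snd p))", simplified])
    show "C2_differentiable A (\<lambda>p. (fst p, fst (snd p)))"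
      by (intro C2_differentiable_Pair C2_differentiable_bounded_linear bounded_linear_fst
          bounded_linear_compose[OF bounded_linear_fst bounded_linear_snd])
    show "(\<lambda>p. (fst p, fst (snd p))) ` A \<subseteq> rays x0" by (auto simp: A_def)
  qed
  have C2_pt: "C2_differentiable A pt"
    unfolding pt_def
    by (intro C2_differentiable_Pair C2_differentiable_add C2_differentiable_scaleR C2_differentiable_const C2_rd
        C2_differentiable_bounded_linear bounded_linear_fst
        bounded_linear_compose[OF bounded_linear_fst bounded_linear_snd]
        bounded_linear_compose[OF bounded_linear_snd bounded_linear_snd])
  have open_G: "open G" unfolding G_def
    by (rule continuous_open_preimage[OF C1_imp_continuous_on[OF C2_imp_C1[OF C2_pt]] open_A open_V])
  have "C2_differentiable G (\<lambda>p. \<phi> (pt p))"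
    by (rule C2_differentiable_compose[OF C2_differentiable_subset[OF C2_pt] C2_phi _ open_G]) (auto simp: G_def)
  then have "C2_differentiable G (\<lambda>p. (-1) *\<^sub>R \<phi> (pt p))"
    by (intro C2_differentiable_scaleR C2_differentiable_const)
  then have C2_exp: "C2_differentiable G (\<lambda>p. exp ((-1) *\<^sub>R \<phi> (pt p)))"
    by (rule C2_differentiable_compose[OF _ C2_differentiable_exp[of UNIV] _ open_G]) auto
  have "C2_differentiable G (\<lambda>p. rd p ^ DIM('b) *\<^sub>R (snd (snd p) ^ (DIM('b) - 1)))"
    by (intro C2_differentiable_scaleR C2_differentiable_power C2_differentiable_subset[OF C2_rd]
        C2_differentiable_bounded_linear bounded_linear_compose[OF bounded_linear_snd bounded_linear_snd])
       (auto simp: G_def)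
  from C2_differentiable_scaleR[OF this C2_exp]
  have "C2_differentiable G (\<lambda>p. (rd p ^ DIM('b) *\<^sub>R (snd (snd p) ^ (DIM('b) - 1))) *\<^sub>R exp ((-1) *\<^sub>R \<phi> (pt p)))" .
  then have C2_H: "C2_differentiable G H" by (simp add: H_def[abs_def])
  have cont_w: "continuous_on UNIV w" unfolding w_def
    by (intro continuous_on_compose2[OF continuous_shell_weight[of UNIV]] continuous_intros) auto
  have closed_K: "closed K" unfolding K_def by (intro closed_Collect_le continuous_intros)
  have w0: "w q = 0" if "q \<notin> interior K" for q
  proof -
    have "{q::'b \<times> real. 1 < norm (fst q)} \<subseteq> interior K"
      by (rule interior_maximal) (auto simp: K_def intro!: open_Collect_less continuous_intros)
    then have "norm (fst q) \<le> 1" using that by force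
    then show ?thesis by (simp add: w_def shell_weight_eq_0)
  qed
  have sub: "U \<times> (shell_box \<inter> K) \<subseteq> G"
  proof
    fix p assume "p \<in> U \<times> (shell_box \<inter> K)"
    then obtain t z u where p: "p = (t, z, u)" "t \<in> U" "1 \<le> norm z" "0 \<le> u" "u \<le> 1"
      by (cases p) (auto simp: K_def cbox_Pair_iff)
    note D = UD[OF p(2)]
    have z: "z \<noteq> 0" using p(3) by auto
    \<comment> \<open>Scaling by u \<le> 1 keeps the point between the centre and the exit, so a
      neighbourhood of the closure contains it even for u = 1.\<close>
    have "(t, x0 + (u * exit x0 t z) *\<^sub>R z) \<in> closure D"
      using p(4,5) exit_pos[OF D z] by (intro exit_closure[OF D z]) (auto intro: mult_left_le_one_le)
    then have "pt p \<in> V" using closure_sub_V D by (force simp: pt_def rd_def p(1))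
    then show "p \<in> G" using D z by (simp add: G_def A_def rays_def p(1))
  qed
  define J where "J t = integral shell_box (\<lambda>q. w q * H (t, q))" for t
  have C2_J: "C2_differentiable U J" unfolding J_def
    by (rule C2_differentiable_weighted_integral[OF _ _ open_G C2_H cont_w closed_K sub w0]) (auto simp: U_def)
  have mass: "shell_const * fibre_mass t = ennreal (J t)" if t: "t \<in> U" for t
  proof -
    note D = UD[OF t]
    define E where "E = {y. (t, x0 + y) \<in> D}"
    have dens [measurable]: "(\<lambda>x. indicator (fibre D t) x * ennreal (exp (- \<phi> (t, x)))) \<in> borel_measurable borel"
      by (intro fibre_density_measurable open_fibre fibre_sub_V)
    have "(\<lambda>y. indicator (fibre D t) (x0 + y) * ennreal (exp (- \<phi> (t, x0 + y)))) \<in> borel_measurable borel"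
      by (rule measurable_compose[OF _ dens]) measurable
    moreover have E_ind: "indicator (fibre D t) (x0 + y) = (indicator E y :: ennreal)" for y
      by (auto simp: fibre_def E_def split: split_indicator)
    ultimately have meas: "(\<lambda>y. indicator E y * ennreal (exp (- \<phi> (t, x0 + y)))) \<in> borel_measurable borel" by simp
    \<comment> \<open>Translation by \<open>x0\<close> moves the centre of the star-shaped fibre to
      the origin.\<close>
    have "fibre_mass t = (\<integral>\<^sup>+y. indicator E y * ennreal (exp (- \<phi> (t, x0 + y))) \<partial>lborel)"
      unfolding fibre_mass_def
      by (subst lborel_affine[of 1 x0]) (simp_all add: nn_integral_density nn_integral_distr E_ind)
    moreover have eq: "(\<lambda>(z, u). shell_weight z * (exit x0 t z ^ DIM('b) * u ^ (DIM('b) - 1) * exp (- \<phi> (t, x0 + u *\<^sub>R exit x0 t z *\<^sub>R z))))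
      = (\<lambda>q. w q * H (t, q))"
      by (auto simp: w_def H_def rd_def pt_def)
    moreover have "continuous_on shell_box (\<lambda>q. w q * H (t, q))"
    proof -
      have "continuous_on (U \<times> shell_box) (\<lambda>(x, q). w q * H (x, q))"
        by (rule continuous_on_weighted[OF C1_imp_continuous_on[OF C2_imp_C1[OF C2_H]] cont_w closed_K sub w0])
      from continuous_on_compose2[OF this, of shell_box "\<lambda>q. (t, q)"] t show ?thesis
        by (simp add: image_subset_iff continuous_on_Pair)
    qed
    ultimately show ?thesis
      using nn_integral_starlike[of "exit x0 t" E "\<lambda>y. exp (- \<phi> (t, x0 + y))", OF exit_pos[OF D] _ meas]
        less_exit_iff[OF D] unfolding J_def eq by (simp add: E_def less_imp_le)
  qed
  show ?thesis
    by (rule that[of U J]) (use r C2_J mass in \<open>auto simp: U_def\<close>)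
qed

text \<open>\<open>J\<close> is real-valued and \<open>shell_const\<close> positive, so the shell
  formula already contains finiteness.\<close>

lemma fibre_mass_finite:
  assumes "t \<in> fst ` D"
  shows "fibre_mass t < \<infinity>"
proof -
  obtain U J where "t \<in> U" "\<And>t. t \<in> U \<Longrightarrow> shell_const * fibre_mass t = ennreal (J t)"
    using fibre_mass_local[OF assms] by metis
  then have "shell_const * fibre_mass t < \<infinity>" by simp
  then show ?thesis using shell_const_pos_finite by (auto simp: ennreal_mult_less_top)
qed

lemma C2_differentiable_fibre_mass: "C2_differentiable (fst ` D) (\<lambda>t. enn2real (fibre_mass t))"
proof (rule C2_differentiable_local)
  fix t0 assume "t0 \<in> fst ` D"
  then obtain U J where U: "open U" "t0 \<in> U" "C2_differentiable U J"
    "\<And>t. t \<in> U \<Longrightarrow> shell_const * fibre_mass t = ennreal (J t)"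
    using fibre_mass_local by metis
  define c where "c = enn2real shell_const"
  have c: "0 < c" "shell_const = ennreal c"
    using shell_const_pos_finite by (auto simp: c_def enn2real_positive_iff)
  define U' where "U' = U \<inter> fst ` D"
  have U': "open U'" "t0 \<in> U'" using U \<open>t0 \<in> fst ` D\<close> open_D by (auto simp: U'_def open_image_fst)
  have "J t *\<^sub>R inverse c = enn2real (fibre_mass t)" if t: "t \<in> U'" for t
  proof -
    have tD: "t \<in> fst ` D" using t by (simp add: U'_def)
    obtain i where i: "fibre_mass t = ennreal i" "0 < i"
      using fibre_mass_pos[OF tD] fibre_mass_finite[OF tD] by (cases "fibre_mass t") auto
    \<comment> \<open>\<open>ennreal\<close> sends negative numbers to 0, so positivity of the
      product of c and i is what identifies \<open>J t\<close> with it.\<close>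
    have "ennreal (c * i) = ennreal (J t)" using U(4)[of t] t c i by (simp add: U'_def ennreal_mult)
    moreover have "0 < c * i" using c i by simp
    ultimately have "J t = c * i" by (metis ennreal_inj ennreal_neg less_eq_real_def linorder_le_cases ennreal_eq_0_iff not_less)
    then show ?thesis using i c by simp
  qed
  note eq = this
  have "C2_differentiable U' (\<lambda>t. J t *\<^sub>R inverse c)"
    by (intro C2_differentiable_scaleR C2_differentiable_const C2_differentiable_subset[OF U(3)]) (auto simp: U'_def)
  then have "C2_differentiable U' (\<lambda>t. enn2real (fibre_mass t))"
    by (rule C2_differentiable_cong[OF _ U'(1) eq])
  then show "\<exists>T. open T \<and> t0 \<in> T \<and> C2_differentiable T (\<lambda>t. enn2real (fibre_mass t))"
    using U' by blast
qed

end

section \<open>Strict midpoint convexity\<close>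

text \<open>Subtracting c s^2 / 2 leaves a convex function of s on [0, 1]; at s = 1/2 the subtracted
  term lies c/8 below its chord.\<close>

lemma has_C2_derivs_on_midpoint:
  assumes f: "has_C2_derivs_on f D1 D2 S" and seg: "\<And>s. 0 \<le> s \<Longrightarrow> s \<le> 1 \<Longrightarrow> p + s *\<^sub>R v \<in> S"
    and ge: "\<And>s. 0 \<le> s \<Longrightarrow> s \<le> 1 \<Longrightarrow> c \<le> blinfun_apply (blinfun_apply (D2 (p + s *\<^sub>R v)) v) v"
  shows "f (p + (1/2) *\<^sub>R v) \<le> (f p + f (p + v)) / 2 - c / 8"
proof -
  define k where "k s = f (p + s *\<^sub>R v) - c / 2 * s\<^sup>2" for s
  have "convex_on {0..1} k"
  proof (rule f''_ge0_imp_convex)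
    fix s :: real assume s: "s \<in> {0..1}"
    show "(k has_real_derivative blinfun_apply (D1 (p + s *\<^sub>R v)) v - c * s) (at s)"
      unfolding k_def using s by (auto intro!: derivative_eq_intros has_C2_derivs_on_line(1)[OF f] seg)
    show "((\<lambda>s. blinfun_apply (D1 (p + s *\<^sub>R v)) v - c * s) has_real_derivative
        blinfun_apply (blinfun_apply (D2 (p + s *\<^sub>R v)) v) v - c) (at s)"
      using s by (auto intro!: derivative_eq_intros has_C2_derivs_on_line(2)[OF f] seg)
    show "0 \<le> blinfun_apply (blinfun_apply (D2 (p + s *\<^sub>R v)) v) v - c" using ge[of s] s by simp
  qed simp
  then have "k ((1 - 1/2) *\<^sub>R 0 + (1/2) *\<^sub>R 1) \<le> (1 - 1/2) * k 0 + (1/2) * k 1"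
    by (intro convex_onD) auto
  then show ?thesis by (simp add: k_def field_simps power2_eq_square)
qed

text \<open>Otherwise, by continuity, the second derivative along v stays below C/2 near t, which
  bounds the second differences by (C/2) h^2 for small h.\<close>

lemma has_C2_derivs_on_second_difference:
  assumes f: "has_C2_derivs_on f D1 D2 S" and S: "open S" "t \<in> S" and C: "0 < C" "0 < \<delta>"
    and ge: "\<And>h. 0 < h \<Longrightarrow> h < \<delta> \<Longrightarrow> C * h\<^sup>2 \<le> f (t + h *\<^sub>R v) + f (t - h *\<^sub>R v) - 2 * f t"
  shows "0 < blinfun_apply (blinfun_apply (D2 t) v) v"
proof (rule ccontr)
  assume neg: "\<not> ?thesis"
  have cont: "continuous_on S (\<lambda>x. blinfun_apply (blinfun_apply (D2 x) v) v)"
    using f by (auto simp: has_C2_derivs_on_def intro!: continuous_intros)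
  have "isCont (\<lambda>s. t + s *\<^sub>R v) 0" by (intro continuous_intros)
  then have lim: "((\<lambda>s. t + s *\<^sub>R v) \<longlongrightarrow> t) (nhds 0)" using tendsto_at_iff_tendsto_nhds[of "\<lambda>s. t + s *\<^sub>R v" 0] by (simp add: isCont_def)
  have "isCont (\<lambda>x. blinfun_apply (blinfun_apply (D2 x) v) v) t"
    using cont S by (simp add: continuous_on_eq_continuous_at)
  then have "((\<lambda>s. blinfun_apply (blinfun_apply (D2 (t + s *\<^sub>R v)) v) v) \<longlongrightarrow> blinfun_apply (blinfun_apply (D2 t) v) v) (nhds 0)"
    using lim by (rule isCont_tendsto_compose)
  moreover have "blinfun_apply (blinfun_apply (D2 t) v) v < C / 2" using neg C by simp
  ultimately have "eventually (\<lambda>s. blinfun_apply (blinfun_apply (D2 (t + s *\<^sub>R v)) v) v < C / 2) (nhds 0)"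
    by (rule order_tendstoD)
  moreover have "eventually (\<lambda>s. t + s *\<^sub>R v \<in> S) (nhds 0)"
    using lim S by (rule topological_tendstoD)
  ultimately have "eventually (\<lambda>s. t + s *\<^sub>R v \<in> S \<and> blinfun_apply (blinfun_apply (D2 (t + s *\<^sub>R v)) v) v < C / 2) (nhds 0)"
    by eventually_elim simp
  then obtain d where d: "0 < d" "\<And>s. \<bar>s\<bar> < d \<Longrightarrow> t + s *\<^sub>R v \<in> S \<and> blinfun_apply (blinfun_apply (D2 (t + s *\<^sub>R v)) v) v < C / 2"
    unfolding eventually_nhds_metric by (auto simp: dist_real_def)
  define h where "h = min d \<delta> / 2"
  have h: "0 < h" "h < d" "h < \<delta>" using d(1) C by (auto simp: h_def)
  define k where "k s = C / 4 * s\<^sup>2 - f (t + s *\<^sub>R v)" for s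
  have "convex_on {-h..h} k"
  proof (rule f''_ge0_imp_convex)
    fix s assume "s \<in> {-h..h}"
    then have s: "t + s *\<^sub>R v \<in> S" "blinfun_apply (blinfun_apply (D2 (t + s *\<^sub>R v)) v) v < C / 2"
      using d(2)[of s] h by auto
    show "(k has_real_derivative C / 2 * s - blinfun_apply (D1 (t + s *\<^sub>R v)) v) (at s)"
      unfolding k_def using s by (auto intro!: derivative_eq_intros has_C2_derivs_on_line(1)[OF f])
    show "((\<lambda>s. C / 2 * s - blinfun_apply (D1 (t + s *\<^sub>R v)) v) has_real_derivative
        C / 2 - blinfun_apply (blinfun_apply (D2 (t + s *\<^sub>R v)) v) v) (at s)"
      using s by (auto intro!: derivative_eq_intros has_C2_derivs_on_line(2)[OF f])
    show "0 \<le> C / 2 - blinfun_apply (blinfun_apply (D2 (t + s *\<^sub>R v)) v) v" using s by simp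
  qed simp
  then have "k ((1 - 1/2) *\<^sub>R (-h) + (1/2) *\<^sub>R h) \<le> (1 - 1/2) * k (-h) + (1/2) * k h"
    using h by (intro convex_onD) auto
  then have "f (t + h *\<^sub>R v) + f (t - h *\<^sub>R v) - 2 * f t \<le> C / 2 * h\<^sup>2"
    by (simp add: k_def field_simps)
  moreover have "C * h\<^sup>2 \<le> f (t + h *\<^sub>R v) + f (t - h *\<^sub>R v) - 2 * f t" using ge h by simp
  moreover have "0 < C * h\<^sup>2" using C h by simp
  ultimately show False by linarith
qed

context C2_weighted_convex_family
begin

section \<open>Bounds for \<rho> that are uniform near a fixed parameter\<close>

text \<open>Boundedness of single fibres becomes uniform because the exit radius is continuous on
  the compact product of a ball and the unit sphere. The radius is then halved, so that points of
  the closure over the small ball are limits of points of \<open>D\<close> over the large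
  one.\<close>

lemma compact_local_closure:
  assumes "t0 \<in> fst ` D"
  obtains r where "0 < r" "cball t0 r \<subseteq> fst ` D" "compact (closure D \<inter> cball t0 r \<times> UNIV)"
proof -
  obtain x0 where x0: "(t0, x0) \<in> D" using assms by auto
  have "open ((\<lambda>t. (t, x0)) -` D)" by (intro open_vimage open_D continuous_intros)
  then obtain r where r: "0 < r" "cball t0 r \<subseteq> (\<lambda>t. (t, x0)) -` D"
    using x0 by (metis open_contains_cball vimageI)
  have D: "(t, x0) \<in> D" if "t \<in> cball t0 r" for t using r(2) that by auto
  have "compact ((\<lambda>p. exit x0 (fst p) (snd p)) ` (cball t0 r \<times> sphere (0::'b) 1))"
    using D by (intro compact_continuous_image continuous_on_subset[OF continuous_on_exit[of x0]] compact_Times)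
      (auto simp: rays_def)
  then obtain B where "\<forall>y\<in>(\<lambda>p. exit x0 (fst p) (snd p)) ` (cball t0 r \<times> sphere (0::'b) 1). norm y \<le> B"
    unfolding compact_eq_bounded_closed bounded_iff by blast
  then have B: "\<bar>exit x0 (fst p) (snd p)\<bar> \<le> B" if "p \<in> cball t0 r \<times> sphere (0::'b) 1" for p
    using that unfolding real_norm_def by blast
  \<comment> \<open>A basis vector serves as a point of the unit sphere.\<close>
  have "0 \<le> B" using B[of "(t0, SOME b. b \<in> Basis)"] r(1) by (force simp: some_in_eq norm_Basis)
  have bd: "D \<inter> cball t0 r \<times> UNIV \<subseteq> cball t0 r \<times> cball x0 B"
  proof
    fix p assume p: "p \<in> D \<inter> cball t0 r \<times> UNIV"
    obtain t x where tx: "p = (t, x)" by (cases p)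
    have t: "t \<in> cball t0 r" using p tx by auto
    have "norm (x - x0) \<le> B"
    proof (cases "x = x0")
      case False
      define z where "z = (1 / norm (x - x0)) *\<^sub>R (x - x0)"
      have z: "norm z = 1" "z \<noteq> 0" "x0 + norm (x - x0) *\<^sub>R z = x" using False by (auto simp: z_def)
      have "norm (x - x0) < exit x0 t z"
        using less_exit_iff[OF D[OF t] z(2), of "norm (x - x0)"] z(3) p tx by simp
      also have "\<dots> \<le> B" using B[of "(t, z)"] t z by auto
      finally show ?thesis by simp
    qed (use \<open>0 \<le> B\<close> in simp)
    then show "p \<in> cball t0 r \<times> cball x0 B" using t tx by (auto simp: dist_norm norm_minus_commute)
  qed
  define r' where "r' = r / 2"
  have r': "0 < r'" "r' < r" using r(1) by (auto simp: r'_def)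
  have "closure D \<inter> cball t0 r' \<times> UNIV \<subseteq> closure (D \<inter> cball t0 r \<times> UNIV)"
  proof -
    have "closure D \<inter> cball t0 r' \<times> UNIV \<subseteq> (ball t0 r \<times> UNIV) \<inter> closure D" using r' by auto
    also have "\<dots> \<subseteq> closure ((ball t0 r \<times> UNIV) \<inter> D)"
      by (rule open_Int_closure_subset) (simp add: open_Times)
    also have "\<dots> \<subseteq> closure (D \<inter> cball t0 r \<times> UNIV)" by (rule closure_mono) auto
    finally show ?thesis .
  qed
  moreover have "bounded (closure (D \<inter> cball t0 r \<times> UNIV))"
    by (rule bounded_closure[OF bounded_subset[OF bounded_Times bd]]) auto
  ultimately have "bounded (closure D \<inter> cball t0 r' \<times> UNIV)" by (rule bounded_subset[rotated])
  moreover have "closed (closure D \<inter> cball t0 r' \<times> UNIV)" by (intro closed_Int closed_Times) auto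
  ultimately have "compact (closure D \<inter> cball t0 r' \<times> UNIV)" by (simp add: compact_eq_bounded_closed)
  moreover have "cball t0 r' \<subseteq> fst ` D"
  proof
    fix t assume "t \<in> cball t0 r'"
    then have "(t, x0) \<in> D" using r' by (intro D) auto
    then show "t \<in> fst ` D" by force
  qed
  ultimately show ?thesis using that r' by blast
qed

text \<open>The least value of the Hessian form on \<open>K\<close> times the unit sphere is
  positive, and homogeneity extends the bound to all v; the factor 1/8 comes from
  \<open>has_C2_derivs_on_midpoint\<close>.\<close>

lemma rho_midpoint_gap:
  assumes K: "compact K" "K \<subseteq> W"
  obtains c where "0 < c" "\<And>p q. closed_segment p q \<subseteq> K \<Longrightarrow>
    \<rho> ((1/2) *\<^sub>R (p + q)) \<le> (\<rho> p + \<rho> q) / 2 - c * (norm (q - p))\<^sup>2"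
proof (cases "K = {}")
  case False
  let ?H = "\<lambda>x. blinfun_apply (blinfun_apply (\<rho>2 (fst x)) (snd x)) (snd x)"
  have "continuous_on W \<rho>2" using derivs by (simp add: has_C2_derivs_on_def)
  then have "continuous_on (K \<times> sphere 0 1) ?H"
    using K(2) by (intro continuous_intros continuous_on_compose2[where g = \<rho>2 and f = fst]) auto
  moreover have "compact (K \<times> sphere (0::'a \<times> 'b) 1)" using K by (intro compact_Times) auto
  moreover have "K \<times> sphere (0::'a \<times> 'b) 1 \<noteq> {}"
    using False by (auto simp: sphere_eq_empty)
  ultimately obtain m where m: "m \<in> K \<times> sphere 0 1" "\<And>x. x \<in> K \<times> sphere 0 1 \<Longrightarrow> ?H m \<le> ?H x"
    using continuous_attains_inf[of "K \<times> sphere 0 1" ?H] by blast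
  define l where "l = ?H m"
  have "0 < l" unfolding l_def using m(1) K(2) by (intro pos_def) auto
  have l: "l * (norm v)\<^sup>2 \<le> blinfun_apply (blinfun_apply (\<rho>2 p) v) v" if "p \<in> K" for p v
  proof (cases "v = 0")
    case False
    define w where "w = (1 / norm v) *\<^sub>R v"
    have w: "norm w = 1" "v = norm v *\<^sub>R w" using False by (auto simp: w_def)
    have "l \<le> blinfun_apply (blinfun_apply (\<rho>2 p) w) w" using m(2)[of "(p, w)"] that w by (simp add: l_def)
    then have "l * (norm v)\<^sup>2 \<le> blinfun_apply (blinfun_apply (\<rho>2 p) w) w * (norm v)\<^sup>2" by (rule mult_right_mono) simp
    also have "\<dots> = blinfun_apply (blinfun_apply (\<rho>2 p) (norm v *\<^sub>R w)) (norm v *\<^sub>R w)"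
      by (simp add: blinfun.scaleR_right blinfun.scaleR_left power2_eq_square)
    finally show ?thesis using w(2) by simp
  qed simp
  show ?thesis
  proof (rule that[of "l / 8"])
    fix p q assume seg: "closed_segment p q \<subseteq> K"
    have in_seg: "p + s *\<^sub>R (q - p) \<in> K" if "0 \<le> s" "s \<le> 1" for s
    proof -
      have "p + s *\<^sub>R (q - p) = (1 - s) *\<^sub>R p + s *\<^sub>R q" by (simp add: algebra_simps)
      then have "p + s *\<^sub>R (q - p) \<in> closed_segment p q" using that by (auto simp: in_segment)
      then show ?thesis using seg by auto
    qed
    have "\<rho> (p + (1/2) *\<^sub>R (q - p)) \<le> (\<rho> p + \<rho> (p + (q - p))) / 2 - l * (norm (q - p))\<^sup>2 / 8"
      using in_seg K(2) l by (intro has_C2_derivs_on_midpoint[OF derivs]) blast+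
    moreover have "p + (1/2) *\<^sub>R (q - p) = (1/2) *\<^sub>R (p + q)"
      by (simp add: algebra_simps flip: scaleR_add_left)
    ultimately show "\<rho> ((1/2) *\<^sub>R (p + q)) \<le> (\<rho> p + \<rho> q) / 2 - l / 8 * (norm (q - p))\<^sup>2" by simp
  qed (use \<open>0 < l\<close> in simp)
qed (use that[of 1] in auto)

lemma compact_fibre_closure:
  assumes "t \<in> fst ` D"
  shows "compact (closure D \<inter> {t} \<times> UNIV)"
proof -
  obtain r where r: "0 < r" "compact (closure D \<inter> cball t r \<times> UNIV)"
    using compact_local_closure[OF assms] by metis
  have "closed (closure D \<inter> {t} \<times> UNIV)" by (intro closed_Int closed_Times) auto
  moreover have "closure D \<inter> {t} \<times> UNIV = (closure D \<inter> cball t r \<times> UNIV) \<inter> (closure D \<inter> {t} \<times> UNIV)"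
    using r by auto
  ultimately show ?thesis using r(2) by (metis compact_Int_closed)
qed

text \<open>If \<^term>\<open>\<rho> (t, x) \<le> - \<kappa>\<close>, the ray from \<^term>\<open>x0\<close> through \<^term>\<open>x\<close> stays in the fibre for a
  further relative distance proportional to \<^term>\<open>\<kappa>\<close>, because \<^term>\<open>\<rho>\<close> is Lipschitz there.\<close>

lemma fibre_dilation:
  assumes D: "(t, x0) \<in> D"
  obtains e where "0 < e" "\<And>x \<kappa>. (t, x) \<in> D \<Longrightarrow> 0 < \<kappa> \<Longrightarrow> \<rho> (t, x) \<le> - \<kappa> \<Longrightarrow>
    (t, x0 + (1 + e * \<kappa>) *\<^sub>R (x - x0)) \<in> D"
proof -
  define K where "K = closure D \<inter> {t} \<times> UNIV"
  have tD: "t \<in> fst ` D" using D by force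
  have K: "compact K" "K \<subseteq> W"
    unfolding K_def using compact_fibre_closure[OF tD] closure_sub tD by auto
  have "continuous_on W \<rho>1"
    using derivs unfolding has_C2_derivs_on_def
    by (meson continuous_at_imp_continuous_on has_derivative_continuous)
  then have "compact (\<rho>1 ` K)" using K by (intro compact_continuous_image) (rule continuous_on_subset)
  then obtain L where L: "\<And>p. p \<in> K \<Longrightarrow> norm (\<rho>1 p) \<le> L"
    unfolding compact_eq_bounded_closed bounded_iff by auto
  obtain B where B: "\<And>p. p \<in> K \<Longrightarrow> norm p \<le> B"
    using K(1) unfolding compact_eq_bounded_closed bounded_iff by auto
  have inK: "(t, x0) \<in> K" using D closure_subset[of D] by (auto simp: K_def)
  have L0: "0 \<le> L" using L[OF inK] norm_ge_zero order_trans by blast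
  have B0: "0 \<le> B" using B[OF inK] norm_ge_zero order_trans by blast
  \<comment> \<open>\<open>N\<close> bounds the derivative of \<rho> along the ray, since |x - x0|
    \<le> 2 B; the summand 1 makes it positive.\<close>
  define N where "N = L * (2 * B) + 1"
  have N: "0 < N" using L0 B0 by (simp add: N_def add_nonneg_pos)
  show ?thesis
  \<comment> \<open>The factor 2 leaves room to stay strictly before the exit.\<close>
  proof (rule that[of "1 / (2 * N)"])
    show "0 < 1 / (2 * N)" using N by simp
    fix x \<kappa> assume x: "(t, x) \<in> D" "0 < \<kappa>" "\<rho> (t, x) \<le> - \<kappa>"
    show "(t, x0 + (1 + 1 / (2 * N) * \<kappa>) *\<^sub>R (x - x0)) \<in> D"
    proof (cases "x = x0")
      case False
      define z where "z = x - x0"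
      have z: "z \<noteq> 0" "x0 + 1 *\<^sub>R z = x" using False by (auto simp: z_def)
      define r where "r = exit x0 t z"
      have r: "1 < r" unfolding r_def using less_exit_iff[OF D z(1), of 1] z(2) x(1) by simp
      have eq: "(t, x0) + s *\<^sub>R (0, z) = (t, x0 + s *\<^sub>R z)" for s by simp
      have ray: "(t, x0 + s *\<^sub>R z) \<in> K" if "0 \<le> s" "s \<le> r" for s
        using exit_closure[OF D z(1)] that by (simp add: r_def K_def)
      have "((\<lambda>s. \<rho> (t, x0 + s *\<^sub>R z)) has_real_derivative blinfun_apply (\<rho>1 (t, x0 + s *\<^sub>R z)) (0, z)) (at s)"
        if "1 \<le> s" "s \<le> r" for s
      proof -
        have "(t, x0 + s *\<^sub>R z) \<in> W" using ray[of s] that K(2) by auto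
        then show ?thesis using rho_line_derivative(1)[of "(t, x0)" s "(0, z)"] by (simp only: eq)
      qed
      from MVT2[OF r this] obtain \<xi> where \<xi>: "1 < \<xi>" "\<xi> < r"
        "\<rho> (t, x0 + r *\<^sub>R z) - \<rho> (t, x0 + 1 *\<^sub>R z) = (r - 1) * blinfun_apply (\<rho>1 (t, x0 + \<xi> *\<^sub>R z)) (0, z)"
        by auto
      have "norm x \<le> B" "norm x0 \<le> B"
        using B[OF inK] B[of "(t, x)"] norm_snd_le[of x t] norm_snd_le[of x0 t] x(1) closure_subset[of D]
        by (auto simp: K_def intro: order_trans)
      then have nz: "norm z \<le> 2 * B" using norm_triangle_ineq4[of x x0] by (simp add: z_def)
      have "blinfun_apply (\<rho>1 (t, x0 + \<xi> *\<^sub>R z)) (0, z) \<le> norm (\<rho>1 (t, x0 + \<xi> *\<^sub>R z)) * norm (0::'a, z)"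
        using norm_blinfun[of "\<rho>1 (t, x0 + \<xi> *\<^sub>R z)" "(0, z)"] by simp
      also have "\<dots> \<le> L * (2 * B)"
        using nz L0 L[OF ray[of \<xi>]] \<xi> by (intro mult_mono) (auto simp: norm_Pair)
      also have "\<dots> \<le> N" by (simp add: N_def)
      finally have "(r - 1) * blinfun_apply (\<rho>1 (t, x0 + \<xi> *\<^sub>R z)) (0, z) \<le> (r - 1) * N"
        using r by (intro mult_left_mono) auto
      \<comment> \<open>Between x and the exit, \<rho> rises from at most -\<kappa> to 0.\<close>
      moreover have "\<kappa> \<le> \<rho> (t, x0 + r *\<^sub>R z) - \<rho> (t, x0 + 1 *\<^sub>R z)"
        using rho_exit[OF D z(1)] z(2) x(3) by (simp add: r_def)
      ultimately have "\<kappa> \<le> (r - 1) * N" using \<xi>(3) by simp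
      then have "\<kappa> / N \<le> r - 1" using N by (simp add: field_simps)
      moreover have "1 / (2 * N) * \<kappa> < \<kappa> / N" using N x(2) by (simp add: field_simps)
      ultimately have "1 + 1 / (2 * N) * \<kappa> < r" by linarith
      moreover have "0 \<le> 1 + 1 / (2 * N) * \<kappa>" using N x(2) by (intro add_nonneg_nonneg) auto
      ultimately show ?thesis
        using less_exit_iff[OF D z(1)] by (simp add: r_def z_def)
    qed (use D in simp)
  qed
qed

section \<open>Mass of the fibre over a midpoint\<close>

text \<open>Convexity of \<phi> is the hypothesis of \<open>prekopa_leindler\<close> in logarithmic
  form: at a midpoint, twice \<phi> is at most the sum of its values at the ends. The third function
  is cut off to \<open>M\<close>, the set on which that hypothesis forces it to be positive.\<close>

lemma fibre_mass_midpoint: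
  assumes conv: "convex_on D \<phi>"
    and M: "M = {(1/2) *\<^sub>R (x + y) | x y. x \<in> fibre D a \<and> y \<in> fibre D b}"
  shows "fibre_mass a * fibre_mass b
    \<le> (\<integral>\<^sup>+x. indicator M x * ennreal (exp (- \<phi> ((1/2) *\<^sub>R (a + b), x))) \<partial>lborel)\<^sup>2"
    and "open M" and "M \<subseteq> fibre D ((1/2) *\<^sub>R (a + b))"
proof -
  have mid: "((1/2) *\<^sub>R (a + b), (1/2) *\<^sub>R (x + y)) \<in> D"
    "2 * \<phi> ((1/2) *\<^sub>R (a + b), (1/2) *\<^sub>R (x + y)) \<le> \<phi> (a, x) + \<phi> (b, y)"
    if "(a, x) \<in> D" "(b, y) \<in> D" for x y
  proof -
    have eq: "(1 - 1/2) *\<^sub>R (a, x) + (1/2) *\<^sub>R (b, y) = ((1/2) *\<^sub>R (a + b), (1/2) *\<^sub>R (x + y))"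
      by (simp add: scaleR_add_right)
    have "(1 - 1/2) *\<^sub>R (a, x) + (1/2) *\<^sub>R (b, y) \<in> D"
      using convex_D that by (intro convexD) auto
    then show "((1/2) *\<^sub>R (a + b), (1/2) *\<^sub>R (x + y)) \<in> D" unfolding eq .
    have "\<phi> ((1 - 1/2) *\<^sub>R (a, x) + (1/2) *\<^sub>R (b, y)) \<le> (1 - 1/2) * \<phi> (a, x) + (1/2) * \<phi> (b, y)"
      using conv that by (intro convex_onD) auto
    then show "2 * \<phi> ((1/2) *\<^sub>R (a + b), (1/2) *\<^sub>R (x + y)) \<le> \<phi> (a, x) + \<phi> (b, y)"
      unfolding eq by simp
  qed
  show M_sub: "M \<subseteq> fibre D ((1/2) *\<^sub>R (a + b))"
    using mid(1) by (auto simp: M fibre_def)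
  show M_open: "open M"
  proof -
    \<comment> \<open>A union of translates of a scaled open fibre.\<close>
    have "M = (\<Union>y\<in>fibre D b. (\<lambda>x. (1/2) *\<^sub>R y + (1/2) *\<^sub>R x) ` fibre D a)"
    proof -
      have "(1/2) *\<^sub>R (x + y) = (1/2) *\<^sub>R y + (1/2) *\<^sub>R x" for x y :: 'b
        by (simp add: scaleR_add_right add.commute)
      then show ?thesis unfolding M by (simp only:) blast
    qed
    moreover have "open ((\<lambda>x. (1/2) *\<^sub>R y + (1/2) *\<^sub>R x) ` fibre D a)" for y
      using open_affinity[OF open_fibre[of a], of "1/2" "(1/2) *\<^sub>R y"] by simp
    ultimately show ?thesis by (simp add: open_UN)
  qed
  define f where "f t x = indicator (fibre D t) x * ennreal (exp (- \<phi> (t, x)))" for t x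
  define g where "g x = indicator M x * ennreal (exp (- \<phi> ((1/2) *\<^sub>R (a + b), x)))" for x
  have meas: "f t \<in> borel_measurable borel" "g \<in> borel_measurable borel" for t
    unfolding f_def g_def using M_open M_sub fibre_sub_V
    by (intro fibre_density_measurable open_fibre; blast)+
  have "f a x * f b y \<le> (g ((1/2) *\<^sub>R (x + y)))\<^sup>2" for x y
  proof (cases "x \<in> fibre D a \<and> y \<in> fibre D b")
    case True
    define p where "p = \<phi> ((1/2) *\<^sub>R (a + b), (1/2) *\<^sub>R (x + y))"
    have "(1/2) *\<^sub>R (x + y) \<in> M" using True unfolding M by blast
    then have g: "g ((1/2) *\<^sub>R (x + y)) = ennreal (exp (- p))" by (simp add: g_def p_def)
    have "f a x * f b y = ennreal (exp (- \<phi> (a, x)) * exp (- \<phi> (b, y)))"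
      using True by (simp add: f_def ennreal_mult)
    also have "exp (- \<phi> (a, x)) * exp (- \<phi> (b, y)) = exp (- (\<phi> (a, x) + \<phi> (b, y)))"
      by (simp add: mult_exp_exp)
    also have "ennreal \<dots> \<le> ennreal (exp (2 * - p))"
      using mid(2)[of x y] True by (intro ennreal_leI) (simp add: fibre_def p_def)
    also have "\<dots> = (g ((1/2) *\<^sub>R (x + y)))\<^sup>2"
      unfolding g exp_double by (simp add: ennreal_power)
    finally show ?thesis .
  qed (auto simp: f_def)
  then have PL: "(\<integral>\<^sup>+x. f a x \<partial>lborel) * (\<integral>\<^sup>+x. f b x \<partial>lborel) \<le> (\<integral>\<^sup>+x. g x \<partial>lborel)\<^sup>2"
    by (intro prekopa_leindler[of "f a" "f b" g] meas)
  have "fibre_mass t = (\<integral>\<^sup>+x. f t x \<partial>lborel)" for t by (simp only: fibre_mass_def f_def)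
  moreover have "(\<integral>\<^sup>+x. indicator M x * ennreal (exp (- \<phi> ((1/2) *\<^sub>R (a + b), x))) \<partial>lborel) = (\<integral>\<^sup>+x. g x \<partial>lborel)"
    by (simp only: g_def)
  ultimately show "fibre_mass a * fibre_mass b
    \<le> (\<integral>\<^sup>+x. indicator M x * ennreal (exp (- \<phi> ((1/2) *\<^sub>R (a + b), x))) \<partial>lborel)\<^sup>2"
    using PL by (simp only:)
qed

text \<open>The fibre contains a translate of (1 + e) M, whose volume is at least 1 + e times that
  of \<open>M\<close> as the dimension is positive. So the fibre has volume at least e \<beta>
  outside \<open>M\<close>, where the density is at least \<gamma>.\<close>

lemma fibre_mass_gain:
  assumes M: "open M" "M \<subseteq> fibre D t" and t: "t \<in> fst ` D"
    and \<gamma>: "\<And>x. x \<in> fibre D t \<Longrightarrow> \<gamma> \<le> exp (- \<phi> (t, x))" "0 \<le> \<gamma>"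
    and e: "0 < e" and dil: "\<And>x. x \<in> M \<Longrightarrow> x0 + (1 + e) *\<^sub>R (x - x0) \<in> fibre D t"
    and \<beta>: "\<beta> \<le> measure lborel M"
  shows "(\<integral>\<^sup>+x. indicator M x * ennreal (exp (- \<phi> (t, x))) \<partial>lborel) + ennreal (\<gamma> * (e * \<beta>)) \<le> fibre_mass t"
proof -
  let ?F = "fibre D t"
  have [measurable]: "M \<in> sets borel" "?F \<in> sets borel" using M(1) open_fibre by auto
  have fin: "emeasure lborel ?F \<noteq> \<infinity>"
    using emeasure_bounded_finite[OF bounded_fibre[OF t]] by auto
  have fM: "M \<in> fmeasurable lborel" "?F \<in> fmeasurable lborel"
    using fin emeasure_mono[OF M(2), of lborel] by (auto simp: fmeasurable_def less_top[symmetric] top_unique)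
  define T where "T x = (1 + e) *\<^sub>R x + (x0 - (1 + e) *\<^sub>R x0)" for x
  have "T ` M \<subseteq> ?F"
    using dil by (auto simp: T_def algebra_simps)
  moreover have T_open: "open (T ` M)"
    using open_affinity[OF M(1), of "1 + e" "x0 - (1 + e) *\<^sub>R x0"] e by (simp add: T_def add.commute image_image)
  ultimately have "measure lborel (T ` M) \<le> measure lborel ?F"
    using fM by (intro measure_mono_fmeasurable) auto
  moreover have "measure lborel (T ` M) = \<bar>1 + e\<bar> ^ DIM('b) * measure lborel M"
    using measure_lebesgue_affine[of "1 + e" "x0 - (1 + e) *\<^sub>R x0" M] T_open M(1)
    by (simp add: T_def[abs_def] measure_completion)
  moreover have "(1 + e) * measure lborel M \<le> (1 + e) ^ DIM('b) * measure lborel M"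
    using e self_le_power[of "1 + e" "DIM('b)"] by (intro mult_right_mono) auto
  ultimately have "(1 + e) * measure lborel M \<le> measure lborel ?F" using e by simp
  moreover have "measure lborel (?F - M) = measure lborel ?F - measure lborel M"
    using fM M(2) by (intro measure_Diff) (auto simp: fmeasurable_def)
  ultimately have "e * measure lborel M \<le> measure lborel (?F - M)" by (simp add: algebra_simps)
  moreover have "e * \<beta> \<le> e * measure lborel M" using \<beta> e by simp
  ultimately have "e * \<beta> \<le> measure lborel (?F - M)" by linarith
  then have "\<gamma> * (e * \<beta>) \<le> \<gamma> * measure lborel (?F - M)" using \<gamma>(2) by (rule mult_left_mono)
  moreover have "emeasure lborel (?F - M) = ennreal (measure lborel (?F - M))"
    using fM by (intro emeasure_eq_measure2 fmeasurable_Diff) auto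
  ultimately have "ennreal (\<gamma> * (e * \<beta>)) \<le> ennreal \<gamma> * emeasure lborel (?F - M)"
    using \<gamma>(2) by (simp add: ennreal_leI flip: ennreal_mult)
  also have "\<dots> = (\<integral>\<^sup>+x. ennreal \<gamma> * indicator (?F - M) x \<partial>lborel)" by (simp add: nn_integral_cmult)
  finally have "(\<integral>\<^sup>+x. indicator M x * ennreal (exp (- \<phi> (t, x))) \<partial>lborel) + ennreal (\<gamma> * (e * \<beta>))
    \<le> (\<integral>\<^sup>+x. indicator M x * ennreal (exp (- \<phi> (t, x))) \<partial>lborel) + (\<integral>\<^sup>+x. ennreal \<gamma> * indicator (?F - M) x \<partial>lborel)"
    by (rule add_left_mono)
  also have "\<dots> = (\<integral>\<^sup>+x. indicator M x * ennreal (exp (- \<phi> (t, x))) + ennreal \<gamma> * indicator (?F - M) x \<partial>lborel)"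
    using fibre_density_measurable[OF M(1), of t] M(2) fibre_sub_V
    by (intro nn_integral_add[symmetric]) auto
  also have "\<dots> \<le> fibre_mass t"
    unfolding fibre_mass_def
    by (intro nn_integral_mono) (use \<gamma>(1) M(2) in \<open>auto split: split_indicator intro: ennreal_leI\<close>)
  finally show ?thesis .
qed

lemma fibre_mass_strict_midpoint:
  assumes conv: "convex_on D \<phi>" and t0: "t0 \<in> fst ` D" and v: "v \<noteq> 0"
  obtains C \<delta> where "0 < C" "0 < \<delta>" "\<And>h. 0 < h \<Longrightarrow> h < \<delta> \<Longrightarrow>
    sqrt (enn2real (fibre_mass (t0 + h *\<^sub>R v)) * enn2real (fibre_mass (t0 - h *\<^sub>R v))) + C * h\<^sup>2
      \<le> enn2real (fibre_mass t0)"
proof -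
  obtain x0 where x0: "(t0, x0) \<in> D" using t0 by auto
  then obtain r0 where r0: "0 < r0" "ball (t0, x0) r0 \<subseteq> D" using open_D open_contains_ball by metis
  obtain r where r: "0 < r" "cball t0 r \<subseteq> fst ` D" "compact (closure D \<inter> cball t0 r \<times> UNIV)"
    by (rule compact_local_closure[OF t0])
  define K where "K = closure D \<inter> cball t0 r \<times> UNIV"
  have K: "compact K" "K \<subseteq> W" "K \<subseteq> V"
    using r closure_sub closure_sub_V by (auto simp: K_def)
  obtain c where c: "0 < c" "\<And>p q. closed_segment p q \<subseteq> K \<Longrightarrow>
      \<rho> ((1/2) *\<^sub>R (p + q)) \<le> (\<rho> p + \<rho> q) / 2 - c * (norm (q - p))\<^sup>2"
    by (rule rho_midpoint_gap[OF K(1,2)], rule that)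
  obtain e where e: "0 < e" "\<And>x \<kappa>. (t0, x) \<in> D \<Longrightarrow> 0 < \<kappa> \<Longrightarrow> \<rho> (t0, x) \<le> - \<kappa> \<Longrightarrow>
      (t0, x0 + (1 + e * \<kappa>) *\<^sub>R (x - x0)) \<in> D"
    by (rule fibre_dilation[OF x0], rule that)
  have "compact (\<phi> ` K)" using K by (intro compact_continuous_image continuous_on_subset[OF phi_continuous])
  then obtain B where B: "\<And>p. p \<in> K \<Longrightarrow> \<bar>\<phi> p\<bar> \<le> B"
    unfolding compact_eq_bounded_closed bounded_iff by (metis imageI real_norm_def)
  define \<gamma> where "\<gamma> = exp (- B)"
  have \<gamma>: "0 < \<gamma>" "\<And>x. x \<in> fibre D t0 \<Longrightarrow> \<gamma> \<le> exp (- \<phi> (t0, x))"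
  proof -
    fix x assume "x \<in> fibre D t0"
    then have "(t0, x) \<in> K" using r(1) closure_subset[of D] by (auto simp: fibre_def K_def)
    from B[OF this] show "\<gamma> \<le> exp (- \<phi> (t0, x))" by (simp add: \<gamma>_def)
  qed (simp add: \<gamma>_def)
  \<comment> \<open>Every midpoint set \<open>M\<close> considered below contains this ball, so its
    volume has a lower bound independent of h.\<close>
  define \<beta> where "\<beta> = measure lborel (ball x0 (r0 / 2))"
  have "0 < \<beta>" unfolding \<beta>_def using content_ball_pos[of "r0 / 2" x0] r0(1) by simp
  \<comment> \<open>Points over t0 + h v and t0 - h v are at distance at least 2 h |v|, so \<rho> is
    at most -k h^2 at their midpoint.\<close>
  define k where "k = c * (2 * norm v)\<^sup>2"
  have k: "0 < k" using c v by (simp add: k_def)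
  define C where "C = \<gamma> * (e * k * \<beta>)"
  have C: "0 < C" using \<gamma> e k \<open>0 < \<beta>\<close> by (simp add: C_def)
  \<comment> \<open>Keeps h |v| below \<open>r\<close>, so that segments between the two fibres stay
    in \<open>K\<close>, and below \<open>r0\<close> / 2, so that both fibres contain the ball of
    radius \<open>r0\<close> / 2 around \<open>x0\<close>.\<close>
  define \<delta> where "\<delta> = min r (r0 / 2) / norm v"
  have \<delta>: "0 < \<delta>" using r r0 v by (simp add: \<delta>_def)
  show ?thesis
  proof (rule that[OF C \<delta>])
    fix h assume h: "0 < h" "h < \<delta>"
    define a where "a = t0 + h *\<^sub>R v"
    define b where "b = t0 - h *\<^sub>R v"
    have hv: "h * norm v < min r (r0/2)" using h v by (simp add: \<delta>_def field_simps)
    have ab: "dist t0 a < min r (r0/2)" "dist t0 b < min r (r0/2)"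
      using hv h(1) by (auto simp: a_def b_def dist_norm)
    have "a + b = 2 *\<^sub>R t0" unfolding a_def b_def scaleR_2 by simp
    then have mid: "(1/2) *\<^sub>R (a + b) = t0" by simp
    have ab_cball: "a \<in> cball t0 r" "b \<in> cball t0 r" using ab by auto
    then have abD: "a \<in> fst ` D" "b \<in> fst ` D" using r(2) by (blast dest: subsetD)+
    define M where "M = {(1/2) *\<^sub>R (x + y) | x y. x \<in> fibre D a \<and> y \<in> fibre D b}"
    note PL = fibre_mass_midpoint[OF conv M_def, unfolded mid]
    have gap: "\<rho> (t0, (1/2) *\<^sub>R (x + y)) \<le> - (k * h\<^sup>2)" if "(a, x) \<in> D" "(b, y) \<in> D" for x y
    proof -
      have seg: "closed_segment (a, x) (b, y) \<subseteq> K"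
      proof
        fix p assume p: "p \<in> closed_segment (a, x) (b, y)"
        then have "p \<in> closure D"
          using closed_segment_subset[OF that convex_D] closure_subset by blast
        moreover obtain u where u: "p = (1 - u) *\<^sub>R (a, x) + u *\<^sub>R (b, y)" "0 \<le> u" "u \<le> 1"
          using p unfolding in_segment by blast
        have "fst p \<in> closed_segment a b" unfolding in_segment u(1) using u(2,3) by (intro exI[of _ u]) simp
        then have "fst p \<in> cball t0 r"
          using closed_segment_subset[OF ab_cball convex_cball] by blast
        ultimately show "p \<in> K" unfolding K_def by (simp add: mem_Times_iff)
      qed
      have neg: "\<rho> (a, x) < 0" "\<rho> (b, y) < 0" using that D_eq by auto
      have mid_xy: "(1/2) *\<^sub>R ((a, x) + (b, y)) = (t0, (1/2) *\<^sub>R (x + y))" using mid by simp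
      have "b - a = - (2 *\<^sub>R (h *\<^sub>R v))" unfolding a_def b_def scaleR_2 by simp
      then have "norm (b - a) = 2 * norm v * h" using h by simp
      then have "2 * norm v * h \<le> norm ((b, y) - (a, x))" using norm_fst_le[of "b - a" "y - x"] by simp
      then have "(2 * norm v * h)\<^sup>2 \<le> (norm ((b, y) - (a, x)))\<^sup>2" using h(1) by (intro power_mono) auto
      then have "k * h\<^sup>2 \<le> c * (norm ((b, y) - (a, x)))\<^sup>2"
        unfolding k_def mult.assoc using c(1) by (intro mult_left_mono) (simp_all only: power_mult_distrib mult.assoc less_imp_le)
      \<comment> \<open>The endpoints lie in \<open>D\<close>, so the mean of their values of \<rho>
        is negative and may be dropped.\<close>
      moreover have "m \<le> - p" if "r1 < 0" "r2 < 0" "p \<le> q" "m \<le> (r1 + r2) / 2 - q" for m p q r1 r2 :: real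
        using that by argo
      ultimately show ?thesis using neg c(2)[OF seg, unfolded mid_xy] by blast
    qed
    have dil: "x0 + (1 + e * (k * h\<^sup>2)) *\<^sub>R (p - x0) \<in> fibre D t0" if p: "p \<in> M" for p
    proof -
      obtain x y where xy: "p = (1/2) *\<^sub>R (x + y)" "(a, x) \<in> D" "(b, y) \<in> D"
        using p unfolding M_def fibre_def by blast
      have "(t0, p) \<in> D" using PL(3) p by (auto simp: fibre_def)
      from e(2)[OF this, of "k * h\<^sup>2"] show ?thesis using gap[OF xy(2,3)] k h by (simp add: fibre_def xy(1))
    qed
    have ball_M: "ball x0 (r0 / 2) \<subseteq> M"
    proof
      fix x assume x: "x \<in> ball x0 (r0 / 2)"
      have "(\<tau>, x) \<in> D" if "dist t0 \<tau> < r0 / 2" for \<tau>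
      proof -
        have "dist (t0, x0) (\<tau>, x) \<le> dist t0 \<tau> + dist x0 x"
          by (simp add: dist_Pair_Pair sqrt_sum_squares_le_sum)
        then show ?thesis using that x r0(2) by auto
      qed
      then have "x \<in> fibre D a" "x \<in> fibre D b" using ab by (auto simp: fibre_def)
      moreover have "x = (1/2) *\<^sub>R (x + x)" by (simp flip: scaleR_2)
      ultimately show "x \<in> M" unfolding M_def by blast
    qed
    have \<beta>: "\<beta> \<le> measure lborel M"
      unfolding \<beta>_def
    proof (rule measure_mono_fmeasurable[OF ball_M])
      have "emeasure lborel M \<le> emeasure lborel (fibre D t0)"
        using PL(3) open_fibre by (intro emeasure_mono) auto
      also have "\<dots> < \<infinity>" by (rule emeasure_bounded_finite[OF bounded_fibre[OF t0]])
      finally show "M \<in> fmeasurable lborel" using PL(2) by (auto simp: fmeasurable_def)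
    qed simp
    define m where "m = (\<integral>\<^sup>+x. indicator M x * ennreal (exp (- \<phi> (t0, x))) \<partial>lborel)"
    have "m + ennreal (\<gamma> * (e * (k * h\<^sup>2) * \<beta>)) \<le> fibre_mass t0"
      unfolding m_def
      using \<gamma> e(1) k h by (intro fibre_mass_gain[OF PL(2,3) t0 _ _ _ dil \<beta>]) auto
    then have gain: "m + ennreal (C * h\<^sup>2) \<le> fibre_mass t0" by (simp add: C_def ac_simps)
    obtain A B N where ABN: "fibre_mass a = ennreal A" "fibre_mass b = ennreal B" "fibre_mass t0 = ennreal N"
      "0 \<le> A" "0 \<le> B" "0 \<le> N"
      using fibre_mass_finite[OF abD(1)] fibre_mass_finite[OF abD(2)] fibre_mass_finite[OF t0]
      by (cases "fibre_mass a"; cases "fibre_mass b"; cases "fibre_mass t0") auto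
    have "m \<noteq> \<infinity>" using gain ABN(3) by (auto simp: top_unique)
    then obtain m' where m': "m = ennreal m'" "0 \<le> m'" by (cases m) auto
    have "ennreal (A * B) \<le> ennreal (m'\<^sup>2)"
      using PL(1) ABN m' by (simp add: m_def[symmetric] ennreal_mult ennreal_power)
    then have "A * B \<le> m'\<^sup>2" using ABN by (simp add: ennreal_le_iff)
    then have "sqrt (A * B) \<le> m'" using m'(2) real_le_lsqrt by blast
    moreover have "ennreal (m' + C * h\<^sup>2) \<le> ennreal N" using gain ABN m' C by (simp add: ennreal_plus)
    then have "m' + C * h\<^sup>2 \<le> N" using ABN by (simp add: ennreal_le_iff)
    ultimately show "sqrt (enn2real (fibre_mass (t0 + h *\<^sub>R v)) * enn2real (fibre_mass (t0 - h *\<^sub>R v))) + C * h\<^sup>2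
      \<le> enn2real (fibre_mass t0)"
      using ABN by (simp flip: a_def b_def)
  qed
qed

section \<open>Lebesgue integrals of the fibres and the Hessian of the marginal\<close>

lemma fibre_integrable:
  assumes "t \<in> fst ` D"
  shows "set_integrable lborel (fibre D t) (\<lambda>x. exp (- \<phi> (t, x)))"
    and "(LINT x:fibre D t|lborel. exp (- \<phi> (t, x))) = enn2real (fibre_mass t)"
proof -
  let ?f = "\<lambda>x. indicator (fibre D t) x *\<^sub>R exp (- \<phi> (t, x))"
  have eq: "ennreal (?f x) = indicator (fibre D t) x * ennreal (exp (- \<phi> (t, x)))" for x
    by (auto split: split_indicator)
  have meas: "?f \<in> borel_measurable borel"
    using open_fibre fibre_sub_V
    by (intro borel_measurable_continuous_on_indicator continuous_intros continuous_on_fibre_phi) auto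
  have mass: "(\<integral>\<^sup>+x. ennreal (?f x) \<partial>lborel) = fibre_mass t" unfolding fibre_mass_def eq ..
  show "set_integrable lborel (fibre D t) (\<lambda>x. exp (- \<phi> (t, x)))"
    unfolding set_integrable_def
    using meas fibre_mass_finite[OF assms] mass by (intro integrableI_nonneg) auto
  show "(LINT x:fibre D t|lborel. exp (- \<phi> (t, x))) = enn2real (fibre_mass t)"
    unfolding set_lebesgue_integral_def mass[symmetric] using meas by (intro integral_eq_nn_integral) auto
qed

text \<open>The density is Borel measurable, and passing to the completion leaves integrals of Borel
  functions unchanged.\<close>

lemma fibre_integrable_lebesgue:
  assumes "t \<in> fst ` D"
  shows "set_integrable lebesgue (fibre D t) (\<lambda>x. exp (- \<phi> (t, x)))"
    and "(LINT x:fibre D t|lebesgue. exp (- \<phi> (t, x))) = enn2real (fibre_mass t)"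
proof -
  have meas: "(\<lambda>x. indicator (fibre D t) x *\<^sub>R exp (- \<phi> (t, x))) \<in> borel_measurable lborel"
    using fibre_integrable(1)[OF assms] unfolding set_integrable_def by (rule borel_measurable_integrable)
  show "set_integrable lebesgue (fibre D t) (\<lambda>x. exp (- \<phi> (t, x)))"
    using fibre_integrable(1)[OF assms] unfolding set_integrable_def integrable_completion[OF meas] .
  show "(LINT x:fibre D t|lebesgue. exp (- \<phi> (t, x))) = enn2real (fibre_mass t)"
    using fibre_integrable(2)[OF assms] unfolding set_lebesgue_integral_def integral_completion[OF meas] .
qed

lemma enn2real_fibre_mass_pos: "t \<in> fst ` D \<Longrightarrow> 0 < enn2real (fibre_mass t)"
  using fibre_mass_pos fibre_mass_finite by (simp add: enn2real_positive_iff)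

text \<open>With S the geometric mean of the masses at t + h v and t - h v, the inequality ln y
  \<le> y - 1 at y = S / N t turns the additive deficit C h^2 into ln (N t) - ln S \<ge> C h^2 / N
  t; the second difference of - ln N is twice the left-hand side.\<close>

lemma C2_strictly_convex_neg_ln_fibre_mass:
  assumes conv: "convex_on D \<phi>"
  shows "C2_strictly_convex_on (fst ` D) (\<lambda>t. - ln (enn2real (fibre_mass t)))"
proof -
  define N where "N t = enn2real (fibre_mass t)" for t
  have N_pos: "0 < N t" if "t \<in> fst ` D" for t
    unfolding N_def by (rule enn2real_fibre_mass_pos[OF that])
  have open_U: "open (fst ` D)" by (rule open_image_fst[OF open_D])
  have "C2_differentiable (fst ` D) N" unfolding N_def[abs_def] by (rule C2_differentiable_fibre_mass)
  then have "C2_differentiable (fst ` D) (\<lambda>t. ln (N t))"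
    by (rule C2_differentiable_compose[OF _ C2_differentiable_ln _ open_U]) (use N_pos in auto)
  then have "C2_differentiable (fst ` D) (\<lambda>t. (-1) *\<^sub>R ln (N t))"
    by (intro C2_differentiable_scaleR C2_differentiable_const)
  then have "C2_differentiable (fst ` D) (\<lambda>t. - ln (N t))" by simp
  then obtain D1 D2 where der: "has_C2_derivs_on (\<lambda>t. - ln (N t)) D1 D2 (fst ` D)"
    by (rule C2_differentiable_imp_has_C2_derivs_on)
  have "0 < blinfun_apply (blinfun_apply (D2 t) v) v" if t: "t \<in> fst ` D" and v: "v \<noteq> 0" for t v
  proof -
    obtain C \<delta> where C: "0 < C" "0 < \<delta>" "\<And>h. 0 < h \<Longrightarrow> h < \<delta> \<Longrightarrow>
        sqrt (N (t + h *\<^sub>R v) * N (t - h *\<^sub>R v)) + C * h\<^sup>2 \<le> N t"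
      by (rule fibre_mass_strict_midpoint[OF conv t v, folded N_def], erule that)
    obtain r where r: "0 < r" "ball t r \<subseteq> fst ` D" using open_U t open_contains_ball by metis
    \<comment> \<open>Both t + h v and t - h v must stay in the base, where the mass is
      positive.\<close>
    define d where "d = min \<delta> (r / norm v)"
    show ?thesis
    proof (rule has_C2_derivs_on_second_difference[OF der open_U t])
      show "0 < 2 * C / N t" using C N_pos[OF t] by simp
      show "0 < d" using C r v by (simp add: d_def)
      fix h assume h: "0 < h" "h < d"
      then have hv: "h * norm v < r" using v by (simp add: d_def field_simps)
      have "t + h *\<^sub>R v \<in> ball t r" "t - h *\<^sub>R v \<in> ball t r" using hv h by (simp_all add: dist_norm)
      then have pos: "0 < N (t + h *\<^sub>R v)" "0 < N (t - h *\<^sub>R v)" using r(2) N_pos by blast+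
      define S where "S = sqrt (N (t + h *\<^sub>R v) * N (t - h *\<^sub>R v))"
      have S: "0 < S" using pos by (simp add: S_def)
      have "S + C * h\<^sup>2 \<le> N t" using C(3)[of h] h by (simp add: S_def d_def)
      then have "C * h\<^sup>2 / N t \<le> 1 - S / N t" using N_pos[OF t] by (simp add: field_simps)
      also have "\<dots> \<le> - ln (S / N t)" using ln_le_minus_one[of "S / N t"] S N_pos[OF t] by simp
      also have "\<dots> = ln (N t) - ln S" using S N_pos[OF t] by (simp add: ln_div)
      also have "ln S = (ln (N (t + h *\<^sub>R v)) + ln (N (t - h *\<^sub>R v))) / 2"
        using pos by (simp add: S_def ln_sqrt ln_mult)
      finally show "2 * C / N t * h\<^sup>2 \<le> - ln (N (t + h *\<^sub>R v)) + - ln (N (t - h *\<^sub>R v)) - 2 * - ln (N t)"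
        by (simp add: field_simps)
    qed
  qed
  with der show ?thesis unfolding C2_strictly_convex_on_def N_def by blast
qed

end

theorem corollary1p7:
  fixes U\<^sub>0 :: "(real^'n) set"
    and D W :: "((real^'n) \<times> (real^'m)) set"
    and \<phi> :: "(real^'n) \<times> (real^'m) \<Rightarrow> real"
  assumes "is_domain U\<^sub>0"
    and "strictly_convex_family_of_bounded_domains U\<^sub>0 D"
    and "nbhd_of_rel_closure U\<^sub>0 D W"
    and "C2_convex_on W \<phi>"
  shows "(\<forall>t\<in>U\<^sub>0. set_integrable lebesgue (fibre D t) (\<lambda>x. exp (- \<phi> (t, x))) \<and>
            exp (- marginal D \<phi> t) = fibre_integral D \<phi> t) \<and>
         C2_strictly_convex_on U\<^sub>0 (marginal D \<phi>)"
proof -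
  have family: "strictly_convex_family U\<^sub>0 D" and bdd: "\<forall>t\<in>U\<^sub>0. bounded (fibre D t)"
    using assms(2) by (auto simp: strictly_convex_family_of_bounded_domains_def)
  have D: "open D" "convex D" "fst ` D = U\<^sub>0" "D \<subseteq> U\<^sub>0 \<times> UNIV"
    using family by (auto simp: strictly_convex_family_def is_domain_def)
  obtain W' \<rho> where W': "nbhd_of_rel_closure U\<^sub>0 D W'" "C2_strictly_convex_on W' \<rho>"
    "D = {(t, x) \<in> W'. \<rho> (t, x) < 0}"
    using family unfolding strictly_convex_family_def by blast
  obtain \<rho>1 \<rho>2 where \<rho>: "has_C2_derivs_on \<rho> \<rho>1 \<rho>2 W'"
    "\<forall>x\<in>W'. \<forall>v. v \<noteq> 0 \<longrightarrow> 0 < blinfun_apply (blinfun_apply (\<rho>2 x) v) v"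
    using W'(2) unfolding C2_strictly_convex_on_def by blast
  obtain \<phi>1 \<phi>2 where \<phi>: "has_C2_derivs_on \<phi> \<phi>1 \<phi>2 W"
    using assms(4) unfolding C2_convex_on_def C2_on_def by blast
  interpret C2_weighted_convex_family D W' \<rho> \<rho>1 \<rho>2 W \<phi>
  proof
    show "D = {p \<in> W'. \<rho> p < 0}" using W'(3) by auto
    show "C2_differentiable W \<phi>" by (rule has_C2_derivs_on_imp_C2_differentiable[OF \<phi>])
  qed (use D bdd W'(1) \<rho> assms(3) in \<open>auto simp: nbhd_of_rel_closure_def\<close>)
  have "convex_on D \<phi>"
    using assms(4) D(2) D_sub_V unfolding C2_convex_on_def by blast
  then have "C2_strictly_convex_on U\<^sub>0 (\<lambda>t. - ln (enn2real (fibre_mass t)))"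
    using C2_strictly_convex_neg_ln_fibre_mass D(3) by simp
  then obtain D1 D2 where der: "has_C2_derivs_on (\<lambda>t. - ln (enn2real (fibre_mass t))) D1 D2 U\<^sub>0"
    "\<forall>x\<in>U\<^sub>0. \<forall>v. v \<noteq> 0 \<longrightarrow> 0 < blinfun_apply (blinfun_apply (D2 x) v) v"
    unfolding C2_strictly_convex_on_def by blast
  have integral: "fibre_integral D \<phi> t = enn2real (fibre_mass t)" if "t \<in> U\<^sub>0" for t
    using fibre_integrable_lebesgue(2)[of t] that D(3) by (simp add: fibre_integral_def)
  then have eq: "- ln (enn2real (fibre_mass t)) = marginal D \<phi> t" if "t \<in> U\<^sub>0" for t
    using that by (simp add: marginal_def)
  have open_U: "open U\<^sub>0" using assms(1) by (simp add: is_domain_def)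
  \<comment> \<open>The two functions are known to agree on \<open>U\<^sub>0\<close>, which is open,
    so two-sided derivatives at its points carry over.\<close>
  have "has_C2_derivs_on (marginal D \<phi>) D1 D2 U\<^sub>0"
    using der(1) has_derivative_cong_open[where f = "\<lambda>t. - ln (enn2real (fibre_mass t))" and g = "marginal D \<phi>", OF _ open_U _ eq]
    unfolding has_C2_derivs_on_def by blast
  then have "C2_strictly_convex_on U\<^sub>0 (marginal D \<phi>)"
    using der(2) unfolding C2_strictly_convex_on_def by blast
  \<comment> \<open>Positivity of the mass rules out the default value of \<open>ln\<close>.\<close>
  moreover have "exp (- marginal D \<phi> t) = fibre_integral D \<phi> t" if "t \<in> U\<^sub>0" for t
    using enn2real_fibre_mass_pos[of t] that D(3) integral[OF that] by (simp add: marginal_def)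
  ultimately show ?thesis
    using fibre_integrable_lebesgue(1) D(3) by simp
qed

end
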